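(* Let $n\ge2$ and let $\nabla^{(m)}$ and $\nabla^{(e)}$ be the mixture and exponential connections on the manifold $\mathcal M$ of positive definite $n\times n$ matrices. For $p\in[0,1]$, the connection $p\nabla^{(m)}+(1-p)\nabla^{(e)}$ is flat if and only if $p=0$ or $p=1$. In particular, for every $\alpha\in(-1,1)$ the connection $\frac{1+\alpha}{2}\nabla^{(e)}+\frac{1-\alpha}{2}\nabla^{(m)}$ is not flat and is different from the $\alpha$-connection $\nabla^{(\alpha)}$.
   Context: $\mathcal M_h$ is the real vector space of Hermitian $n\times n$ complex matrices and $\mathcal M\subset\mathcal M_h$ the open subset of positive definite matrices, a differentiable manifold with every tangent space identified with $\mathcal M_h$; vector fields are $\mathcal M_h$-valued functions on $\mathcal M$. The $\alpha$-connection $\nabla^{(\alpha)}$ ($\alpha\in\mathbb R$): let $f_\alpha(x)=\frac{2}{1-\alpha}x^{\frac{1-\alpha}{2}}$ for $\alpha\ne1$, $f_1(x)=\log x$, and $L_\alpha[\rho](X)=\frac{d}{ds}f_\alpha(\rho+sX)|_{s=0}$ (an invertible linear operator on $\mathcal M_h$). Then $\nabla^{(\alpha)}$ is defined by $L_\alpha[\rho]\big((\nabla^{(\alpha)}_{\mathcal X}\mathcal Y)(\rho)\big)=\mathcal X\mathcal Y f_\alpha(\rho)$ for smooth vector fields $\mathcal X,\mathcal Y$, i.e. the derivative along $\mathcal X$ of the function $\rho\mapsto L_\alpha[\rho](Y(\rho))$, where $Y(\rho)\in\mathcal M_h$ is the value of $\mathcal Y$ at $\rho$. The mixture connection is $\nabla^{(m)}=\nabla^{(-1)}$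 (the flat affine structure inherited from $\mathcal M_h$) and the exponential connection is $\nabla^{(e)}=\nabla^{(1)}$. A connection is flat if it is torsion-free and its Riemannian curvature tensor vanishes. *)

theory Defs
  imports "HOL-Analysis.Analysis"
begin

section \<open>Hermitian and positive definite matrices\<close>

type_synonym 'n cmat = "complex^'n^'n"

definition conj_transpose :: "'n::finite cmat \<Rightarrow> 'n cmat" where
  "conj_transpose A = (\<chi> i j. cnj (A $ j $ i))"

definition Herm :: "'n::finite cmat set" where
  "Herm = {A. conj_transpose A = A}"

text \<open>The inner product on \<^typ>\<open>complex^'n\<close> is the real one, i.e. the real part of the
  sesquilinear product; for Hermitian \<open>A\<close> the number \<open>v* A v\<close> is real anyway.\<close>

definition PD :: "'n::finite cmat set" where
  "PD = {A \<in> Herm. \<forall>v. v \<noteq> 0 \<longrightarrow> v \<bullet> (A *v v) > 0}"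

section \<open>Functional calculus\<close>

definition unitary_mat :: "'n::finite cmat \<Rightarrow> bool" where
  "unitary_mat U \<longleftrightarrow> U ** conj_transpose U = mat 1 \<and> conj_transpose U ** U = mat 1"

definition real_diag :: "('n::finite \<Rightarrow> real) \<Rightarrow> 'n cmat" where
  "real_diag d = (\<chi> i j. if i = j then complex_of_real (d i) else 0)"

definition herm_fun :: "(real \<Rightarrow> real) \<Rightarrow> 'n::finite cmat \<Rightarrow> 'n cmat" where
  "herm_fun f A = (THE B. \<exists>U d. unitary_mat U \<and>
      A = U ** real_diag d ** conj_transpose U \<and>
      B = U ** real_diag (\<lambda>i. f (d i)) ** conj_transpose U)"

section \<open>Smooth vector fields\<close>

text \<open>A vector field is given by a function on all matrices, of which only the values on
  \<^const>\<open>PD\<close> matter. As \<^const>\<open>PD\<close> is relatively open in the real subspace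
  \<^const>\<open>Herm\<close>, the derivative within \<^const>\<open>PD\<close> is determined exactly on the
  directions in \<^const>\<open>Herm\<close>, the only ones used below.\<close>

type_synonym 'n vfield = "'n cmat \<Rightarrow> 'n cmat"

primrec C_k_on_PD :: "nat \<Rightarrow> 'n::finite vfield \<Rightarrow> bool" where
  "C_k_on_PD 0 F \<longleftrightarrow> continuous_on PD F"
| "C_k_on_PD (Suc k) F \<longleftrightarrow>
     (\<exists>F'. (\<forall>\<rho>\<in>PD. (F has_derivative F' \<rho>) (at \<rho> within PD)) \<and>
           (\<forall>V\<in>Herm. C_k_on_PD k (\<lambda>\<rho>. F' \<rho> V)))"

definition smooth_vfield :: "'n::finite vfield \<Rightarrow> bool" where
  "smooth_vfield X \<longleftrightarrow> (\<forall>\<rho>\<in>PD. X \<rho> \<in> Herm) \<and> (\<forall>k. C_k_on_PD k X)"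

definition dir_deriv :: "'n::finite vfield \<Rightarrow> 'n vfield \<Rightarrow> 'n vfield" where
  "dir_deriv X F \<rho> = vector_derivative (\<lambda>s::real. F (\<rho> + s *\<^sub>R X \<rho>)) (at 0)"

definition lie_bracket :: "'n::finite vfield \<Rightarrow> 'n vfield \<Rightarrow> 'n vfield" where
  "lie_bracket X Y \<rho> = dir_deriv X Y \<rho> - dir_deriv Y X \<rho>"

section \<open>Connections, torsion, curvature\<close>

text \<open>A connection is represented by its covariant derivative, \<open>D X Y\<close> being
  \<open>\<nabla>\<close> of \<open>Y\<close> along \<open>X\<close>.\<close>

type_synonym 'n conn = "'n vfield \<Rightarrow> 'n vfield \<Rightarrow> 'n vfield"

definition conn_torsion :: "'n::finite conn \<Rightarrow> 'n conn" where
  "conn_torsion D X Y \<rho> = D X Y \<rho> - D Y X \<rho> - lie_bracket X Y \<rho>"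

definition conn_curvature ::
    "'n::finite conn \<Rightarrow> 'n vfield \<Rightarrow> 'n vfield \<Rightarrow> 'n vfield \<Rightarrow> 'n vfield" where
  "conn_curvature D X Y Z \<rho> =
     D X (D Y Z) \<rho> - D Y (D X Z) \<rho> - D (lie_bracket X Y) Z \<rho>"

definition flat_conn :: "'n::finite conn \<Rightarrow> bool" where
  "flat_conn D \<longleftrightarrow>
     (\<forall>X Y. smooth_vfield X \<and> smooth_vfield Y \<longrightarrow> (\<forall>\<rho>\<in>PD. conn_torsion D X Y \<rho> = 0)) \<and>
     (\<forall>X Y Z. smooth_vfield X \<and> smooth_vfield Y \<and> smooth_vfield Z \<longrightarrow>
        (\<forall>\<rho>\<in>PD. conn_curvature D X Y Z \<rho> = 0))"

text \<open>Equality of connections, disregarding values on non-smooth fields and outside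
  \<^const>\<open>PD\<close>.\<close>

definition conn_eq :: "'n::finite conn \<Rightarrow> 'n conn \<Rightarrow> bool" where
  "conn_eq D E \<longleftrightarrow>
     (\<forall>X Y. smooth_vfield X \<and> smooth_vfield Y \<longrightarrow> (\<forall>\<rho>\<in>PD. D X Y \<rho> = E X Y \<rho>))"

definition conn_comb :: "real \<Rightarrow> 'n::finite conn \<Rightarrow> real \<Rightarrow> 'n conn \<Rightarrow> 'n conn" where
  "conn_comb a D b E X Y \<rho> = a *\<^sub>R D X Y \<rho> + b *\<^sub>R E X Y \<rho>"

section \<open>The alpha-connections\<close>

definition f_alpha :: "real \<Rightarrow> real \<Rightarrow> real" where
  "f_alpha \<alpha> x = (if \<alpha> = 1 then ln x else 2 / (1 - \<alpha>) * x powr ((1 - \<alpha>) / 2))"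

definition L_alpha :: "real \<Rightarrow> 'n::finite cmat \<Rightarrow> 'n cmat \<Rightarrow> 'n cmat" where
  "L_alpha \<alpha> \<rho> X =
     vector_derivative (\<lambda>s::real. herm_fun (f_alpha \<alpha>) (\<rho> + s *\<^sub>R X)) (at 0)"

definition alpha_conn :: "real \<Rightarrow> 'n::finite conn" where
  "alpha_conn \<alpha> X Y \<rho> =
     (THE W. W \<in> Herm \<and> L_alpha \<alpha> \<rho> W = dir_deriv X (\<lambda>\<sigma>. L_alpha \<alpha> \<sigma> (Y \<sigma>)) \<rho>)"

definition mixture_conn :: "'n::finite conn" where
  "mixture_conn = alpha_conn (-1)"

definition exponential_conn :: "'n::finite conn" where
  "exponential_conn = alpha_conn 1"

end

(* For every alpha in [-1,1] there is a finite measure M on [0,1] such that f_alpha'(x) is the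
   integral of 1/(1-u+ux)^2 over M.  Hence on positive definite matrices f_alpha has derivative
   L(V) = INT R V R dM with the resolvents R = ((1-u)I + u rho)^(-1), a smooth family of operators
   which is diagonal with positive entries in an eigenbasis of rho, so invertible.  The
   alpha-connection is D_X Y + Gam(X,Y), with Gam = L^(-1) applied to the second derivative of
   f_alpha, and it is flat because L maps its curvature to that of the trivial connection, where
   second derivatives commute.

   Let P be the antisymmetrized derivative of Gam and Q its commutator, for constant fields.
   Flatness of the exponential connection says P + Q = 0.  A mixture with weight q on the
   exponential side has Christoffel symbols q Gam, hence curvature q P + q^2 Q = (q^2 - q) Q.  At
   the identity matrix Gam is a multiple of the anticommutator, Q is a multiple of an iterated
   commutator, and this does not vanish for n >= 2.  If the mixture coincided with an
   alpha-connection, flatness of the latter would again give q P + q^2 Q = 0. *)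
theory Submission
  imports Defs
begin

section \<open>The spectral theorem for Hermitian matrices\<close>

text \<open>\<open>herm_fun\<close> is defined through a diagonalization, and eigenvectors need not
  depend smoothly on the matrix. Resolvents remove this obstacle: inverses vary smoothly, while
  eigenvectors are used only at a fixed \<rho>, to identify the integral and to see that L is
  injective. The parameter u runs over a compact interval, so near a given \<rho> all bounds are
  uniform in u; its ends u = 0 and u = 1 give the identity and the inverse of \<rho>. The kernel is
  a point mass at 0 for \<alpha> = -1 and Lebesgue measure for \<alpha> = 1. The second obstacle is
  that \<open>PD\<close> lies in the real subspace \<open>Herm\<close>: a derivative within
  \<open>PD\<close> is undetermined in the other directions, so its values are read off along
  Hermitian lines. L itself is inverted on all matrices and commutes with the conjugate transpose.
  The identity matrix is the place to test curvature because all resolvents equal the identity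
  there, and only the mass and the first moment of the measure enter. P is never computed: flatness
  of the exponential connection replaces it by -Q.\<close>

lemma bounded_bilinear_matrix_mult:
  "bounded_bilinear ((**) :: complex^'n::finite^'m::finite \<Rightarrow> complex^'k::finite^'n \<Rightarrow> complex^'k^'m)"
  by (subst bilinear_conv_bounded_bilinear [symmetric])
     (auto simp: bilinear_def linear_iff matrix_add_ldistrib matrix_matrix_mult_def vec_eq_iff
        algebra_simps sum.distrib scaleR_sum_right)

interpretation mm: bounded_bilinear "(**) :: 'n::finite cmat \<Rightarrow> 'n cmat \<Rightarrow> 'n cmat"
  by (rule bounded_bilinear_matrix_mult)

lemma bounded_bilinear_matrix_vector_mult:
  "bounded_bilinear ((*v) :: complex^'n::finite^'m::finite \<Rightarrow> complex^'n \<Rightarrow> complex^'m)"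
  by (subst bilinear_conv_bounded_bilinear [symmetric])
     (auto simp: bilinear_def linear_iff matrix_vector_mult_def vec_eq_iff
        algebra_simps sum.distrib scaleR_sum_right)

interpretation mv: bounded_bilinear "(*v) :: 'n::finite cmat \<Rightarrow> complex^'n \<Rightarrow> complex^'n"
  by (rule bounded_bilinear_matrix_vector_mult)

section \<open>Conjugate transpose and Hermitian matrices\<close>

lemma conj_transpose_nth [simp]: "conj_transpose A $ i $ j = cnj (A $ j $ i)"
  by (simp add: conj_transpose_def)

lemma bounded_linear_conj_transpose: "bounded_linear (conj_transpose :: 'n::finite cmat \<Rightarrow> 'n cmat)"
  by (rule linear_conv_bounded_linear [THEN iffD1], rule linearI) (auto simp: vec_eq_iff)

lemmas conj_transpose_linear_simps [simp] =
  bounded_linear.linear [OF bounded_linear_conj_transpose, THEN linear_add]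
  bounded_linear.linear [OF bounded_linear_conj_transpose, THEN linear_diff]
  bounded_linear.linear [OF bounded_linear_conj_transpose, THEN linear_neg]
  bounded_linear.linear [OF bounded_linear_conj_transpose, THEN linear_0]
  bounded_linear.linear [OF bounded_linear_conj_transpose, THEN linear_cmul]

lemma conj_transpose_mult: "conj_transpose (A ** B) = conj_transpose B ** conj_transpose A"
  by (auto simp: vec_eq_iff matrix_matrix_mult_def mult.commute)

lemma conj_transpose_conj_transpose [simp]: "conj_transpose (conj_transpose A) = A"
  by (simp add: vec_eq_iff)

lemma conj_transpose_mat_1 [simp]: "conj_transpose (mat 1) = mat 1"
  by (simp add: vec_eq_iff mat_def)

lemma mem_Herm: "A \<in> Herm \<longleftrightarrow> conj_transpose A = A"
  by (simp add: Herm_def)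

lemma Herm_simps [simp]:
  "0 \<in> Herm" "mat 1 \<in> Herm"
  "A \<in> Herm \<Longrightarrow> B \<in> Herm \<Longrightarrow> A + B \<in> Herm"
  "A \<in> Herm \<Longrightarrow> B \<in> Herm \<Longrightarrow> A - B \<in> Herm"
  "A \<in> Herm \<Longrightarrow> - A \<in> Herm"
  "A \<in> Herm \<Longrightarrow> c *\<^sub>R A \<in> Herm"
  by (simp_all add: mem_Herm)

lemma inner_matrix_vector: "v \<bullet> (A *v w) = (conj_transpose A *v v) \<bullet> w"
proof -
  have *: "x \<bullet> (a * y) = (cnj a * x) \<bullet> y" for x a y :: complex
    by (simp add: inner_complex_def algebra_simps)
  have "v \<bullet> (A *v w) = (\<Sum>i\<in>UNIV. \<Sum>j\<in>UNIV. (cnj (A $ i $ j) * v $ i) \<bullet> w $ j)"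
    by (simp add: inner_vec_def matrix_vector_mult_def inner_sum_right *)
  also have "\<dots> = (\<Sum>j\<in>UNIV. \<Sum>i\<in>UNIV. (cnj (A $ i $ j) * v $ i) \<bullet> w $ j)"
    by (rule sum.swap)
  also have "\<dots> = (conj_transpose A *v v) \<bullet> w"
    by (simp add: inner_vec_def matrix_vector_mult_def inner_sum_left)
  finally show ?thesis .
qed

lemma Herm_inner: "A \<in> Herm \<Longrightarrow> v \<bullet> (A *v w) = (A *v v) \<bullet> w"
  by (simp add: inner_matrix_vector mem_Herm)

section \<open>The complex structure seen through the real inner product\<close>

lemma matrix_mult_vector_mult_i: "A *v (\<i> *s v) = \<i> *s (A *v v)"
  by (simp add: vec_eq_iff matrix_vector_mult_def sum_distrib_left mult_ac)

text \<open>The inner product is the real part of the sesquilinear one; pairing with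
  \<open>\<i> *s v\<close> recovers the imaginary part, so complex orthogonality amounts to two real
  conditions.\<close>

lemma inner_i_left: "(\<i> *s v) \<bullet> w = - (v \<bullet> (\<i> *s w))" for v w :: "complex^'n::finite"
  by (simp add: inner_vec_def inner_complex_def sum_negf [symmetric])

lemma inner_i_self: "(\<i> *s v) \<bullet> v = 0" for v :: "complex^'n::finite"
  by (simp add: inner_vec_def inner_complex_def)

text \<open>A maximizer of the Rayleigh quotient on the compact unit sphere of the invariant
  subspace is an eigenvector: a nonzero residual would be a direction of first-order
  increase.\<close>

lemma Herm_eigenvector_in_subspace:
  fixes A :: "'n::finite cmat"
  assumes A: "A \<in> Herm" and S: "subspace S" and inv: "\<And>v. v \<in> S \<Longrightarrow> A *v v \<in> S"
    and nz: "\<exists>v\<in>S. v \<noteq> 0"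
  obtains v l where "v \<in> S" "norm v = 1" "A *v v = l *\<^sub>R v"
proof -
  let ?K = "S \<inter> sphere 0 1"
  let ?q = "\<lambda>v. v \<bullet> (A *v v)"
  obtain v0 where v0: "v0 \<in> S" "v0 \<noteq> 0" using nz by blast
  have "(1 / norm v0) *\<^sub>R v0 \<in> ?K"
    using v0 by (simp add: S subspace_scale)
  then have ne: "?K \<noteq> {}" by blast
  have "compact ?K"
    by (simp add: closed_Int_compact closed_subspace S)
  moreover have "continuous_on ?K ?q"
    by (intro continuous_intros mv.continuous_on)
  ultimately obtain v where v: "v \<in> ?K" and vmax: "\<And>y. y \<in> ?K \<Longrightarrow> ?q y \<le> ?q v"
    using continuous_attains_sup ne by meson
  have vS: "v \<in> S" and nv: "norm v = 1" using v by auto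
  let ?l = "?q v"
  have bound: "?q y \<le> ?l * (norm y)\<^sup>2" if y: "y \<in> S" for y
  proof (cases "y = 0")
    case False
    have "(1 / norm y) *\<^sub>R y \<in> ?K"
      using y False by (simp add: S subspace_scale)
    from vmax [OF this] have "(1 / norm y)\<^sup>2 * ?q y \<le> ?l"
      by (simp add: mv.scaleR_right power2_eq_square)
    then show ?thesis using False by (simp add: field_simps)
  qed simp
  define w where "w = A *v v - ?l *\<^sub>R v"
  have wS: "w \<in> S"
    by (simp add: w_def S subspace_diff subspace_scale inv vS)
  have vw: "v \<bullet> w = 0"
    using nv by (simp add: w_def inner_diff_right flip: power2_norm_eq_inner)
  have "w = 0"
  proof (rule ccontr)
    assume "w \<noteq> 0"
    then have pos: "w \<bullet> w > 0" by simp
    have wA: "w \<bullet> (A *v v) = w \<bullet> w"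
      using vw by (simp add: w_def inner_diff_right inner_commute)
    let ?c = "?l * (w \<bullet> w) - ?q w"
    \<comment> \<open>Moving from v to v + s w raises the quadratic form by 2 s (w . w) to first
      order, while maximality of v leaves room only for a term of order s^2.\<close>
    have *: "2 * s * (w \<bullet> w) \<le> s\<^sup>2 * ?c" for s :: real
    proof -
      have "?q (v + s *\<^sub>R w) = ?l + 2 * s * (w \<bullet> w) + s\<^sup>2 * ?q w"
        using wA Herm_inner [OF A, of v w]
        by (simp add: algebra_simps inner_add_left inner_add_right mv.add_right mv.scaleR_right power2_eq_square inner_commute)
      moreover have "(norm (v + s *\<^sub>R w))\<^sup>2 = 1 + s\<^sup>2 * (w \<bullet> w)"
        unfolding power2_norm_eq_inner using vw nv
        by (simp add: inner_add_left inner_add_right inner_commute norm_eq_1 power2_eq_square)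
      moreover have "v + s *\<^sub>R w \<in> S" by (simp add: S vS wS subspace_add subspace_scale)
      ultimately show ?thesis using bound [of "v + s *\<^sub>R w"] by (simp add: algebra_simps)
    qed
    have c0: "?c \<ge> 0" using bound [OF wS] by (simp add: power2_norm_eq_inner)
    \<comment> \<open>Small enough that s times \<open>?c\<close> is at most w . w; the added 1
      keeps the denominator positive when \<open>?c\<close> is 0.\<close>
    define s where "s = (w \<bullet> w) / (?c + 1)"
    have "s > 0" using pos c0 by (simp add: s_def)
    then have "2 * (w \<bullet> w) \<le> s * ?c" using * [of s] by (simp add: power2_eq_square)
    also have "\<dots> \<le> w \<bullet> w" using c0 pos by (simp add: s_def field_simps)
    finally show False using pos by simp
  qed
  then have "A *v v = ?l *\<^sub>R v" by (simp add: w_def)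
  with vS nv show ?thesis by (rule that)
qed

text \<open>Induction over subsets T of the index type yields a basis indexed by \<open>'n\<close>
  itself. Each new eigenvector is sought in the complex orthogonal complement of those already
  found, which A leaves invariant.\<close>

lemma Herm_eigenbasis:
  fixes A :: "'n::finite cmat"
  assumes A: "A \<in> Herm"
  obtains e :: "'n \<Rightarrow> complex^'n" and d :: "'n \<Rightarrow> real"
  where "\<And>i. A *v e i = d i *\<^sub>R e i" "\<And>i. norm (e i) = 1"
    "\<And>i j. i \<noteq> j \<Longrightarrow> e i \<bullet> e j = 0" "\<And>i j. i \<noteq> j \<Longrightarrow> (\<i> *s e i) \<bullet> e j = 0"
proof -
  have "\<exists>e d. (\<forall>i\<in>T. A *v e i = d i *\<^sub>R e i \<and> norm (e i) = 1) \<and>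
      (\<forall>i\<in>T. \<forall>j\<in>T. i \<noteq> j \<longrightarrow> e i \<bullet> e j = 0 \<and> (\<i> *s e i) \<bullet> e j = 0)"
    for T :: "'n set"
    using finite [of T]
  proof (induction T rule: finite_induct)
    case (insert k T)
    then obtain e :: "'n \<Rightarrow> complex^'n" and d
      where ed0: "\<forall>i\<in>T. A *v e i = d i *\<^sub>R e i \<and> norm (e i) = 1"
        "\<forall>i\<in>T. \<forall>j\<in>T. i \<noteq> j \<longrightarrow> e i \<bullet> e j = 0 \<and> (\<i> *s e i) \<bullet> e j = 0"
      by (elim exE conjE) (rule that, assumption+)
    have ed: "\<And>i. i \<in> T \<Longrightarrow> A *v e i = d i *\<^sub>R e i \<and> norm (e i) = 1"
        "\<And>i j. i \<in> T \<Longrightarrow> j \<in> T \<Longrightarrow> i \<noteq> j \<Longrightarrow> e i \<bullet> e j = 0 \<and> (\<i> *s e i) \<bullet> e j = 0"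
      using ed0 by simp_all
    define S where "S = {x. \<forall>i\<in>T. e i \<bullet> x = 0 \<and> (\<i> *s e i) \<bullet> x = 0}"
    have "subspace S"
      by (auto simp: S_def subspace_def inner_add_right)
    moreover have "A *v x \<in> S" if "x \<in> S" for x
    proof -
      have i_scaleR: "\<i> *s (c *\<^sub>R v) = c *\<^sub>R (\<i> *s v)" for c and v :: "complex^'n"
        by (simp add: vec_eq_iff)
      show ?thesis
        using that ed(1) by (simp add: S_def Herm_inner [OF A] matrix_mult_vector_mult_i i_scaleR)
    qed
    moreover have "\<exists>x\<in>S. x \<noteq> 0"
    proof -
      \<comment> \<open>At most 2 card T real vectors cannot span a space of real dimension 2
        CARD('n), so the complement is not trivial.\<close>
      let ?B = "e ` T \<union> (\<lambda>i. \<i> *s e i) ` T"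
      have "dim ?B \<le> card ?B" by (simp add: dim_le_card')
      also have "\<dots> \<le> card T + card T"
        by (rule order_trans [OF card_Un_le]) (intro add_mono card_image_le finite)
      also have "\<dots> < 2 * CARD('n)"
      proof -
        have "T \<subset> UNIV" using insert.hyps(2) by blast
        then have "card T < CARD('n)" by (intro psubset_card_mono) simp_all
        then show ?thesis by simp
      qed
      finally have "dim ?B < DIM(complex^'n)" by simp
      from orthogonal_to_subspace_exists [OF this]
      obtain x where "x \<noteq> 0" "\<And>y. y \<in> span ?B \<Longrightarrow> orthogonal x y" by blast
      then have "\<And>y. y \<in> ?B \<Longrightarrow> y \<bullet> x = 0"
        by (metis orthogonal_def orthogonal_commute span_base)
      then show ?thesis using \<open>x \<noteq> 0\<close>
        by (intro bexI [of _ x]) (auto simp: S_def)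
    qed
    ultimately obtain v l where v: "v \<in> S" "norm v = 1" "A *v v = l *\<^sub>R v"
      using Herm_eigenvector_in_subspace [OF A] by blast
    have "v \<bullet> e i = 0 \<and> (\<i> *s v) \<bullet> e i = 0" if "i \<in> T" for i
      using v(1) that inner_i_left [of v "e i"] inner_commute [of v "\<i> *s e i"] inner_commute [of v "e i"]
      by (simp add: S_def)
    moreover have "e i \<bullet> v = 0 \<and> (\<i> *s e i) \<bullet> v = 0" if "i \<in> T" for i
      using v(1) that by (simp add: S_def)
    ultimately show ?case using ed v(2,3) insert.hyps(2)
      by (intro exI [of _ "e(k := v)"] exI [of _ "d(k := l)"] conjI ballI impI)
         (simp_all, (metis | blast)+)
  qed simp
  from this [of UNIV] obtain e :: "'n \<Rightarrow> complex^'n" and d where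
    "\<forall>i. A *v e i = d i *\<^sub>R e i \<and> norm (e i) = 1"
    "\<forall>i j. i \<noteq> j \<longrightarrow> e i \<bullet> e j = 0 \<and> (\<i> *s e i) \<bullet> e j = 0"
    by (simp only: ball_UNIV) (elim exE conjE, rule that, assumption+)
  then show ?thesis by (intro that [of e d]) simp_all
qed

theorem Herm_diagonalizable:
  fixes A :: "'n::finite cmat"
  assumes A: "A \<in> Herm"
  obtains U d where "unitary_mat U" "A = U ** real_diag d ** conj_transpose U"
proof -
  obtain e :: "'n \<Rightarrow> complex^'n" and d where e: "\<And>i. A *v e i = d i *\<^sub>R e i" "\<And>i. norm (e i) = 1"
    "\<And>i j. i \<noteq> j \<Longrightarrow> e i \<bullet> e j = 0" "\<And>i j. i \<noteq> j \<Longrightarrow> (\<i> *s e i) \<bullet> e j = 0"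
    using Herm_eigenbasis [OF A] by blast
  define U :: "'n cmat" where "U = (\<chi> i j. e j $ i)"
  \<comment> \<open>The two real orthogonality relations are the real and imaginary part of one
    complex relation, which makes the columns unitary.\<close>
  have cip: "(\<Sum>i\<in>UNIV. cnj (e j $ i) * e k $ i) = Complex (e j \<bullet> e k) ((\<i> *s e j) \<bullet> e k)" for j k
    by (rule complex_eqI) (simp_all add: inner_vec_def inner_complex_def)
  have UU: "conj_transpose U ** U = mat 1"
    by (auto simp: vec_eq_iff matrix_matrix_mult_def U_def mat_def cip e complex_eq_iff
        inner_i_self power2_norm_eq_inner [symmetric])
  then have UU': "U ** conj_transpose U = mat 1"
    using matrix_left_right_inverse by blast
  have AU: "A ** U = U ** real_diag d"
  proof -
    have "(A ** U) $ i $ j = (A *v e j) $ i" for i j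
      by (simp add: matrix_matrix_mult_def matrix_vector_mult_def U_def)
    moreover have "(U ** real_diag d) $ i $ j = (d j *\<^sub>R e j) $ i" for i j
      by (simp add: matrix_matrix_mult_def real_diag_def U_def if_distrib [of "\<lambda>x. _ * x"] scaleR_conv_of_real [where 'a = complex] mult.commute cong: if_cong)
    ultimately show ?thesis by (simp add: vec_eq_iff e)
  qed
  have "A = A ** (U ** conj_transpose U)" by (simp add: UU')
  also have "\<dots> = U ** real_diag d ** conj_transpose U" by (simp add: matrix_mul_assoc AU)
  finally show ?thesis using that UU UU' unitary_mat_def by blast
qed

section \<open>Independence of the functional calculus from the diagonalization\<close>

lemma real_diag_mult_nth:
  "(real_diag g ** A) $ i $ j = of_real (g i) * A $ i $ j"
  "(A ** real_diag g) $ i $ j = A $ i $ j * of_real (g j)"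
  by (simp_all add: matrix_matrix_mult_def real_diag_def if_distrib [of "\<lambda>x. _ * x"]
      if_distrib [of "\<lambda>x. x * _"] cong: if_cong)

text \<open>For two diagonalizations, W = V* U intertwines the diagonal matrices, so an entry of W
  is nonzero only where the two eigenvalues agree. There f takes the same value, hence W also
  intertwines the diagonal matrices after applying f.\<close>

lemma herm_fun_eq:
  assumes U: "unitary_mat U" and A: "A = U ** real_diag d ** conj_transpose U"
  shows "herm_fun f A = U ** real_diag (\<lambda>i. f (d i)) ** conj_transpose U"
  unfolding herm_fun_def
proof (rule the_equality)
  show "\<exists>V e. unitary_mat V \<and> A = V ** real_diag e ** conj_transpose V \<and>
      U ** real_diag (\<lambda>i. f (d i)) ** conj_transpose U = V ** real_diag (\<lambda>i. f (e i)) ** conj_transpose V"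
    using assms by blast
next
  fix B
  assume "\<exists>V e. unitary_mat V \<and> A = V ** real_diag e ** conj_transpose V \<and>
      B = V ** real_diag (\<lambda>i. f (e i)) ** conj_transpose V"
  then obtain V e where V: "unitary_mat V" and AV: "A = V ** real_diag e ** conj_transpose V"
    and B: "B = V ** real_diag (\<lambda>i. f (e i)) ** conj_transpose V" by blast
  define W where "W = conj_transpose V ** U"
  have UU: "conj_transpose U ** U = mat 1" "U ** conj_transpose U = mat 1"
    and VV: "conj_transpose V ** V = mat 1" "V ** conj_transpose V = mat 1"
    using U V by (auto simp: unitary_mat_def)
  have UUX: "X ** conj_transpose U ** U = X" "X ** U ** conj_transpose U = X" for X
    by (simp_all add: matrix_mul_assoc [symmetric] UU)
  have "W ** real_diag d = conj_transpose V ** A ** U"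
    unfolding A W_def by (simp add: matrix_mul_assoc UUX)
  also have "\<dots> = real_diag e ** W"
    unfolding AV W_def by (simp add: matrix_mul_assoc VV)
  finally have eq: "W ** real_diag d = real_diag e ** W" .
  have "W ** real_diag (\<lambda>i. f (d i)) = real_diag (\<lambda>i. f (e i)) ** W"
  proof -
    have "W $ i $ j = 0 \<or> d j = e i" for i j
    proof -
      have "W $ i $ j * of_real (d j) = of_real (e i) * W $ i $ j"
        using arg_cong [OF eq, of "\<lambda>X. X $ i $ j"] by (simp only: real_diag_mult_nth)
      then have "W $ i $ j * (of_real (d j) - of_real (e i)) = 0" by (simp add: algebra_simps)
      then show ?thesis by simp
    qed
    then show ?thesis unfolding vec_eq_iff real_diag_mult_nth
      by (metis (no_types) mult.commute mult_zero_left)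
  qed
  then have eqf: "real_diag (\<lambda>i. f (e i)) ** W = W ** real_diag (\<lambda>i. f (d i))" ..
  have "B = V ** (real_diag (\<lambda>i. f (e i)) ** W) ** conj_transpose U"
    unfolding B W_def by (simp add: matrix_mul_assoc UUX)
  also have "\<dots> = U ** real_diag (\<lambda>i. f (d i)) ** conj_transpose U"
    unfolding eqf unfolding W_def by (simp add: matrix_mul_assoc VV)
  finally show "B = U ** real_diag (\<lambda>i. f (d i)) ** conj_transpose U" .
qed

lemma matrix_inv_unique:
  fixes A :: "'n::finite cmat"
  assumes AB: "A ** B = mat 1"
  shows "matrix_inv A = B"
proof -
  have BA: "B ** A = mat 1" using AB matrix_left_right_inverse by blast
  then have "invertible A" using AB invertible_def by blast
  then have "A ** matrix_inv A = mat 1 \<and> matrix_inv A ** A = mat 1"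
    unfolding invertible_def matrix_inv_def by (rule someI_ex)
  then show ?thesis by (metis BA matrix_mul_assoc matrix_mul_lid matrix_mul_rid)
qed

text \<open>The norm of a matrix is the Euclidean norm of its entries. An operator bound controls
  each entry by evaluation at a unit vector; the crude dimension factor is harmless, since only
  finiteness of bounds matters later.\<close>

lemma norm_matrix_le:
  fixes A :: "'n::finite cmat"
  assumes "\<And>v. norm (A *v v) \<le> c * norm v"
  shows "norm A \<le> (real CARD('n))\<^sup>2 * c"
proof -
  have ent: "norm (A $ i $ j) \<le> c" for i j
  proof -
    have "A $ i $ j = (A *v axis j 1) $ i"
      by (simp add: matrix_vector_mult_def axis_def if_distrib [of "\<lambda>x. _ * x"] cong: if_cong)
    then have "norm (A $ i $ j) \<le> norm (A *v axis j 1)"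
      using Finite_Cartesian_Product.norm_nth_le [of "A *v axis j 1" i] by simp
    also have "\<dots> \<le> c" using assms [of "axis j 1"] by simp
    finally show ?thesis .
  qed
  have "norm A \<le> (\<Sum>i\<in>UNIV. norm (A $ i))"
    unfolding norm_vec_def by (rule L2_set_le_sum) simp
  also have "\<dots> \<le> (\<Sum>i\<in>(UNIV :: 'n set). \<Sum>j\<in>(UNIV :: 'n set). c)"
  proof (rule sum_mono)
    fix i
    have "norm (A $ i) \<le> (\<Sum>j\<in>UNIV. norm (A $ i $ j))"
      unfolding norm_vec_def [of "A $ i"] by (rule L2_set_le_sum) simp
    also have "\<dots> \<le> (\<Sum>j\<in>(UNIV :: 'n set). c)" by (rule sum_mono) (rule ent)
    finally show "norm (A $ i) \<le> (\<Sum>j\<in>(UNIV :: 'n set). c)" .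
  qed
  finally show ?thesis by (simp add: power2_eq_square)
qed

section \<open>Positive definite matrices\<close>

lemma PD_Herm: "\<rho> \<in> PD \<Longrightarrow> \<rho> \<in> Herm"
  by (simp add: PD_def)

lemma PD_I: "\<rho> \<in> Herm \<Longrightarrow> 0 < m \<Longrightarrow> (\<And>v. m * (norm v)\<^sup>2 \<le> v \<bullet> (\<rho> *v v)) \<Longrightarrow> \<rho> \<in> PD"
  unfolding PD_def by (simp, metis less_le_trans mult_pos_pos zero_less_norm_iff zero_less_power)

lemma mat_1_PD: "mat 1 \<in> PD"
  by (rule PD_I [of _ 1]) (simp_all add: power2_norm_eq_inner)

text \<open>Convexity makes the mean value inequality available when differentiating under the
  integral sign.\<close>

lemma convex_PD: "convex (PD :: 'n::finite cmat set)"
  unfolding convex_def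
proof (intro ballI allI impI)
  fix x y :: "'n cmat" and u v :: real
  assume *: "x \<in> PD" "y \<in> PD" "0 \<le> u" "0 \<le> v" "u + v = 1"
  have "0 < w \<bullet> ((u *\<^sub>R x + v *\<^sub>R y) *v w)" if "w \<noteq> 0" for w
  proof -
    have pos: "w \<bullet> (x *v w) > 0" "w \<bullet> (y *v w) > 0" using * that by (auto simp: PD_def)
    have "u > 0 \<or> v > 0" using * by linarith
    then show ?thesis using pos *(3,4)
      by (auto simp: mv.add_left mv.scaleR_left inner_add_right add_pos_nonneg add_nonneg_pos)
  qed
  then show "u *\<^sub>R x + v *\<^sub>R y \<in> PD" using * by (auto simp: PD_def)
qed

text \<open>The quadratic form attains a positive minimum on the compact unit sphere.\<close>

lemma PD_coercive:
  fixes \<rho> :: "'n::finite cmat"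
  assumes "\<rho> \<in> PD"
  obtains m where "m > 0" "\<And>v. m * (norm v)\<^sup>2 \<le> v \<bullet> (\<rho> *v v)"
proof -
  let ?q = "\<lambda>v. v \<bullet> (\<rho> *v v)"
  have "continuous_on (sphere 0 1) ?q"
    by (intro continuous_intros mv.continuous_on)
  moreover have "axis undefined 1 \<in> (sphere 0 1 :: (complex^'n) set)" by simp
  then have "(sphere 0 1 :: (complex^'n) set) \<noteq> {}" by blast
  ultimately obtain v0 where v0: "v0 \<in> sphere 0 1" "\<And>v. v \<in> sphere 0 1 \<Longrightarrow> ?q v0 \<le> ?q v"
    using continuous_attains_inf [OF compact_sphere] by meson
  have "?q v0 * (norm v)\<^sup>2 \<le> ?q v" for v
  proof (cases "v = 0")
    case False
    then have "?q v0 \<le> ?q ((1 / norm v) *\<^sub>R v)" by (intro v0) simp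
    also have "\<dots> = (1 / norm v)\<^sup>2 * ?q v"
      by (simp add: mv.scaleR_right power2_eq_square)
    finally show ?thesis using False by (simp add: field_simps)
  qed simp
  moreover have "v0 \<noteq> 0" using v0 by auto
  then have "?q v0 > 0" using assms by (simp add: PD_def)
  ultimately show ?thesis using that by blast
qed

text \<open>Half of the constant at \<rho> survives a small perturbation. The normalization m \<le>
  1 makes the same constant work for all convex combinations of the identity and \<sigma>.\<close>

lemma PD_uniformly_coercive_nhd:
  fixes \<rho> :: "'n::finite cmat"
  assumes "\<rho> \<in> PD"
  obtains r m where "r > 0" "m > 0" "m \<le> 1"
    "\<And>\<sigma> v. \<sigma> \<in> ball \<rho> r \<Longrightarrow> m * (norm v)\<^sup>2 \<le> v \<bullet> (\<sigma> *v v)"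
proof -
  obtain m where m: "m > 0" "\<And>v. m * (norm v)\<^sup>2 \<le> v \<bullet> (\<rho> *v v)"
    using PD_coercive [OF assms] by blast
  obtain K where K: "K > 0" "\<And>(A :: 'n cmat) v. norm (A *v v) \<le> norm A * norm v * K"
    using mv.pos_bounded by blast
  have "min 1 (m / 2) * (norm v)\<^sup>2 \<le> v \<bullet> (\<sigma> *v v)" if "\<sigma> \<in> ball \<rho> (m / (2 * K))" for \<sigma> v
  proof -
    have "\<bar>v \<bullet> ((\<sigma> - \<rho>) *v v)\<bar> \<le> norm v * norm ((\<sigma> - \<rho>) *v v)" by (rule Cauchy_Schwarz_ineq2)
    also have "\<dots> \<le> norm v * (norm (\<sigma> - \<rho>) * norm v * K)"
      by (intro mult_left_mono K) simp
    also have "\<dots> = (norm (\<sigma> - \<rho>) * K) * (norm v)\<^sup>2" by (simp add: power2_eq_square)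
    also have "\<dots> \<le> (m / 2) * (norm v)\<^sup>2"
      using that K(1) by (intro mult_right_mono) (auto simp: dist_norm norm_minus_commute field_simps)
    finally have "\<bar>v \<bullet> (\<sigma> *v v) - v \<bullet> (\<rho> *v v)\<bar> \<le> m / 2 * (norm v)\<^sup>2"
      by (simp only: mv.diff_left inner_diff_right)
    then have "m / 2 * (norm v)\<^sup>2 \<le> v \<bullet> (\<sigma> *v v)"
      using m(2) [of v] by linarith
    moreover have "min 1 (m / 2) * (norm v)\<^sup>2 \<le> m / 2 * (norm v)\<^sup>2"
      by (intro mult_right_mono) auto
    ultimately show ?thesis by linarith
  qed
  then show ?thesis using m(1) K(1) by (intro that [of "m / (2 * K)" "min 1 (m / 2)"]) auto
qed

lemma PD_relatively_open:
  fixes \<rho> :: "'n::finite cmat"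
  assumes "\<rho> \<in> PD"
  obtains r where "r > 0" "\<And>\<sigma>. \<sigma> \<in> Herm \<Longrightarrow> \<sigma> \<in> ball \<rho> r \<Longrightarrow> \<sigma> \<in> PD"
proof -
  obtain r m where rm: "r > 0" "m > 0" "m \<le> 1"
    "\<And>\<sigma> v. \<sigma> \<in> ball \<rho> r \<Longrightarrow> m * (norm v)\<^sup>2 \<le> v \<bullet> (\<sigma> *v v)"
    using PD_uniformly_coercive_nhd [OF assms] by metis
  show ?thesis by (rule that [OF rm(1)]) (rule PD_I [OF _ rm(2) rm(4)])
qed

lemma eventually_line_PD:
  fixes \<rho> :: "'n::finite cmat"
  assumes "\<rho> \<in> PD" "V \<in> Herm"
  obtains e where "e > 0" "\<And>s. \<bar>s\<bar> < e \<Longrightarrow> \<rho> + s *\<^sub>R V \<in> PD"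
proof -
  obtain r where r: "r > 0" "\<And>\<sigma>. \<sigma> \<in> Herm \<Longrightarrow> \<sigma> \<in> ball \<rho> r \<Longrightarrow> \<sigma> \<in> PD"
    using PD_relatively_open [OF assms(1)] by blast
  show ?thesis
  proof
    show "r / (norm V + 1) > 0" using r(1) by (simp add: add_nonneg_pos)
    fix s assume s: "\<bar>s\<bar> < r / (norm V + 1)"
    have "\<bar>s\<bar> * norm V \<le> \<bar>s\<bar> * (norm V + 1)" by (simp add: mult_left_mono)
    also have "\<dots> < r" using s by (simp add: pos_less_divide_eq add_nonneg_pos)
    finally show "\<rho> + s *\<^sub>R V \<in> PD"
      using assms by (intro r) (simp_all add: PD_Herm dist_norm)
  qed
qed

lemma PD_diagonalizable:
  fixes \<rho> :: "'n::finite cmat"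
  assumes "\<rho> \<in> PD"
  obtains U d where "unitary_mat U" "\<rho> = U ** real_diag d ** conj_transpose U" "\<And>i. d i > 0"
proof -
  obtain U d where U: "unitary_mat U" and \<rho>: "\<rho> = U ** real_diag d ** conj_transpose U"
    using Herm_diagonalizable [OF PD_Herm [OF assms]] by blast
  have "d i > 0" for i
  proof -
    let ?v = "U *v axis i 1"
    have UU: "conj_transpose U ** U = mat 1" using U by (simp add: unitary_mat_def)
    have Uv: "conj_transpose U *v ?v = axis i 1"
      by (simp add: matrix_vector_mul_assoc UU)
    then have "?v \<noteq> 0" by (metis axis_eq_0_iff mv.zero_right zero_neq_one)
    then have "0 < ?v \<bullet> (\<rho> *v ?v)" using assms by (simp add: PD_def)
    also have "\<rho> *v ?v = U *v (real_diag d *v axis i 1)"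
      unfolding \<rho> using Uv by (metis matrix_vector_mul_assoc)
    also have "?v \<bullet> \<dots> = axis i 1 \<bullet> (real_diag d *v axis i 1)"
      unfolding inner_matrix_vector [of _ U] Uv ..
    also have "real_diag d *v axis i 1 = d i *\<^sub>R axis i 1"
      by (simp add: vec_eq_iff matrix_vector_mult_def real_diag_def axis_def scaleR_conv_of_real [where 'a = complex]
          if_distrib [of "\<lambda>x. x * _"] if_distrib [of "\<lambda>x. _ * x"] cong: if_cong)
    also have "axis i 1 \<bullet> (d i *\<^sub>R axis i 1 :: complex^'n) = d i"
      by (simp add: inner_axis_axis)
    finally show ?thesis .
  qed
  with U \<rho> show ?thesis using that by blast
qed

section \<open>Resolvents\<close>

text \<open>For u > 0 this is 1/u times the resolvent (\<sigma> + (1 - u)/u)^(-1). The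
  parametrization brings the whole half line, including the point at infinity, to the compact
  interval from 0 to 1.\<close>

definition res :: "real \<Rightarrow> 'n::finite cmat \<Rightarrow> 'n cmat" where
  "res u \<sigma> = matrix_inv ((1 - u) *\<^sub>R mat 1 + u *\<^sub>R \<sigma>)"

text \<open>By Cauchy-Schwarz, coercivity gives m |v| \<le> |A v|. This is injectivity, hence
  invertibility in finite dimension, and at the same time a bound on the inverse.\<close>

lemma coercive_invertible:
  fixes A :: "'n::finite cmat"
  assumes m: "m > 0" and A: "\<And>v. m * (norm v)\<^sup>2 \<le> v \<bullet> (A *v v)"
  shows "A ** matrix_inv A = mat 1" "norm (matrix_inv A) \<le> (real CARD('n))\<^sup>2 * (1 / m)"
proof -
  have le: "m * norm v \<le> norm (A *v v)" for v
  proof (cases "v = 0")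
    case False
    have "m * norm v * norm v \<le> norm v * norm (A *v v)"
      using A [of v] norm_cauchy_schwarz [of v "A *v v"] by (simp add: power2_eq_square)
    then show ?thesis using False by (simp add: mult.commute)
  qed simp
  have "inj ((*v) A)"
  proof (rule injI)
    fix v w assume "A *v v = A *v w"
    then have "m * norm (v - w) \<le> 0" using le [of "v - w"] by (simp add: mv.diff_right)
    then show "v = w" using m by (simp add: mult_le_0_iff)
  qed
  then obtain B where B: "A ** B = mat 1"
    using matrix_left_invertible_injective matrix_left_right_inverse by blast
  then have inv: "matrix_inv A = B" by (rule matrix_inv_unique)
  show "A ** matrix_inv A = mat 1" by (simp add: inv B)
  show "norm (matrix_inv A) \<le> (real CARD('n))\<^sup>2 * (1 / m)"
  proof (rule norm_matrix_le)
    fix v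
    have "m * norm (B *v v) \<le> norm v"
      using le [of "B *v v"] by (simp add: matrix_vector_mul_assoc B)
    then show "norm (matrix_inv A *v v) \<le> 1 / m * norm v"
      using m by (simp add: inv field_simps)
  qed
qed

text \<open>The bound is uniform in u as well as in \<sigma>; it supplies the domination for the
  integrals over u.\<close>

lemma res_properties:
  fixes \<rho> :: "'n::finite cmat"
  assumes "\<rho> \<in> PD"
  obtains r K where "r > 0"
    "\<And>\<sigma> u. \<sigma> \<in> ball \<rho> r \<Longrightarrow> u \<in> {0..1} \<Longrightarrow> ((1 - u) *\<^sub>R mat 1 + u *\<^sub>R \<sigma>) ** res u \<sigma> = mat 1"
    "\<And>\<sigma> u. \<sigma> \<in> ball \<rho> r \<Longrightarrow> u \<in> {0..1} \<Longrightarrow> norm (res u \<sigma>) \<le> K"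
proof -
  obtain r m where rm: "r > 0" "m > 0" "m \<le> 1"
    "\<And>\<sigma> v. \<sigma> \<in> ball \<rho> r \<Longrightarrow> m * (norm v)\<^sup>2 \<le> v \<bullet> (\<sigma> *v v)"
    using PD_uniformly_coercive_nhd [OF assms] by metis
  have co: "m * (norm v)\<^sup>2 \<le> v \<bullet> (((1 - u) *\<^sub>R mat 1 + u *\<^sub>R \<sigma>) *v v)"
    if "\<sigma> \<in> ball \<rho> r" "u \<in> {0..1}" for \<sigma> u v
  proof -
    have "m * (norm v)\<^sup>2 = (1 - u) * (m * (norm v)\<^sup>2) + u * (m * (norm v)\<^sup>2)"
      by (simp add: algebra_simps)
    also have "\<dots> \<le> (1 - u) * (norm v)\<^sup>2 + u * (v \<bullet> (\<sigma> *v v))"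
      using rm that by (intro add_mono mult_left_mono) (auto simp: mult_left_le_one_le)
    finally show ?thesis
      by (simp add: mv.add_left mv.scaleR_left inner_add_right power2_norm_eq_inner)
  qed
  show ?thesis
    by (rule that [OF rm(1)]; unfold res_def; rule coercive_invertible [OF rm(2)]; rule co)
qed

lemma res_right: "\<rho> \<in> PD \<Longrightarrow> u \<in> {0..1} \<Longrightarrow> ((1 - u) *\<^sub>R mat 1 + u *\<^sub>R \<rho>) ** res u \<rho> = mat 1"
  by (rule res_properties [of \<rho>]) simp_all

lemma res_left: "\<rho> \<in> PD \<Longrightarrow> u \<in> {0..1} \<Longrightarrow> res u \<rho> ** ((1 - u) *\<^sub>R mat 1 + u *\<^sub>R \<rho>) = mat 1"
  using res_right matrix_left_right_inverse by blast

lemma res_mat_1: "res u (mat 1) = mat 1"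
  unfolding res_def by (rule matrix_inv_unique) (simp flip: scaleR_add_left)

lemma res_Herm: "\<rho> \<in> PD \<Longrightarrow> u \<in> {0..1} \<Longrightarrow> conj_transpose (res u \<rho>) = res u \<rho>"
proof -
  assume *: "\<rho> \<in> PD" "u \<in> {0..1}"
  have "conj_transpose (res u \<rho> ** ((1 - u) *\<^sub>R mat 1 + u *\<^sub>R \<rho>)) = mat 1"
    by (simp only: res_left [OF *] conj_transpose_mat_1)
  then have "((1 - u) *\<^sub>R mat 1 + u *\<^sub>R \<rho>) ** conj_transpose (res u \<rho>) = mat 1"
    using PD_Herm [OF *(1)] by (simp add: conj_transpose_mult mem_Herm)
  from matrix_inv_unique [OF this] show ?thesis by (simp add: res_def)
qed

lemma real_diag_mult: "real_diag a ** real_diag b = real_diag (\<lambda>i. a i * b i)"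
  by (auto simp: vec_eq_iff matrix_matrix_mult_def real_diag_def if_distrib [of "\<lambda>x. _ * x"]
      if_distrib [of "\<lambda>x. x * _"] cong: if_cong)

lemma res_diag:
  assumes U: "unitary_mat U" and \<rho>: "\<rho> = U ** real_diag d ** conj_transpose U" and d: "\<And>i. d i > 0"
    and u: "u \<in> {0..1}"
  shows "res u \<rho> = U ** real_diag (\<lambda>i. 1 / (1 - u + u * d i)) ** conj_transpose U"
  unfolding res_def
proof (rule matrix_inv_unique)
  have UU: "conj_transpose U ** U = mat 1" "U ** conj_transpose U = mat 1"
    using U by (simp_all add: unitary_mat_def)
  have UUX: "X ** conj_transpose U ** U = X" for X
    by (simp add: matrix_mul_assoc [symmetric] UU)
  have pos: "1 - u + u * d i > 0" for i
    using u d [of i] by (cases "u = 1") (auto intro: add_pos_nonneg)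
  have "(1 - u) *\<^sub>R mat 1 + u *\<^sub>R real_diag d = real_diag (\<lambda>i. 1 - u + u * d i)"
    by (auto simp: vec_eq_iff real_diag_def mat_def scaleR_conv_of_real [where 'a = complex])
  then have M: "(1 - u) *\<^sub>R mat 1 + u *\<^sub>R \<rho> = U ** real_diag (\<lambda>i. 1 - u + u * d i) ** conj_transpose U"
    unfolding \<rho> by (metis (no_types) UU(2) matrix_add_ldistrib matrix_mul_rid mm.add_left mm.scaleR_left mm.scaleR_right)
  have "real_diag (\<lambda>i. (1 - u + u * d i) * (1 / (1 - u + u * d i))) = (mat 1 :: 'a cmat)"
    using pos by (auto simp: vec_eq_iff real_diag_def mat_def less_imp_neq [THEN not_sym])
  then show "((1 - u) *\<^sub>R mat 1 + u *\<^sub>R \<rho>) ** (U ** real_diag (\<lambda>i. 1 / (1 - u + u * d i)) ** conj_transpose U) = mat 1"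
    unfolding M by (simp add: matrix_mul_assoc UUX UU)
      (simp add: matrix_mul_assoc [symmetric] real_diag_mult UU)
qed

text \<open>The resolvent identity. It yields both the continuity of \<open>res\<close> in u and its
  derivative in \<sigma>.\<close>

lemma res_diff:
  fixes M1 M2 R1 R2 :: "'n::finite cmat"
  assumes "M1 ** R1 = mat 1" "R2 ** M2 = mat 1"
  shows "R2 - R1 = R2 ** (M1 - M2) ** R1"
proof -
  have "R2 ** (M1 - M2) ** R1 = R2 ** (M1 ** R1) - (R2 ** M2) ** R1"
    by (simp add: mm.diff_right mm.diff_left matrix_mul_assoc)
  then show ?thesis by (simp add: assms)
qed

section \<open>Differentiation under the integral sign\<close>

text \<open>The normalized remainder of g u tends to 0 for each u and is bounded by 2 K by the mean
  value inequality on the convex set S, so dominated convergence applies on a finite measure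
  space.\<close>

lemma has_derivative_integral_finite_measure:
  fixes g :: "'u \<Rightarrow> 'a::real_normed_vector \<Rightarrow> 'b::{banach,second_countable_topology}"
  assumes M: "finite_measure M" and S: "convex S" "x \<in> S"
    and deriv: "\<And>u y. u \<in> space M \<Longrightarrow> y \<in> S \<Longrightarrow> (g u has_derivative g' u y) (at y within S)"
    and bound: "\<And>u y v. u \<in> space M \<Longrightarrow> y \<in> S \<Longrightarrow> norm (g' u y v) \<le> K * norm v"
    and int: "\<And>y. y \<in> S \<Longrightarrow> integrable M (\<lambda>u. g u y)"
    and int': "\<And>v. integrable M (\<lambda>u. g' u x v)"
  shows "((\<lambda>y. \<integral>u. g u y \<partial>M) has_derivative (\<lambda>v. \<integral>u. g' u x v \<partial>M)) (at x within S)"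
proof -
  interpret finite_measure M by (rule M)
  have K: "0 \<le> K * norm v" if "space M \<noteq> {}" for v :: 'a
    using that bound [OF _ S(2), of _ v] norm_ge_zero by (meson ex_in_conv order_trans)
  have lin: "linear (g' u x)" if "u \<in> space M" for u
    using deriv [OF that S(2)] has_derivative_bounded_linear bounded_linear.linear by blast
  have blin: "bounded_linear (\<lambda>v. \<integral>u. g' u x v \<partial>M)"
  proof (rule bounded_linear_intro [where K = "measure M (space M) * K"])
    fix v w and r :: real
    have "(\<integral>u. g' u x (v + w) \<partial>M) = (\<integral>u. g' u x v + g' u x w \<partial>M)"
      by (rule Bochner_Integration.integral_cong) (simp_all add: lin linear_add)
    then show "(\<integral>u. g' u x (v + w) \<partial>M) = (\<integral>u. g' u x v \<partial>M) + (\<integral>u. g' u x w \<partial>M)"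
      by (simp add: int')
    have "(\<integral>u. g' u x (r *\<^sub>R v) \<partial>M) = (\<integral>u. r *\<^sub>R g' u x v \<partial>M)"
      by (rule Bochner_Integration.integral_cong) (simp_all add: lin linear_cmul)
    then show "(\<integral>u. g' u x (r *\<^sub>R v) \<partial>M) = r *\<^sub>R (\<integral>u. g' u x v \<partial>M)"
      by simp
    have "norm (\<integral>u. g' u x v \<partial>M) \<le> (\<integral>u. norm (g' u x v) \<partial>M)"
      by (rule integral_norm_bound)
    also have "\<dots> \<le> (\<integral>u. K * norm v \<partial>M)"
      by (rule integral_mono) (auto simp: int' integrable_norm bound S)
    finally show "norm (\<integral>u. g' u x v \<partial>M) \<le> norm v * (measure M (space M) * K)"
      by (simp add: mult_ac)
  qed
  define q where "q u y = norm (g u y - g u x - g' u x (y - x)) / norm (y - x)" for u y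
  have int_q: "integrable M (\<lambda>u. q u y)" if "y \<in> S" for y
    unfolding q_def
    by (intro integrable_divide integrable_norm Bochner_Integration.integrable_diff int int' that S(2))
  have q_bound: "norm (q u y) \<le> 2 * K" if u: "u \<in> space M" and y: "y \<in> S - {x}" for u y
  proof -
    have "norm (g u y - g u x) \<le> K * norm (y - x)"
    proof (rule differentiable_bound [OF S(1)])
      show "onorm (g' u z) \<le> K" if "z \<in> S" for z
      proof (rule onorm_bound)
        have "0 \<le> K * norm (y - x)" using K u by blast
        then show "0 \<le> K" using y by (simp add: zero_le_mult_iff)
      qed (rule bound [OF u that])
    qed (use deriv u y S in auto)
    moreover have "norm (g' u x (y - x)) \<le> K * norm (y - x)"
      by (rule bound) (use u S in auto)
    ultimately have "norm (g u y - g u x - g' u x (y - x)) \<le> 2 * K * norm (y - x)"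
      using norm_triangle_ineq4 [of "g u y - g u x" "g' u x (y - x)"] by linarith
    then show ?thesis using y by (simp add: q_def divide_le_eq)
  qed
  have "((\<lambda>y. norm ((\<integral>u. g u y \<partial>M) - (\<integral>u. g u x \<partial>M) - (\<integral>u. g' u x (y - x) \<partial>M)) / norm (y - x)) \<longlongrightarrow> 0) (at x within S)"
    \<comment> \<open>Dominated convergence concerns sequences, so the limit at x is tested along
      them.\<close>
    unfolding tendsto_at_iff_sequentially
  proof (intro allI impI)
    fix X assume X: "\<forall>i. X i \<in> S - {x}" and Xx: "X \<longlonglongrightarrow> x"
    have "(\<lambda>n. \<integral>u. q u (X n) \<partial>M) \<longlonglongrightarrow> (\<integral>u. 0 \<partial>M)"
    proof (rule integral_dominated_convergence [where w = "\<lambda>_. 2 * K"])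
      show "AE u in M. (\<lambda>n. q u (X n)) \<longlonglongrightarrow> 0"
      proof (rule AE_I2)
        fix u assume u: "u \<in> space M"
        have "((\<lambda>y. q u y) \<longlongrightarrow> 0) (at x within S)"
          using deriv [OF u S(2)] by (simp add: has_derivative_iff_norm q_def)
        then show "(\<lambda>n. q u (X n)) \<longlonglongrightarrow> 0"
          using X Xx unfolding tendsto_at_iff_sequentially comp_def by blast
      qed
      show "AE u in M. norm (q u (X n)) \<le> 2 * K" for n
        by (rule AE_I2) (use q_bound X in blast)
      show "(\<lambda>u. q u (X n)) \<in> borel_measurable M" for n
        by (rule borel_measurable_integrable [OF int_q]) (use X in blast)
    qed simp_all
    then have lim: "(\<lambda>n. \<integral>u. q u (X n) \<partial>M) \<longlonglongrightarrow> 0" by simp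
    have le: "norm ((\<integral>u. g u y \<partial>M) - (\<integral>u. g u x \<partial>M) - (\<integral>u. g' u x (y - x) \<partial>M)) / norm (y - x) \<le> (\<integral>u. q u y \<partial>M)"
      if "y \<in> S" for y
    proof -
      have "(\<integral>u. g u y \<partial>M) - (\<integral>u. g u x \<partial>M) - (\<integral>u. g' u x (y - x) \<partial>M) = (\<integral>u. g u y - g u x - g' u x (y - x) \<partial>M)"
        using that S by (simp add: int int')
      then have "norm ((\<integral>u. g u y \<partial>M) - (\<integral>u. g u x \<partial>M) - (\<integral>u. g' u x (y - x) \<partial>M)) \<le> (\<integral>u. norm (g u y - g u x - g' u x (y - x)) \<partial>M)"
        by (simp add: integral_norm_bound)
      then show ?thesis by (simp add: q_def divide_right_mono)
    qed
    show "((\<lambda>y. norm ((\<integral>u. g u y \<partial>M) - (\<integral>u. g u x \<partial>M) - (\<integral>u. g' u x (y - x) \<partial>M)) / norm (y - x)) \<circ> X) \<longlonglongrightarrow> 0"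
      by (rule tendsto_sandwich [OF _ _ tendsto_const lim]) (use le X in \<open>auto simp: comp_def\<close>)
  qed
  then show ?thesis using blin by (simp add: has_derivative_iff_norm)
qed

text \<open>\<open>param_diff g g'\<close> collects what makes \<open>\<integral>u. g u \<sigma>\<close> over \<open>[0,1]\<close> differentiable in \<open>\<sigma>\<close>; unlike
  differentiability of the integral itself, it is stable under products.\<close>

definition param_diff :: "(real \<Rightarrow> 'n::finite cmat \<Rightarrow> 'n cmat) \<Rightarrow> (real \<Rightarrow> 'n cmat \<Rightarrow> 'n cmat \<Rightarrow> 'n cmat) \<Rightarrow> bool"
  where "param_diff g g' \<longleftrightarrow>
    (\<forall>u\<in>{0..1}. \<forall>\<rho>\<in>PD. (g u has_derivative g' u \<rho>) (at \<rho> within PD)) \<and>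
    (\<forall>\<rho>\<in>PD. \<exists>r>0. \<exists>K. \<forall>u\<in>{0..1}. \<forall>\<sigma>\<in>PD \<inter> ball \<rho> r.
        norm (g u \<sigma>) \<le> K \<and> (\<forall>v. norm (g' u \<sigma> v) \<le> K * norm v)) \<and>
    (\<forall>\<rho>\<in>PD. continuous_on {0..1} (\<lambda>u. g u \<rho>)) \<and>
    (\<forall>\<rho>\<in>PD. \<forall>v. continuous_on {0..1} (\<lambda>u. g' u \<rho> v))"

lemma param_diff_boundsE:
  assumes "param_diff g g'" "\<rho> \<in> PD"
  obtains r K where "r > 0" "K \<ge> 0"
    "\<And>u \<sigma>. u \<in> {0..1} \<Longrightarrow> \<sigma> \<in> PD \<Longrightarrow> \<sigma> \<in> ball \<rho> r \<Longrightarrow> norm (g u \<sigma>) \<le> K"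
    "\<And>u \<sigma> v. u \<in> {0..1} \<Longrightarrow> \<sigma> \<in> PD \<Longrightarrow> \<sigma> \<in> ball \<rho> r \<Longrightarrow> norm (g' u \<sigma> v) \<le> K * norm v"
proof -
  obtain r K where r: "r > 0" and K: "\<And>u \<sigma>. u \<in> {0..1} \<Longrightarrow> \<sigma> \<in> PD \<inter> ball \<rho> r \<Longrightarrow>
        norm (g u \<sigma>) \<le> K \<and> (\<forall>v. norm (g' u \<sigma> v) \<le> K * norm v)"
    using assms unfolding param_diff_def by meson
  have "norm (g 0 \<rho>) \<le> K" using K [of 0 \<rho>] r assms by simp
  then have "K \<ge> 0" using norm_ge_zero order_trans by blast
  then show ?thesis using that [OF r] K by blast
qed

lemma param_diff_const: "param_diff (\<lambda>u \<sigma>. A) (\<lambda>u \<sigma> v. 0)"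
proof -
  have b: "\<exists>r>0. \<exists>K. \<forall>u\<in>{0..1::real}. \<forall>\<sigma>\<in>PD \<inter> ball \<rho> r. norm A \<le> K \<and> (\<forall>v :: 'a cmat. norm (0 :: 'a cmat) \<le> K * norm v)" for \<rho>
    by (rule exI [of _ 1], rule conjI [OF zero_less_one], rule exI [of _ "norm A"]) simp
  show ?thesis unfolding param_diff_def
    by (intro conjI ballI allI; (rule b | rule has_derivative_const | rule continuous_on_const))
qed

lemma param_diff_id_minus: "param_diff (\<lambda>u \<sigma>. \<sigma> - A) (\<lambda>u \<sigma> v. v)"
proof -
  have "norm (\<sigma> - A) \<le> norm (\<rho> - A) + 1 \<and> (\<forall>v. norm v \<le> (norm (\<rho> - A) + 1) * norm v)"
    if "\<sigma> \<in> ball \<rho> 1" for \<rho> \<sigma>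
  proof
    show "norm (\<sigma> - A) \<le> norm (\<rho> - A) + 1"
      using that norm_triangle_ineq [of "\<rho> - A" "\<sigma> - \<rho>"] by (simp add: dist_norm norm_minus_commute)
    show "\<forall>v. norm v \<le> (norm (\<rho> - A) + 1) * norm v"
      by (simp add: distrib_right)
  qed
  then have "\<exists>r>0. \<exists>K. \<forall>u\<in>{0..1::real}. \<forall>\<sigma>\<in>PD \<inter> ball \<rho> r. norm (\<sigma> - A) \<le> K \<and> (\<forall>v :: 'a cmat. norm v \<le> K * norm v)" for \<rho>
    by (intro exI [of _ "1 :: real"] conjI [OF zero_less_one] exI [of _ "norm (\<rho> - A) + 1"]) blast
  then show ?thesis unfolding param_diff_def
    by (auto intro!: derivative_eq_intros)
qed

lemma param_diff_scale:
  assumes "param_diff g g'"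
  shows "param_diff (\<lambda>u \<sigma>. (- u) *\<^sub>R g u \<sigma>) (\<lambda>u \<sigma> v. (- u) *\<^sub>R g' u \<sigma> v)"
  unfolding param_diff_def
proof (intro conjI ballI allI)
  fix \<rho> :: "'a cmat" assume \<rho>: "\<rho> \<in> PD"
  obtain r K where r: "r > 0" "K \<ge> 0"
    and K: "\<And>u \<sigma>. u \<in> {0..1} \<Longrightarrow> \<sigma> \<in> PD \<Longrightarrow> \<sigma> \<in> ball \<rho> r \<Longrightarrow> norm (g u \<sigma>) \<le> K"
    "\<And>u \<sigma> v. u \<in> {0..1} \<Longrightarrow> \<sigma> \<in> PD \<Longrightarrow> \<sigma> \<in> ball \<rho> r \<Longrightarrow> norm (g' u \<sigma> v) \<le> K * norm v"
    using param_diff_boundsE [OF assms \<rho>] by metis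
  have le: "\<bar>u\<bar> * a \<le> b" if "u \<in> {0..1}" "a \<le> b" "0 \<le> a" for u a b :: real
    using that mult_left_le_one_le [of a u] by simp
  show "\<exists>r>0. \<exists>K. \<forall>u\<in>{0..1}. \<forall>\<sigma>\<in>PD \<inter> ball \<rho> r. norm ((- u) *\<^sub>R g u \<sigma>) \<le> K \<and>
      (\<forall>v. norm ((- u) *\<^sub>R g' u \<sigma> v) \<le> K * norm v)"
  proof (rule exI [of _ r], rule conjI [OF r(1)], rule exI [of _ K], intro conjI ballI allI)
    fix u \<sigma> v assume u: "u \<in> {0..1::real}" and \<sigma>: "\<sigma> \<in> PD \<inter> ball \<rho> r"
    show "norm ((- u) *\<^sub>R g u \<sigma>) \<le> K"
      using le [OF u K(1) [OF u]] \<sigma> by simp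
    show "norm ((- u) *\<^sub>R g' u \<sigma> v) \<le> K * norm v"
      using le [OF u K(2) [OF u]] \<sigma> by simp
  qed
  show "continuous_on {0..1} (\<lambda>u. (- u) *\<^sub>R g u \<rho>)"
    using assms \<rho> unfolding param_diff_def by (intro continuous_intros) blast+
  show "continuous_on {0..1} (\<lambda>u. (- u) *\<^sub>R g' u \<rho> v)" for v
    using assms \<rho> unfolding param_diff_def by (intro continuous_intros) blast+
  show "((\<lambda>\<sigma>. (- u) *\<^sub>R g u \<sigma>) has_derivative (\<lambda>v. (- u) *\<^sub>R g' u \<rho> v)) (at \<rho> within PD)" if "u \<in> {0..1}" for u
    using assms \<rho> that unfolding param_diff_def by (intro has_derivative_scaleR_right) blast
qed

text \<open>The pointwise product rule; bounds hold on the smaller of the two balls, and the factor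
  2 in the constant accounts for the two terms of the derivative.\<close>

lemma param_diff_bilinear:
  assumes gg: "param_diff g g'" and hh: "param_diff h h'" and B: "bounded_bilinear B"
  shows "param_diff (\<lambda>u \<sigma>. B (g u \<sigma>) (h u \<sigma>)) (\<lambda>u \<sigma> v. B (g u \<sigma>) (h' u \<sigma> v) + B (g' u \<sigma> v) (h u \<sigma>))"
  unfolding param_diff_def
proof (intro conjI ballI allI)
  interpret B: bounded_bilinear B by (rule B)
  fix \<rho> :: "'a cmat" assume \<rho>: "\<rho> \<in> PD"
  obtain r K where r: "r > 0" "K \<ge> 0"
    and K: "\<And>u \<sigma>. u \<in> {0..1} \<Longrightarrow> \<sigma> \<in> PD \<Longrightarrow> \<sigma> \<in> ball \<rho> r \<Longrightarrow> norm (g u \<sigma>) \<le> K"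
    "\<And>u \<sigma> v. u \<in> {0..1} \<Longrightarrow> \<sigma> \<in> PD \<Longrightarrow> \<sigma> \<in> ball \<rho> r \<Longrightarrow> norm (g' u \<sigma> v) \<le> K * norm v"
    using param_diff_boundsE [OF gg \<rho>] by metis
  obtain r' K' where r': "r' > 0" "K' \<ge> 0"
    and K': "\<And>u \<sigma>. u \<in> {0..1} \<Longrightarrow> \<sigma> \<in> PD \<Longrightarrow> \<sigma> \<in> ball \<rho> r' \<Longrightarrow> norm (h u \<sigma>) \<le> K'"
    "\<And>u \<sigma> v. u \<in> {0..1} \<Longrightarrow> \<sigma> \<in> PD \<Longrightarrow> \<sigma> \<in> ball \<rho> r' \<Longrightarrow> norm (h' u \<sigma> v) \<le> K' * norm v"
    using param_diff_boundsE [OF hh \<rho>] by metis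
  obtain C where C: "C > 0" "\<And>a b. norm (B a b) \<le> norm a * norm b * C"
    using B.pos_bounded by blast
  have Cle: "norm (B a b) \<le> x * y * C" if "norm a \<le> x" "norm b \<le> y" for a b x y
  proof -
    have "norm a * norm b \<le> x * y"
      by (intro mult_mono that order_trans [OF norm_ge_zero that(1)] norm_ge_zero)
    then show ?thesis using C(2) [of a b] C(1) by (meson less_imp_le mult_right_mono order_trans)
  qed
  show "\<exists>r>0. \<exists>K. \<forall>u\<in>{0..1}. \<forall>\<sigma>\<in>PD \<inter> ball \<rho> r. norm (B (g u \<sigma>) (h u \<sigma>)) \<le> K \<and>
      (\<forall>v. norm (B (g u \<sigma>) (h' u \<sigma> v) + B (g' u \<sigma> v) (h u \<sigma>)) \<le> K * norm v)"
  proof (rule exI [of _ "min r r'"], rule conjI, use r r' in simp, rule exI [of _ "2 * (K * K' * C)"], intro conjI ballI allI)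
    fix u \<sigma> v assume u: "u \<in> {0..1::real}" and \<sigma>: "\<sigma> \<in> PD \<inter> ball \<rho> (min r r')"
    have "norm (B (g u \<sigma>) (h u \<sigma>)) \<le> K * K' * C"
      by (rule Cle) (use K K' u \<sigma> in auto)
    moreover have "0 \<le> K * K' * C" using r r' C by simp
    ultimately show "norm (B (g u \<sigma>) (h u \<sigma>)) \<le> 2 * (K * K' * C)" by linarith
    have "norm (B (g u \<sigma>) (h' u \<sigma> v)) \<le> K * (K' * norm v) * C"
      by (rule Cle) (use K K' u \<sigma> in auto)
    moreover have "norm (B (g' u \<sigma> v) (h u \<sigma>)) \<le> (K * norm v) * K' * C"
      by (rule Cle) (use K K' u \<sigma> in auto)
    ultimately show "norm (B (g u \<sigma>) (h' u \<sigma> v) + B (g' u \<sigma> v) (h u \<sigma>)) \<le> 2 * (K * K' * C) * norm v"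
      using norm_triangle_ineq [of "B (g u \<sigma>) (h' u \<sigma> v)" "B (g' u \<sigma> v) (h u \<sigma>)"]
      by (simp add: mult_ac)
  qed
  show "continuous_on {0..1} (\<lambda>u. B (g u \<rho>) (h u \<rho>))"
    using gg hh \<rho> unfolding param_diff_def by (intro B.continuous_on) blast+
  show "continuous_on {0..1} (\<lambda>u. B (g u \<rho>) (h' u \<rho> v) + B (g' u \<rho> v) (h u \<rho>))" for v
    using gg hh \<rho> unfolding param_diff_def by (intro continuous_on_add B.continuous_on) blast+
  show "((\<lambda>\<sigma>. B (g u \<sigma>) (h u \<sigma>)) has_derivative (\<lambda>v. B (g u \<rho>) (h' u \<rho> v) + B (g' u \<rho> v) (h u \<rho>))) (at \<rho> within PD)"
    if "u \<in> {0..1}" for u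
    using gg hh \<rho> that unfolding param_diff_def by (intro B.FDERIV) blast+
qed

lemmas param_diff_mult = param_diff_bilinear [OF _ _ bounded_bilinear_matrix_mult]

lemma param_diff_add:
  assumes gg: "param_diff g g'" and hh: "param_diff h h'"
  shows "param_diff (\<lambda>u \<sigma>. g u \<sigma> + h u \<sigma>) (\<lambda>u \<sigma> v. g' u \<sigma> v + h' u \<sigma> v)"
  unfolding param_diff_def
proof (intro conjI ballI allI)
  fix \<rho> :: "'a cmat" assume \<rho>: "\<rho> \<in> PD"
  obtain r K where r: "r > 0" "K \<ge> 0"
    and K: "\<And>u \<sigma>. u \<in> {0..1} \<Longrightarrow> \<sigma> \<in> PD \<Longrightarrow> \<sigma> \<in> ball \<rho> r \<Longrightarrow> norm (g u \<sigma>) \<le> K"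
    "\<And>u \<sigma> v. u \<in> {0..1} \<Longrightarrow> \<sigma> \<in> PD \<Longrightarrow> \<sigma> \<in> ball \<rho> r \<Longrightarrow> norm (g' u \<sigma> v) \<le> K * norm v"
    using param_diff_boundsE [OF gg \<rho>] by metis
  obtain r' K' where r': "r' > 0" "K' \<ge> 0"
    and K': "\<And>u \<sigma>. u \<in> {0..1} \<Longrightarrow> \<sigma> \<in> PD \<Longrightarrow> \<sigma> \<in> ball \<rho> r' \<Longrightarrow> norm (h u \<sigma>) \<le> K'"
    "\<And>u \<sigma> v. u \<in> {0..1} \<Longrightarrow> \<sigma> \<in> PD \<Longrightarrow> \<sigma> \<in> ball \<rho> r' \<Longrightarrow> norm (h' u \<sigma> v) \<le> K' * norm v"
    using param_diff_boundsE [OF hh \<rho>] by metis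
  show "\<exists>r>0. \<exists>K. \<forall>u\<in>{0..1}. \<forall>\<sigma>\<in>PD \<inter> ball \<rho> r. norm (g u \<sigma> + h u \<sigma>) \<le> K \<and>
      (\<forall>v. norm (g' u \<sigma> v + h' u \<sigma> v) \<le> K * norm v)"
  proof (rule exI [of _ "min r r'"], rule conjI, use r r' in simp, rule exI [of _ "K + K'"], intro conjI ballI allI)
    fix u \<sigma> v assume u: "u \<in> {0..1::real}" and \<sigma>: "\<sigma> \<in> PD \<inter> ball \<rho> (min r r')"
    show "norm (g u \<sigma> + h u \<sigma>) \<le> K + K'"
      by (rule norm_triangle_mono) (use K K' u \<sigma> in auto)
    show "norm (g' u \<sigma> v + h' u \<sigma> v) \<le> (K + K') * norm v"
      unfolding distrib_right by (rule norm_triangle_mono) (use K K' u \<sigma> in auto)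
  qed
  show "continuous_on {0..1} (\<lambda>u. g u \<rho> + h u \<rho>)"
    using gg hh \<rho> unfolding param_diff_def by (intro continuous_on_add) blast+
  show "continuous_on {0..1} (\<lambda>u. g' u \<rho> v + h' u \<rho> v)" for v
    using gg hh \<rho> unfolding param_diff_def by (intro continuous_on_add) blast+
  show "((\<lambda>\<sigma>. g u \<sigma> + h u \<sigma>) has_derivative (\<lambda>v. g' u \<rho> v + h' u \<rho> v)) (at \<rho> within PD)"
    if "u \<in> {0..1}" for u
    using gg hh \<rho> that unfolding param_diff_def by (intro has_derivative_add) blast+
qed

text \<open>Everything follows from the resolvent identity and the uniform bound K:
  \<open>res\<close> is Lipschitz in u, and its difference in \<sigma> is linear in \<sigma> -
  \<rho> up to a quadratic error.\<close>

lemma param_diff_res: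
  "param_diff (res :: real \<Rightarrow> 'n::finite cmat \<Rightarrow> 'n cmat) (\<lambda>u \<sigma> V. (- u) *\<^sub>R (res u \<sigma> ** V ** res u \<sigma>))"
  unfolding param_diff_def
proof (intro conjI ballI allI)
  fix \<rho> :: "'n cmat" assume \<rho>: "\<rho> \<in> PD"
  obtain r K where r: "r > 0"
    and inv: "\<And>\<sigma> u. \<sigma> \<in> ball \<rho> r \<Longrightarrow> u \<in> {0..1} \<Longrightarrow> ((1 - u) *\<^sub>R mat 1 + u *\<^sub>R \<sigma>) ** res u \<sigma> = mat 1"
    and K: "\<And>\<sigma> u. \<sigma> \<in> ball \<rho> r \<Longrightarrow> u \<in> {0..1} \<Longrightarrow> norm (res u \<sigma>) \<le> K"
    using res_properties [OF \<rho>] by metis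
  have inv': "res u \<sigma> ** ((1 - u) *\<^sub>R mat 1 + u *\<^sub>R \<sigma>) = mat 1" if "\<sigma> \<in> ball \<rho> r" "u \<in> {0..1}" for \<sigma> u
    using inv [OF that] matrix_left_right_inverse by blast
  have K0: "K \<ge> 0" using K [of \<rho> 0] r by (auto intro: order_trans [OF norm_ge_zero])
  obtain C where C: "C > 0" "\<And>(a :: 'n cmat) (b :: 'n cmat). norm (a ** b) \<le> norm a * norm b * C"
    using mm.pos_bounded by blast
  have tri: "norm (a ** b ** c) \<le> x * y * z * C * C"
    if "norm a \<le> x" "norm b \<le> y" "norm c \<le> z" for a b c :: "'n cmat" and x y z
  proof -
    have x: "0 \<le> x" "0 \<le> y" "0 \<le> z" using that by (auto intro: order_trans [OF norm_ge_zero])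
    have "norm (a ** b) \<le> x * y * C"
      by (rule order_trans [OF C(2)]) (use C(1) x that in \<open>simp add: mult_mono\<close>)
    then have "norm (a ** b) * norm c * C \<le> (x * y * C) * z * C"
      using C(1) x that by (simp add: mult_mono)
    then show ?thesis using C(2) [of "a ** b" c] by (simp add: mult_ac)
  qed
  have scale1: "norm (u *\<^sub>R a) \<le> b" if "\<bar>u\<bar> \<le> 1" "norm a \<le> b" for u b and a :: "'n cmat"
    using mult_right_mono [OF that(1) norm_ge_zero [of a]] that(2) by simp
  show "\<exists>r>0. \<exists>K. \<forall>u\<in>{0..1}. \<forall>\<sigma>\<in>PD \<inter> ball \<rho> r. norm (res u \<sigma>) \<le> K \<and>
      (\<forall>V. norm ((- u) *\<^sub>R (res u \<sigma> ** V ** res u \<sigma>)) \<le> K * norm V)"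
  proof (rule exI [of _ r], rule conjI [OF r], rule exI [of _ "max K (K * K * C * C)"], intro conjI ballI allI)
    fix u \<sigma> V assume u: "u \<in> {0..1::real}" and \<sigma>: "\<sigma> \<in> PD \<inter> ball \<rho> r"
    show "norm (res u \<sigma>) \<le> max K (K * K * C * C)" using K [of \<sigma> u] u \<sigma> by auto
    have "norm (res u \<sigma> ** V ** res u \<sigma>) \<le> K * norm V * K * C * C"
      by (rule tri) (use K u \<sigma> in auto)
    then have "norm ((- u) *\<^sub>R (res u \<sigma> ** V ** res u \<sigma>)) \<le> K * norm V * K * C * C"
      by (rule scale1 [rotated]) (use u in auto)
    also have "\<dots> = (K * K * C * C) * norm V" by simp
    also have "\<dots> \<le> max K (K * K * C * C) * norm V" by (rule mult_right_mono) auto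
    finally show "norm ((- u) *\<^sub>R (res u \<sigma> ** V ** res u \<sigma>)) \<le> max K (K * K * C * C) * norm V" .
  qed
  show cont: "continuous_on {0..1} (\<lambda>u. res u \<rho>)"
  proof -
    have "(K * norm (mat 1 - \<rho>) * K * C * C)-lipschitz_on {0..1} (\<lambda>u. res u \<rho>)"
    proof (rule lipschitz_onI)
      fix u v assume uv: "u \<in> {0..1::real}" "v \<in> {0..1::real}"
      have "res u \<rho> - res v \<rho> = res u \<rho> ** (((1 - v) *\<^sub>R mat 1 + v *\<^sub>R \<rho>) - ((1 - u) *\<^sub>R mat 1 + u *\<^sub>R \<rho>)) ** res v \<rho>"
        by (rule res_diff) (use inv inv' r uv in auto)
      also have "((1 - v) *\<^sub>R mat 1 + v *\<^sub>R \<rho>) - ((1 - u) *\<^sub>R mat 1 + u *\<^sub>R \<rho>) = (u - v) *\<^sub>R (mat 1 - \<rho>)"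
        by (simp add: algebra_simps)
      also have "norm (res u \<rho> ** \<dots> ** res v \<rho>) \<le> K * (\<bar>u - v\<bar> * norm (mat 1 - \<rho>)) * K * C * C"
        by (rule tri) (use K r uv in auto)
      finally show "dist (res u \<rho>) (res v \<rho>) \<le> K * norm (mat 1 - \<rho>) * K * C * C * dist u v"
        by (simp add: dist_norm mult_ac)
    qed (use K0 C(1) in simp)
    then show ?thesis by (rule lipschitz_on_continuous_on)
  qed
  show "continuous_on {0..1} (\<lambda>u. (- u) *\<^sub>R (res u \<rho> ** V ** res u \<rho>))" for V
    by (intro continuous_intros mm.continuous_on cont)
  show "(res u has_derivative (\<lambda>V. (- u) *\<^sub>R (res u \<rho> ** V ** res u \<rho>))) (at \<rho> within PD)" if u: "u \<in> {0..1}" for u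
  proof (rule has_derivativeI_sandwich [of r])
    show "bounded_linear (\<lambda>V. (- u) *\<^sub>R (res u \<rho> ** V ** res u \<rho>))"
      by (intro bounded_linear_scaleR_right [THEN bounded_linear_compose]
          mm.bounded_linear_left [THEN bounded_linear_compose] mm.bounded_linear_right)
    fix \<sigma> :: "'n cmat" assume \<sigma>: "\<sigma> \<in> PD" "\<sigma> \<noteq> \<rho>" "dist \<sigma> \<rho> < r"
    then have \<sigma>r: "\<sigma> \<in> ball \<rho> r" by (simp add: dist_commute)
    have d: "res u \<sigma> - res u \<rho> = res u \<sigma> ** ((- u) *\<^sub>R (\<sigma> - \<rho>)) ** res u \<rho>"
      using res_diff [OF inv [of \<rho> u] inv' [OF \<sigma>r u]] r u by (simp add: algebra_simps)
    have d2: "res u \<sigma> - res u \<rho> = (- u) *\<^sub>R (res u \<sigma> ** (\<sigma> - \<rho>) ** res u \<rho>)"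
      using d by (simp only: mm.scaleR_left mm.scaleR_right)
    have "norm (res u \<sigma> - res u \<rho>) \<le> K * norm (\<sigma> - \<rho>) * K * C * C"
      unfolding d by (rule tri) (use K \<sigma>r r u in \<open>auto simp: mult_left_le_one_le\<close>)
    then have "norm ((res u \<sigma> - res u \<rho>) ** (\<sigma> - \<rho>) ** res u \<rho>) \<le> (K * norm (\<sigma> - \<rho>) * K * C * C) * norm (\<sigma> - \<rho>) * K * C * C"
      by (rule tri) (use K r u in auto)
    then have "norm ((- u) *\<^sub>R ((res u \<sigma> - res u \<rho>) ** (\<sigma> - \<rho>) ** res u \<rho>)) \<le> (K * norm (\<sigma> - \<rho>) * K * C * C) * norm (\<sigma> - \<rho>) * K * C * C"
      by (rule scale1 [rotated]) (use u in auto)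
    \<comment> \<open>The remainder is a product containing both the difference of two resolvents
      and \<sigma> - \<rho>, hence of second order.\<close>
    also have "(- u) *\<^sub>R ((res u \<sigma> - res u \<rho>) ** (\<sigma> - \<rho>) ** res u \<rho>) = res u \<sigma> - res u \<rho> - (- u) *\<^sub>R (res u \<rho> ** (\<sigma> - \<rho>) ** res u \<rho>)"
      unfolding mm.diff_left [of "res u \<sigma>" "res u \<rho>"] mm.diff_left [of "res u \<sigma> ** _"] scaleR_diff_right [of "- u"] d2 [symmetric] ..
    finally show "norm (res u \<sigma> - res u \<rho> - (- u) *\<^sub>R (res u \<rho> ** (\<sigma> - \<rho>) ** res u \<rho>)) / norm (\<sigma> - \<rho>) \<le> (K * K * C * C * K * C * C) * norm (\<sigma> - \<rho>)"
      using \<sigma>(2) by (simp add: divide_le_eq mult_ac)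
  next
    have "((\<lambda>\<sigma>. (K * K * C * C * K * C * C) * norm (\<sigma> - \<rho>)) \<longlongrightarrow> (K * K * C * C * K * C * C) * norm (\<rho> - \<rho>)) (at \<rho> within PD)"
      by (intro tendsto_intros)
    then show "((\<lambda>\<sigma>. (K * K * C * C * K * C * C) * norm (\<sigma> - \<rho>)) \<longlongrightarrow> 0) (at \<rho> within PD)"
      by simp
  qed (rule r)
qed

section \<open>Symmetry of second derivatives\<close>

text \<open>The mean value theorem in s turns the second difference over a square of side h into an
  increment of \<open>gs\<close> in t; linear approximation of \<open>gs\<close> at the origin then
  isolates b. Differentiability of the first partial derivative at one point is enough for
  this.\<close>

lemma second_difference_approx:
  fixes g :: "real \<Rightarrow> real \<Rightarrow> real"
  assumes e: "e > 0" and \<epsilon>: "\<epsilon> > 0"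
    and gs: "\<And>s t. \<bar>s\<bar> < e \<Longrightarrow> \<bar>t\<bar> < e \<Longrightarrow> ((\<lambda>s. g s t) has_real_derivative gs s t) (at s)"
    and lin: "\<And>\<epsilon>. \<epsilon> > 0 \<Longrightarrow> \<exists>d>0. \<forall>s t. \<bar>s\<bar> < d \<and> \<bar>t\<bar> < d \<longrightarrow>
      \<bar>gs s t - gs 0 0 - (a * s + b * t)\<bar> \<le> \<epsilon> * (\<bar>s\<bar> + \<bar>t\<bar>)"
  shows "\<exists>d>0. \<forall>h. 0 < h \<and> h < d \<longrightarrow>
    \<bar>g h h - g h 0 - g 0 h + g 0 0 - b * h\<^sup>2\<bar> \<le> \<epsilon> * h\<^sup>2"
proof -
  \<comment> \<open>The two approximations contribute errors z + h and z, together at most 3 h,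
    which explains the third of \<epsilon>.\<close>
  obtain d where d: "d > 0" "\<And>s t. \<bar>s\<bar> < d \<Longrightarrow> \<bar>t\<bar> < d \<Longrightarrow>
      \<bar>gs s t - gs 0 0 - (a * s + b * t)\<bar> \<le> \<epsilon> / 3 * (\<bar>s\<bar> + \<bar>t\<bar>)"
    using lin [of "\<epsilon> / 3"] \<epsilon> by auto
  show ?thesis
  proof (intro exI [of _ "min d e"] conjI allI impI)
    show "min d e > 0" using d(1) e by simp
    fix h :: real assume "0 < h \<and> h < min d e"
    then have h: "0 < h" "h < min d e" by auto
    have "\<exists>z. 0 < z \<and> z < h \<and> (g h h - g h 0) - (g 0 h - g 0 0) = (h - 0) * (gs z h - gs z 0)"
      by (rule MVT2 [where f = "\<lambda>s. g s h - g s 0" and f' = "\<lambda>s. gs s h - gs s 0"])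
        (use h in \<open>auto intro!: DERIV_diff gs\<close>)
    then obtain z where z: "0 < z" "z < h"
      and eq: "g h h - g h 0 - g 0 h + g 0 0 = h * (gs z h - gs z 0)" by auto
    have "\<bar>gs z h - gs 0 0 - (a * z + b * h)\<bar> \<le> \<epsilon> / 3 * (\<bar>z\<bar> + \<bar>h\<bar>)"
      "\<bar>gs z 0 - gs 0 0 - (a * z + b * 0)\<bar> \<le> \<epsilon> / 3 * (\<bar>z\<bar> + \<bar>0\<bar>)"
      by (rule d(2); use h z in simp)+
    then have "\<bar>gs z h - gs 0 0 - (a * z + b * h)\<bar> \<le> \<epsilon> / 3 * (z + h)"
      "\<bar>gs z 0 - gs 0 0 - a * z\<bar> \<le> \<epsilon> / 3 * z"
      using h z by simp_all
    then have "\<bar>gs z h - gs z 0 - b * h\<bar> \<le> \<epsilon> / 3 * (z + h) + \<epsilon> / 3 * z"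
      by linarith
    also have "\<dots> \<le> \<epsilon> / 3 * (h + h) + \<epsilon> / 3 * h"
      using z \<epsilon> by (intro add_mono mult_left_mono) auto
    finally have "\<bar>gs z h - gs z 0 - b * h\<bar> \<le> \<epsilon> * h" by (simp add: field_simps)
    then have "h * \<bar>gs z h - gs z 0 - b * h\<bar> \<le> h * (\<epsilon> * h)"
      using h by (intro mult_left_mono) auto
    moreover have "g h h - g h 0 - g 0 h + g 0 0 - b * h\<^sup>2 = h * (gs z h - gs z 0 - b * h)"
      unfolding eq by (simp add: power2_eq_square algebra_simps)
    ultimately show "\<bar>g h h - g h 0 - g 0 h + g 0 0 - b * h\<^sup>2\<bar> \<le> \<epsilon> * h\<^sup>2"
      using h by (simp only: abs_mult power2_eq_square) (simp add: mult_ac)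
  qed
qed

text \<open>The second difference is symmetric in the two variables, and divided by h^2 it
  approximates both b and c.\<close>

lemma mixed_partials_eq:
  fixes g :: "real \<Rightarrow> real \<Rightarrow> real"
  assumes e: "e > 0"
    and gs: "\<And>s t. \<bar>s\<bar> < e \<Longrightarrow> \<bar>t\<bar> < e \<Longrightarrow> ((\<lambda>s. g s t) has_real_derivative gs s t) (at s)"
    and gt: "\<And>s t. \<bar>s\<bar> < e \<Longrightarrow> \<bar>t\<bar> < e \<Longrightarrow> ((\<lambda>t. g s t) has_real_derivative gt s t) (at t)"
    and lin_s: "\<And>\<epsilon>. \<epsilon> > 0 \<Longrightarrow> \<exists>d>0. \<forall>s t. \<bar>s\<bar> < d \<and> \<bar>t\<bar> < d \<longrightarrow>
      \<bar>gs s t - gs 0 0 - (a * s + b * t)\<bar> \<le> \<epsilon> * (\<bar>s\<bar> + \<bar>t\<bar>)"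
    and lin_t: "\<And>\<epsilon>. \<epsilon> > 0 \<Longrightarrow> \<exists>d>0. \<forall>s t. \<bar>s\<bar> < d \<and> \<bar>t\<bar> < d \<longrightarrow>
      \<bar>gt s t - gt 0 0 - (c * s + k * t)\<bar> \<le> \<epsilon> * (\<bar>s\<bar> + \<bar>t\<bar>)"
  shows "b = c"
proof (rule ccontr)
  assume "b \<noteq> c"
  \<comment> \<open>Two errors of size \<epsilon> must not add up to the distance between b and
    c.\<close>
  define \<epsilon> where "\<epsilon> = \<bar>b - c\<bar> / 3"
  have \<epsilon>: "\<epsilon> > 0" using \<open>b \<noteq> c\<close> by (simp add: \<epsilon>_def)
  have "\<exists>d>0. \<forall>h. 0 < h \<and> h < d \<longrightarrow> \<bar>g h h - g h 0 - g 0 h + g 0 0 - b * h\<^sup>2\<bar> \<le> \<epsilon> * h\<^sup>2"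
    by (rule second_difference_approx [OF e \<epsilon>]) (fact gs, fact lin_s)
  then obtain d1 where d1: "d1 > 0"
    "\<And>h. 0 < h \<Longrightarrow> h < d1 \<Longrightarrow> \<bar>g h h - g h 0 - g 0 h + g 0 0 - b * h\<^sup>2\<bar> \<le> \<epsilon> * h\<^sup>2"
    by blast
  have lin_t': "\<exists>d>0. \<forall>t s. \<bar>t\<bar> < d \<and> \<bar>s\<bar> < d \<longrightarrow>
      \<bar>gt s t - gt 0 0 - (k * t + c * s)\<bar> \<le> \<epsilon> * (\<bar>t\<bar> + \<bar>s\<bar>)" if "\<epsilon> > 0" for \<epsilon>
    using lin_t [OF that] by (subst add.commute [of "k * _"], subst add.commute [of "\<bar>_\<bar>"]) blast
  have "\<exists>d>0. \<forall>h. 0 < h \<and> h < d \<longrightarrow> \<bar>g h h - g 0 h - g h 0 + g 0 0 - c * h\<^sup>2\<bar> \<le> \<epsilon> * h\<^sup>2"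
    by (rule second_difference_approx [OF e \<epsilon>, of "\<lambda>t s. g s t" "\<lambda>t s. gt s t" k c])
       (erule (1) gt [rotated], fact lin_t')
  then obtain d2 where d2: "d2 > 0"
    "\<And>h. 0 < h \<Longrightarrow> h < d2 \<Longrightarrow> \<bar>g h h - g 0 h - g h 0 + g 0 0 - c * h\<^sup>2\<bar> \<le> \<epsilon> * h\<^sup>2"
    by blast
  define h where "h = min d1 d2 / 2"
  have h: "0 < h" "h < d1" "h < d2" using d1 d2 by (auto simp: h_def)
  have "\<bar>(b - c) * h\<^sup>2\<bar> \<le> 2 * \<epsilon> * h\<^sup>2"
    using d1(2) [OF h(1,2)] d2(2) [OF h(1,3)] by (simp add: abs_le_iff algebra_simps)
  then have "\<bar>b - c\<bar> \<le> 2 * \<epsilon>" using h by (simp add: abs_mult)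
  then show False using \<epsilon> by (simp add: \<epsilon>_def)
qed

section \<open>Derivatives within the positive definite matrices\<close>

lemma has_vector_derivative_PD_line:
  assumes F: "(F has_derivative F') (at (\<tau> + s *\<^sub>R V) within PD)"
    and PD: "\<tau> + s *\<^sub>R V \<in> PD" and V: "V \<in> Herm"
  shows "((\<lambda>r. F (\<tau> + r *\<^sub>R V)) has_vector_derivative F' V) (at s)"
proof -
  obtain e where e: "e > 0" "\<And>r. \<bar>r\<bar> < e \<Longrightarrow> (\<tau> + s *\<^sub>R V) + r *\<^sub>R V \<in> PD"
    using eventually_line_PD [OF PD V] by blast
  have sub: "(\<lambda>r. \<tau> + r *\<^sub>R V) ` ball s e \<subseteq> PD"
  proof clarify
    fix r assume "r \<in> ball s e"
    then have "(\<tau> + s *\<^sub>R V) + (r - s) *\<^sub>R V \<in> PD"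
      by (intro e) (simp add: dist_real_def abs_minus_commute)
    then show "\<tau> + r *\<^sub>R V \<in> PD" by (simp add: algebra_simps)
  qed
  have "((\<lambda>r. \<tau> + r *\<^sub>R V) has_derivative (\<lambda>r. r *\<^sub>R V)) (at s within ball s e)"
    by (auto intro!: derivative_eq_intros)
  moreover have "(F has_derivative F') (at (\<tau> + s *\<^sub>R V) within (\<lambda>r. \<tau> + r *\<^sub>R V) ` ball s e)"
    by (rule has_derivative_subset [OF F sub])
  ultimately have "((\<lambda>r. F (\<tau> + r *\<^sub>R V)) has_derivative (\<lambda>r. F' (r *\<^sub>R V))) (at s within ball s e)"
    by (rule has_derivative_in_compose)
  moreover have "at s within ball s e = at s" by (rule at_within_open) (use e in auto)
  ultimately show ?thesis
    using has_derivative_bounded_linear [OF F, THEN bounded_linear.linear]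
    by (simp add: has_vector_derivative_def linear_cmul)
qed

lemma dir_deriv_eq:
  assumes "(F has_derivative F') (at \<rho> within PD)" "\<rho> \<in> PD" "X \<rho> \<in> Herm"
  shows "dir_deriv X F \<rho> = F' (X \<rho>)"
  unfolding dir_deriv_def
  by (rule vector_derivative_at, rule has_vector_derivative_PD_line) (use assms in simp_all)

lemma dir_deriv_cong:
  assumes eq: "\<And>\<sigma>. \<sigma> \<in> PD \<Longrightarrow> F \<sigma> = G \<sigma>" and \<rho>: "\<rho> \<in> PD" and X: "X \<rho> \<in> Herm"
  shows "dir_deriv X F \<rho> = dir_deriv X G \<rho>"
proof -
  obtain e where e: "e > 0" "\<And>r. \<bar>r\<bar> < e \<Longrightarrow> \<rho> + r *\<^sub>R X \<rho> \<in> PD"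
    using eventually_line_PD [OF \<rho> X] by blast
  have "\<forall>\<^sub>F s in nhds 0. s \<in> UNIV \<longrightarrow> F (\<rho> + s *\<^sub>R X \<rho>) = G (\<rho> + s *\<^sub>R X \<rho>)"
    using e eq by (auto simp: eventually_nhds_metric)
  then show ?thesis unfolding dir_deriv_def by (intro vector_derivative_cong_eq) auto
qed

text \<open>On \<open>PD\<close> the map F equals its conjugate transpose, and along a Hermitian
  direction the derivative is unique, so the two derivatives agree there.\<close>

lemma has_derivative_Herm:
  fixes F :: "'n::finite cmat \<Rightarrow> 'n cmat"
  assumes F: "(F has_derivative F') (at \<rho> within PD)" and \<rho>: "\<rho> \<in> PD" and V: "V \<in> Herm"
    and H: "\<And>\<sigma>. \<sigma> \<in> PD \<Longrightarrow> F \<sigma> \<in> Herm"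
  shows "F' V \<in> Herm"
proof -
  have "((\<lambda>\<sigma>. conj_transpose (F \<sigma>)) has_derivative (\<lambda>v. conj_transpose (F' v))) (at \<rho> within PD)"
    by (rule bounded_linear.has_derivative [OF bounded_linear_conj_transpose F])
  from dir_deriv_eq [OF this \<rho>, of "\<lambda>_. V"]
  have "conj_transpose (F' V) = dir_deriv (\<lambda>_. V) (\<lambda>\<sigma>. conj_transpose (F \<sigma>)) \<rho>" using V by simp
  also have "\<dots> = dir_deriv (\<lambda>_. V) F \<rho>"
    by (rule dir_deriv_cong) (use H \<rho> V in \<open>auto simp: mem_Herm\<close>)
  also have "\<dots> = F' V" by (rule dir_deriv_eq) (use F \<rho> V in auto)
  finally show ?thesis by (simp add: mem_Herm)
qed

text \<open>Each coordinate of F on the plane through \<rho> spanned by A and B is a real function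
  of two real variables; near the origin that plane stays in \<open>PD\<close> because A and B are
  Hermitian.\<close>

lemma second_derivative_symmetric_PD:
  fixes F :: "'n::finite cmat \<Rightarrow> 'n cmat"
  assumes F: "\<And>\<sigma>. \<sigma> \<in> PD \<Longrightarrow> (F has_derivative F' \<sigma>) (at \<sigma> within PD)"
    and \<rho>: "\<rho> \<in> PD" and AB: "A \<in> Herm" "B \<in> Herm"
    and FA: "((\<lambda>\<sigma>. F' \<sigma> A) has_derivative FA) (at \<rho> within PD)"
    and FB: "((\<lambda>\<sigma>. F' \<sigma> B) has_derivative FB) (at \<rho> within PD)"
  shows "FA B = FB A"
proof (rule euclidean_eqI)
  fix w :: "'n cmat"
  define p where "p s t = \<rho> + s *\<^sub>R A + t *\<^sub>R B" for s t
  obtain r where r: "r > 0" "\<And>\<sigma>. \<sigma> \<in> Herm \<Longrightarrow> \<sigma> \<in> ball \<rho> r \<Longrightarrow> \<sigma> \<in> PD"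
    using PD_relatively_open [OF \<rho>] by blast
  define K where "K = norm A + norm B + 1"
  have K: "K > 0" by (simp add: K_def add_nonneg_pos)
  have dist_p: "norm (p s t - \<rho>) \<le> K * (\<bar>s\<bar> + \<bar>t\<bar>)" for s t
  proof -
    have "norm (p s t - \<rho>) \<le> \<bar>s\<bar> * norm A + \<bar>t\<bar> * norm B"
      unfolding p_def using norm_triangle_ineq [of "s *\<^sub>R A" "t *\<^sub>R B"] by (simp add: add.assoc)
    also have "\<dots> \<le> \<bar>s\<bar> * K + \<bar>t\<bar> * K"
      by (intro add_mono mult_left_mono) (auto simp: K_def)
    finally show ?thesis by (simp add: algebra_simps)
  qed
  have small: "K * (\<bar>s\<bar> + \<bar>t\<bar>) < d" if "\<bar>s\<bar> < d / (2 * K)" "\<bar>t\<bar> < d / (2 * K)" for s t d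
    using that K by (simp add: field_simps)
  have pPD: "p s t \<in> PD" if "\<bar>s\<bar> < r / (2 * K)" "\<bar>t\<bar> < r / (2 * K)" for s t
  proof (rule r(2))
    show "p s t \<in> Herm" using \<rho> AB by (simp add: p_def PD_Herm)
    show "p s t \<in> ball \<rho> r"
      using dist_p [of s t] small [OF that] by (simp add: dist_norm norm_minus_commute)
  qed
  have lin: "\<exists>d>0. \<forall>s t. \<bar>s\<bar> < d \<and> \<bar>t\<bar> < d \<longrightarrow>
      \<bar>F' (p s t) C \<bullet> w - F' (p 0 0) C \<bullet> w - (FC A \<bullet> w * s + FC B \<bullet> w * t)\<bar> \<le> \<epsilon> * (\<bar>s\<bar> + \<bar>t\<bar>)"
    if FC: "((\<lambda>\<sigma>. F' \<sigma> C) has_derivative FC) (at \<rho> within PD)" and \<epsilon>: "\<epsilon> > 0" for C FC \<epsilon>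
  proof -
    interpret FC: bounded_linear FC by (rule has_derivative_bounded_linear [OF FC])
    \<comment> \<open>Absorbs the factor K from the displacement and the norm of w; the added 1
      covers w = 0.\<close>
    define \<eta> where "\<eta> = \<epsilon> / (K * (norm w + 1))"
    have \<eta>: "\<eta> > 0" using \<epsilon> K by (simp add: \<eta>_def add_nonneg_pos)
    obtain d where d: "d > 0" "\<And>\<sigma>. \<sigma> \<in> PD \<Longrightarrow> norm (\<sigma> - \<rho>) < d \<Longrightarrow>
        norm (F' \<sigma> C - F' \<rho> C - FC (\<sigma> - \<rho>)) \<le> \<eta> * norm (\<sigma> - \<rho>)"
      using FC \<eta> unfolding has_derivative_within_alt by blast
    have "\<bar>F' (p s t) C \<bullet> w - F' (p 0 0) C \<bullet> w - (FC A \<bullet> w * s + FC B \<bullet> w * t)\<bar> \<le> \<epsilon> * (\<bar>s\<bar> + \<bar>t\<bar>)"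
      if st: "\<bar>s\<bar> < min r d / (2 * K)" "\<bar>t\<bar> < min r d / (2 * K)" for s t
    proof -
      have st': "\<bar>s\<bar> < r / (2 * K)" "\<bar>t\<bar> < r / (2 * K)" "\<bar>s\<bar> < d / (2 * K)" "\<bar>t\<bar> < d / (2 * K)"
        using st K by (auto simp: field_simps)
      have "F' (p s t) C \<bullet> w - F' (p 0 0) C \<bullet> w - (FC A \<bullet> w * s + FC B \<bullet> w * t)
          = (F' (p s t) C - F' \<rho> C - FC (p s t - \<rho>)) \<bullet> w"
        by (simp add: p_def FC.add FC.scaleR inner_diff_left inner_add_left add.assoc mult.commute)
      also have "\<bar>\<dots>\<bar> \<le> norm (F' (p s t) C - F' \<rho> C - FC (p s t - \<rho>)) * norm w"
        by (rule Cauchy_Schwarz_ineq2)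
      also have "\<dots> \<le> (\<eta> * norm (p s t - \<rho>)) * (norm w + 1)"
        by (intro mult_mono d pPD st' order_le_less_trans [OF dist_p small]) (use \<eta> in auto)
      also have "\<dots> \<le> (\<eta> * (K * (\<bar>s\<bar> + \<bar>t\<bar>))) * (norm w + 1)"
        by (intro mult_right_mono mult_left_mono dist_p) (use \<eta> in auto)
      also have "\<dots> = \<epsilon> * (\<bar>s\<bar> + \<bar>t\<bar>)"
      proof -
        have "norm w + 1 \<noteq> 0" by (metis add_nonneg_pos less_irrefl norm_ge_zero zero_less_one)
        then show ?thesis using K by (simp add: \<eta>_def)
      qed
      finally show ?thesis .
    qed
    then show ?thesis using r d K by (intro exI [of _ "min r d / (2 * K)"]) auto
  qed
  have inner_deriv: "((\<lambda>r. f r \<bullet> w) has_real_derivative (D \<bullet> w)) (at s)"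
    if "(f has_vector_derivative D) (at s)" for f :: "real \<Rightarrow> 'n cmat" and D s
    using bounded_linear.has_vector_derivative [OF bounded_linear_inner_left that, of w]
    by (simp add: has_real_derivative_iff_has_vector_derivative)
  show "FA B \<bullet> w = FB A \<bullet> w"
  proof (rule mixed_partials_eq [where g = "\<lambda>s t. F (p s t) \<bullet> w" and gs = "\<lambda>s t. F' (p s t) A \<bullet> w"
        and gt = "\<lambda>s t. F' (p s t) B \<bullet> w" and e = "r / (2 * K)"])
    show "r / (2 * K) > 0" using r K by simp
    fix s t assume st: "\<bar>s\<bar> < r / (2 * K)" "\<bar>t\<bar> < r / (2 * K)"
    have "((\<lambda>s. F ((\<rho> + t *\<^sub>R B) + s *\<^sub>R A)) has_vector_derivative F' (p s t) A) (at s)"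
      by (rule has_vector_derivative_PD_line) (use F [OF pPD [OF st]] pPD [OF st] AB in \<open>simp_all add: p_def ac_simps\<close>)
    then show "((\<lambda>s. F (p s t) \<bullet> w) has_real_derivative F' (p s t) A \<bullet> w) (at s)"
      by (intro inner_deriv) (simp add: p_def ac_simps)
    have "((\<lambda>t. F ((\<rho> + s *\<^sub>R A) + t *\<^sub>R B)) has_vector_derivative F' (p s t) B) (at t)"
      by (rule has_vector_derivative_PD_line) (use F [OF pPD [OF st]] pPD [OF st] AB in \<open>simp_all add: p_def\<close>)
    then show "((\<lambda>t. F (p s t) \<bullet> w) has_real_derivative F' (p s t) B \<bullet> w) (at t)"
      by (intro inner_deriv) (simp add: p_def)
  qed (rule lin [OF FA] lin [OF FB]; assumption)+
qed

section \<open>Families of linear maps\<close>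

lemma linear_Basis_expansion:
  fixes f :: "'b::euclidean_space \<Rightarrow> 'c::real_vector"
  assumes "linear f"
  shows "f z = (\<Sum>b\<in>Basis. (z \<bullet> b) *\<^sub>R f b)"
  using linear_sum [OF assms, of "\<lambda>b. (z \<bullet> b) *\<^sub>R b" Basis]
  by (simp add: euclidean_representation linear_cmul [OF assms])

text \<open>A product rule for an operator family that is differentiable only after evaluation at
  fixed vectors. In finite dimension the basis expansion reduces it to finitely many scalar
  multiples.\<close>

lemma has_derivative_linear_family:
  fixes T :: "'a::real_normed_vector \<Rightarrow> 'b::euclidean_space \<Rightarrow> 'c::real_normed_vector"
  assumes x: "x \<in> S" and lin: "\<And>y. y \<in> S \<Longrightarrow> linear (T y)" and lin': "\<And>h. linear (T' h)"
    and T: "\<And>b. ((\<lambda>y. T y b) has_derivative (\<lambda>h. T' h b)) (at x within S)"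
    and g: "(g has_derivative g') (at x within S)"
  shows "((\<lambda>y. T y (g y)) has_derivative (\<lambda>h. T' h (g x) + T x (g' h))) (at x within S)"
proof -
  have "((\<lambda>y. \<Sum>b\<in>Basis. (g y \<bullet> b) *\<^sub>R T y b) has_derivative
      (\<lambda>h. \<Sum>b\<in>Basis. (g x \<bullet> b) *\<^sub>R T' h b + (g' h \<bullet> b) *\<^sub>R T x b)) (at x within S)"
    by (intro has_derivative_sum has_derivative_scaleR has_derivative_inner_left g T)
  also have "(\<lambda>h. \<Sum>b\<in>Basis. (g x \<bullet> b) *\<^sub>R T' h b + (g' h \<bullet> b) *\<^sub>R T x b) = (\<lambda>h. T' h (g x) + T x (g' h))"
    by (simp add: sum.distrib linear_Basis_expansion [OF lin', symmetric] linear_Basis_expansion [OF lin [OF x], symmetric])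
  finally show ?thesis
    by (rule has_derivative_transform [OF x, rotated]) (rule linear_Basis_expansion [OF lin])
qed

text \<open>Derivatives within S need not be unique, so those chosen separately for each vector need
  not depend linearly on it. \<open>T'\<close> is rebuilt from the choices on the basis to enforce
  linearity.\<close>

lemma differentiable_linear_family:
  fixes T :: "'a::real_normed_vector \<Rightarrow> 'b::euclidean_space \<Rightarrow> 'c::real_normed_vector"
  assumes x: "x \<in> S" and lin: "\<And>y. y \<in> S \<Longrightarrow> linear (T y)"
    and T: "\<And>b. (\<lambda>y. T y b) differentiable (at x within S)"
    and g: "(g has_derivative g') (at x within S)"
  obtains T' where "\<And>h. linear (T' h)"
    "((\<lambda>y. T y (g y)) has_derivative (\<lambda>h. T' h (g x) + T x (g' h))) (at x within S)"
proof -
  obtain D where D: "\<And>b. ((\<lambda>y. T y b) has_derivative D b) (at x within S)"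
    using T unfolding differentiable_def by metis
  define T' where "T' h z = (\<Sum>b\<in>Basis. (z \<bullet> b) *\<^sub>R D b h)" for h z
  have lin': "linear (T' h)" for h
    by (rule linearI)
       (simp_all add: T'_def inner_add_left scaleR_add_left sum.distrib scaleR_sum_right)
  have "((\<lambda>y. T y z) has_derivative (\<lambda>h. T' h z)) (at x within S)" for z
  proof -
    have "((\<lambda>y. \<Sum>b\<in>Basis. (z \<bullet> b) *\<^sub>R T y b) has_derivative (\<lambda>h. T' h z)) (at x within S)"
      unfolding T'_def by (intro has_derivative_sum has_derivative_scaleR_right D)
    then show ?thesis
      by (rule has_derivative_transform [OF x, rotated]) (rule linear_Basis_expansion [OF lin])
  qed
  from has_derivative_linear_family [OF x lin lin' this g] lin' show ?thesis
    by (intro that)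
qed

text \<open>Near x, \<psi> is of the order of y - x, and the factor tending to 0 makes the product
  of smaller order. This handles a \<phi> whose differentiability is still to be proved.\<close>

lemma has_derivative_scaleR_null:
  fixes \<psi> :: "'a::real_normed_vector \<Rightarrow> 'b::real_normed_vector"
  assumes \<phi>: "(\<phi> \<longlongrightarrow> 0) (at x within S)" and \<psi>: "(\<psi> has_derivative \<psi>') (at x within S)" and 0: "\<psi> x = 0"
  shows "((\<lambda>y. \<phi> y *\<^sub>R \<psi> y) has_derivative (\<lambda>h. 0)) (at x within S)"
proof -
  interpret bounded_linear \<psi>' by (rule has_derivative_bounded_linear [OF \<psi>])
  obtain K where K: "\<And>h. norm (\<psi>' h) \<le> norm h * K" using bounded by blast
  let ?q = "\<lambda>y. norm (\<psi> y - \<psi> x - \<psi>' (y - x)) / norm (y - x)"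
  have le: "norm (\<phi> y *\<^sub>R \<psi> y - \<phi> x *\<^sub>R \<psi> x - 0) / norm (y - x) \<le> \<bar>\<phi> y\<bar> * (?q y + K)" if "y \<noteq> x" for y
  proof -
    have "norm (\<psi> y) \<le> norm (\<psi> y - \<psi>' (y - x)) + norm (\<psi>' (y - x))"
      using norm_triangle_ineq [of "\<psi> y - \<psi>' (y - x)" "\<psi>' (y - x)"] by simp
    also have "\<dots> \<le> norm (\<psi> y - \<psi> x - \<psi>' (y - x)) + K * norm (y - x)"
      using K [of "y - x"] by (simp add: 0 mult.commute)
    also have "\<dots> = (?q y + K) * norm (y - x)"
      using that by (simp add: distrib_right)
    finally have "norm (\<psi> y) / norm (y - x) \<le> ?q y + K"
      using that by (subst pos_divide_le_eq) auto
    then have "\<bar>\<phi> y\<bar> * (norm (\<psi> y) / norm (y - x)) \<le> \<bar>\<phi> y\<bar> * (?q y + K)"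
      by (rule mult_left_mono) simp
    then show ?thesis by (simp add: 0)
  qed
  have "(?q \<longlongrightarrow> 0) (at x within S)" using \<psi> by (simp add: has_derivative_iff_norm)
  from tendsto_mult [OF tendsto_rabs [OF \<phi>] tendsto_add [OF this tendsto_const [of K]]]
  have lim: "((\<lambda>y. \<bar>\<phi> y\<bar> * (?q y + K)) \<longlongrightarrow> 0) (at x within S)" by simp
  show ?thesis
    by (rule has_derivativeI_sandwich [of 1, OF _ _ _ lim]) (use le in auto)
qed

text \<open>Differentiates the solution g of T y (g y) = G y without differentiating inverse
  operators. A lower bound for T x persists nearby and first gives continuity of g; then T x (g y)
  is a differentiable expression plus a product of two small factors, and a left inverse of T x
  recovers g.\<close>

lemma differentiable_linear_family_inverse:
  fixes T :: "'a::real_normed_vector \<Rightarrow> 'b::euclidean_space \<Rightarrow> 'c::euclidean_space"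
  assumes x: "x \<in> S" and lin: "\<And>y. y \<in> S \<Longrightarrow> linear (T y)" and lin': "\<And>h. linear (T' h)"
    and T: "\<And>b. ((\<lambda>y. T y b) has_derivative (\<lambda>h. T' h b)) (at x within S)"
    and inj: "inj (T x)"
    and G: "(G has_derivative G') (at x within S)" and Tg: "\<And>y. y \<in> S \<Longrightarrow> T y (g y) = G y"
  shows "g differentiable (at x within S)"
proof -
  obtain c where c: "c > 0" "\<And>z. c * norm z \<le> norm (T x z)"
    using linear_inj_bounded_below_pos [OF lin [OF x] inj] by metis
  \<comment> \<open>E bounds the operator norm of the perturbation T y - T x and tends to 0.\<close>
  define E where "E y = (\<Sum>b\<in>Basis. norm (T y b - T x b))" for y
  have Tdiff: "T y z - T x z = (\<Sum>b\<in>Basis. (z \<bullet> b) *\<^sub>R (T y b - T x b))" if "y \<in> S" for y z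
    unfolding scaleR_diff_right sum_subtractf
      linear_Basis_expansion [OF lin [OF that], of z, symmetric] linear_Basis_expansion [OF lin [OF x], of z, symmetric] ..
  have E: "norm (T y z - T x z) \<le> E y * norm z" if "y \<in> S" for y z
  proof -
    have "norm (T y z - T x z) \<le> (\<Sum>b\<in>Basis. norm ((z \<bullet> b) *\<^sub>R (T y b - T x b)))"
      unfolding Tdiff [OF that, of z] by (rule norm_sum)
    also have "\<dots> \<le> (\<Sum>b\<in>Basis. norm (T y b - T x b) * norm z)"
    proof (rule sum_mono)
      fix b :: 'b assume "b \<in> Basis"
      then have "\<bar>z \<bullet> b\<bar> * norm (T y b - T x b) \<le> norm z * norm (T y b - T x b)"
        by (intro mult_right_mono Basis_le_norm) auto
      then show "norm ((z \<bullet> b) *\<^sub>R (T y b - T x b)) \<le> norm (T y b - T x b) * norm z"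
        by (simp add: mult.commute)
    qed
    finally show ?thesis by (simp add: E_def sum_distrib_right)
  qed
  have "((\<lambda>y. T y b) \<longlongrightarrow> T x b) (at x within S)" for b
    using has_derivative_continuous [OF T] by (simp add: continuous_within)
  then have "((\<lambda>y. E y) \<longlongrightarrow> (\<Sum>b\<in>Basis. norm (T x b - T x b))) (at x within S)"
    unfolding E_def by (intro tendsto_intros)
  then have "(E \<longlongrightarrow> 0) (at x within S)" by simp
  then have ev_E: "\<forall>\<^sub>F y in at x within S. E y < c / 2"
    using c(1) by (intro order_tendstoD(2)) auto
  \<comment> \<open>The defect of the constant guess g x in the equation at y; it controls g y - g
    x.\<close>
  define H where "H y = G y - T y (g x)" for y
  have H: "(H has_derivative (\<lambda>h. G' h - T' h (g x))) (at x within S)"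
    unfolding H_def by (intro has_derivative_diff G T)
  have Hx: "H x = 0" using Tg [OF x] by (simp add: H_def)
  have ev_S: "\<forall>\<^sub>F y in at x within S. y \<in> S" by (simp add: eventually_at_filter)
  have ev_g: "\<forall>\<^sub>F y in at x within S. norm (g y - g x) \<le> (2 / c) * norm (H y)"
    using ev_E ev_S
  proof eventually_elim
    case (elim y)
    let ?z = "g y - g x"
    have "c * norm ?z \<le> norm (T y ?z) + norm (T y ?z - T x ?z)"
      using c(2) [of ?z] norm_triangle_ineq4 [of "T y ?z" "T y ?z - T x ?z"] by simp
    also have "T y ?z = H y"
      using linear_diff [OF lin [OF elim(2)]] Tg [OF elim(2)] by (simp add: H_def)
    also have "norm (H y - T x ?z) \<le> c / 2 * norm ?z"
      using E [OF elim(2), of ?z] mult_right_mono [OF less_imp_le [OF elim(1)] norm_ge_zero [of ?z]]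
        \<open>T y ?z = H y\<close> by simp
    finally show ?case using c(1) by (simp add: field_simps)
  qed
  have "((\<lambda>y. (2 / c) * norm (H y)) \<longlongrightarrow> (2 / c) * norm (H x)) (at x within S)"
    using has_derivative_continuous [OF H] by (intro tendsto_intros) (simp add: continuous_within)
  then have "((\<lambda>y. (2 / c) * norm (H y)) \<longlongrightarrow> 0) (at x within S)" by (simp only: Hx norm_zero mult_zero_right)
  with ev_g have gx: "((\<lambda>y. g y - g x) \<longlongrightarrow> 0) (at x within S)"
    by (rule Lim_null_comparison)
  \<comment> \<open>The error of replacing T y by T x on g y - g x. One factor tends to 0 by
    continuity of g, the other is differentiable and vanishes at x, so Q has derivative 0.\<close>
  define Q where "Q y = (\<Sum>b\<in>Basis. ((g y - g x) \<bullet> b) *\<^sub>R (T y b - T x b))" for y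
  have "(Q has_derivative (\<lambda>h. \<Sum>b\<in>(Basis :: 'b set). 0)) (at x within S)"
    unfolding Q_def
  proof (intro has_derivative_sum has_derivative_scaleR_null)
    fix b :: 'b
    show "((\<lambda>y. (g y - g x) \<bullet> b) \<longlongrightarrow> 0) (at x within S)"
      using tendsto_inner [OF gx tendsto_const [of b]] by simp
    show "((\<lambda>y. T y b - T x b) has_derivative (\<lambda>h. T' h b - 0)) (at x within S)"
      by (intro has_derivative_diff T has_derivative_const)
  qed simp
  then have "((\<lambda>y. G y - T y (g x) + T x (g x) - Q y) has_derivative (\<lambda>h. (G' h - T' h (g x)) + 0 - (\<Sum>b\<in>(Basis :: 'b set). 0))) (at x within S)"
    by (intro has_derivative_diff has_derivative_add G T has_derivative_const)
  moreover have eq: "T x (g y) = G y - T y (g x) + T x (g x) - Q y" if "y \<in> S" for y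
  proof -
    have "Q y = T y (g y - g x) - T x (g y - g x)"
      unfolding Q_def by (rule Tdiff [OF that, symmetric])
    also have "\<dots> = G y - T y (g x) - (T x (g y) - T x (g x))"
      by (simp add: linear_diff [OF lin [OF x]] linear_diff [OF lin [OF that]] Tg [OF that])
    finally show ?thesis by simp
  qed
  ultimately have D: "((\<lambda>y. T x (g y)) has_derivative (\<lambda>h. (G' h - T' h (g x)) + 0 - (\<Sum>b\<in>(Basis :: 'b set). 0))) (at x within S)"
    by (rule has_derivative_transform [OF x, rotated])
  obtain L where L: "linear L" "L \<circ> T x = id"
    using linear_injective_left_inverse [OF lin [OF x] inj] by blast
  have "bounded_linear L" using L(1) by (simp add: linear_conv_bounded_linear)
  from bounded_linear.has_derivative [OF this D]
  have "((\<lambda>y. (L \<circ> T x) (g y)) has_derivative (\<lambda>h. L ((G' h - T' h (g x)) + 0 - (\<Sum>b\<in>(Basis :: 'b set). 0)))) (at x within S)"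
    unfolding o_def .
  then show ?thesis unfolding L(2) id_apply differentiable_def by blast
qed

section \<open>Integral representation of the functional calculus\<close>

lemma denominator_pos: "0 < x \<Longrightarrow> u \<in> {0..1} \<Longrightarrow> 1 - u + u * x > 0" for x u :: real
  by (cases "u = 1") (auto intro: add_pos_nonneg)

text \<open>Prescribing only the derivative of \<open>f_alpha\<close> lets one measure handle
  logarithm and powers alike; the additive constant reappears as the value at 1. Positive mass is
  what makes L injective.\<close>

locale alpha_kernel = finite_measure M for M :: "real measure" +
  fixes \<alpha> :: real
  assumes sets_M: "sets M = sets (restrict_space borel {0..1})"
    and mass_pos: "measure M (space M) > 0"
    and f_deriv: "\<And>x. x > 0 \<Longrightarrow>
      (f_alpha \<alpha> has_real_derivative (\<integral>u. 1 / (1 - u + u * x)\<^sup>2 \<partial>M)) (at x)"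
begin

lemma space_M: "space M = {0..1}"
  using sets_eq_imp_space_eq [OF sets_M] by (simp add: space_restrict_space)

lemma integrable_continuous:
  fixes g :: "real \<Rightarrow> 'b::{banach,second_countable_topology}"
  assumes g: "continuous_on {0..1} g"
  shows "integrable M g"
proof -
  obtain B where B: "\<And>u. u \<in> {0..1} \<Longrightarrow> norm (g u) \<le> B"
    using compact_imp_bounded [OF compact_continuous_image [OF g compact_Icc]]
    unfolding bounded_iff by blast
  show ?thesis
  proof (rule integrable_const_bound)
    show "AE u in M. norm (g u) \<le> B" by (rule AE_I2) (simp add: space_M B)
    show "g \<in> borel_measurable M"
      using borel_measurable_continuous_on_restrict [OF g] measurable_cong_sets [OF sets_M refl] by blast
  qed
qed

lemma has_derivative_integral_PD:
  assumes g: "param_diff g g'" and \<rho>: "\<rho> \<in> PD"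
  shows "((\<lambda>\<sigma>. \<integral>u. g u \<sigma> \<partial>M) has_derivative (\<lambda>v. \<integral>u. g' u \<rho> v \<partial>M)) (at \<rho> within PD)"
proof -
  obtain r K where r: "r > 0" "K \<ge> 0"
    and K: "\<And>u \<sigma>. u \<in> {0..1} \<Longrightarrow> \<sigma> \<in> PD \<Longrightarrow> \<sigma> \<in> ball \<rho> r \<Longrightarrow> norm (g u \<sigma>) \<le> K"
    "\<And>u \<sigma> v. u \<in> {0..1} \<Longrightarrow> \<sigma> \<in> PD \<Longrightarrow> \<sigma> \<in> ball \<rho> r \<Longrightarrow> norm (g' u \<sigma> v) \<le> K * norm v"
    using param_diff_boundsE [OF g \<rho>] by metis
  have "((\<lambda>\<sigma>. \<integral>u. g u \<sigma> \<partial>M) has_derivative (\<lambda>v. \<integral>u. g' u \<rho> v \<partial>M)) (at \<rho> within PD \<inter> ball \<rho> r)"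
  proof (rule has_derivative_integral_finite_measure)
    show "finite_measure M" by unfold_locales
    show "convex (PD \<inter> ball \<rho> r)" by (intro convex_Int convex_PD convex_ball)
    show "\<rho> \<in> PD \<inter> ball \<rho> r" using \<rho> r by simp
    fix u assume u: "u \<in> space M"
    fix \<sigma> assume \<sigma>: "\<sigma> \<in> PD \<inter> ball \<rho> r"
    have "(g u has_derivative g' u \<sigma>) (at \<sigma> within PD)"
      using g u \<sigma> by (simp add: param_diff_def space_M)
    then show "(g u has_derivative g' u \<sigma>) (at \<sigma> within PD \<inter> ball \<rho> r)"
      by (rule has_derivative_subset) simp
    show "norm (g' u \<sigma> v) \<le> K * norm v" for v
      by (rule K) (use u \<sigma> in \<open>auto simp: space_M\<close>)
  next
    fix \<sigma> assume "\<sigma> \<in> PD \<inter> ball \<rho> r"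
    then show "integrable M (\<lambda>u. g u \<sigma>)"
      using g by (intro integrable_continuous) (simp add: param_diff_def)
  next
    fix v show "integrable M (\<lambda>u. g' u \<rho> v)"
      using g \<rho> by (intro integrable_continuous) (simp add: param_diff_def)
  qed
  moreover have "at \<rho> within PD \<inter> ball \<rho> r = at \<rho> within PD"
    by (rule at_within_nhd [of _ "ball \<rho> r"]) (use r in auto)
  ultimately show ?thesis by simp
qed

text \<open>The integrand has derivative 1 / (1 - u + u x)^2 in x and vanishes at x = 1, so both
  sides have the same derivative on the positive half line and agree at 1.\<close>

lemma f_eq_integral:
  assumes x: "x > 0"
  shows "f_alpha \<alpha> x = f_alpha \<alpha> 1 + (\<integral>u. (x - 1) / (1 - u + u * x) \<partial>M)"
proof -
  define h where "h y = (\<integral>u. (y - 1) / (1 - u + u * y) \<partial>M)" for y :: real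
  have cont: "continuous_on {0..1} (\<lambda>u. (y - 1) / (1 - u + u * y))" "continuous_on {0..1} (\<lambda>u. 1 / (1 - u + u * y)\<^sup>2)"
    if "y > 0" for y :: real
    using denominator_pos [OF that] by (auto intro!: continuous_intros simp: less_imp_neq [THEN not_sym])
  have h: "(h has_real_derivative (\<integral>u. 1 / (1 - u + u * y)\<^sup>2 \<partial>M)) (at y)" if y: "y > 0" for y
  proof -
    \<comment> \<open>Staying above y/2 keeps the denominator at least min 1 (y/2), uniformly in
      u.\<close>
    have "(h has_derivative (\<lambda>v. \<integral>u. v / (1 - u + u * y)\<^sup>2 \<partial>M)) (at y within {y/2<..})"
      unfolding h_def
    proof (rule has_derivative_integral_finite_measure [where K = "1 / (min 1 (y/2))\<^sup>2" and g' = "\<lambda>u z v. v / (1 - u + u * z)\<^sup>2"])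
      show "finite_measure M" by unfold_locales
      show "convex {y/2<..}" by simp
      show "y \<in> {y/2<..}" using y by simp
      show "integrable M (\<lambda>u. v / (1 - u + u * y)\<^sup>2)" for v
        using integrable_mult_right [OF integrable_continuous [OF cont(2) [OF y]], of v] by simp
      show "integrable M (\<lambda>u. (z - 1) / (1 - u + u * z))" if "z \<in> {y/2<..}" for z
        using that y by (intro integrable_continuous cont) auto
    next
      fix u z v assume u: "u \<in> space M" and z: "z \<in> {y/2<..}"
      have z0: "z > 0" using z y by auto
      have pos: "1 - u + u * z > 0" using u z0 by (intro denominator_pos) (auto simp: space_M)
      have "((\<lambda>z. (z - 1) / (1 - u + u * z)) has_real_derivative (1 * (1 - u + u * z) - (z - 1) * u) / ((1 - u + u * z) * (1 - u + u * z))) (at z)"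
        using pos by (auto intro!: derivative_eq_intros)
      also have "(1 * (1 - u + u * z) - (z - 1) * u) = 1" by (simp add: algebra_simps)
      finally have "((\<lambda>z. (z - 1) / (1 - u + u * z)) has_derivative (\<lambda>v. v / (1 - u + u * z)\<^sup>2)) (at z)"
        unfolding has_field_derivative_def
        by (rule has_derivative_eq_rhs) (simp add: fun_eq_iff power2_eq_square)
      then show "((\<lambda>z. (z - 1) / (1 - u + u * z)) has_derivative (\<lambda>v. v / (1 - u + u * z)\<^sup>2)) (at z within {y/2<..})"
        by (rule has_derivative_at_withinI)
      let ?m = "min 1 (y/2)"
      have m: "?m > 0" using y by simp
      have "?m = (1 - u) * ?m + u * ?m" by (simp add: algebra_simps)
      also have "\<dots> \<le> (1 - u) * 1 + u * z"
        using u z by (intro add_mono mult_left_mono) (auto simp: space_M)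
      finally have "?m\<^sup>2 \<le> (1 - u + u * z)\<^sup>2" using m by (intro power_mono) auto
      then have "\<bar>v\<bar> / (1 - u + u * z)\<^sup>2 \<le> \<bar>v\<bar> / ?m\<^sup>2"
        using m pos by (intro divide_left_mono) auto
      then show "norm (v / (1 - u + u * z)\<^sup>2) \<le> 1 / ?m\<^sup>2 * norm v" by simp
    qed
    moreover have "at y within {y/2<..} = at y" by (rule at_within_open) (use y in auto)
    moreover have "(\<lambda>v. \<integral>u. v / (1 - u + u * y)\<^sup>2 \<partial>M) = (*) (\<integral>u. 1 / (1 - u + u * y)\<^sup>2 \<partial>M)"
    proof
      fix v
      have "(\<integral>u. v / (1 - u + u * y)\<^sup>2 \<partial>M) = (\<integral>u. v * (1 / (1 - u + u * y)\<^sup>2) \<partial>M)" by simp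
      also have "\<dots> = v * (\<integral>u. 1 / (1 - u + u * y)\<^sup>2 \<partial>M)" by (rule integral_mult_right_zero)
      finally show "(\<integral>u. v / (1 - u + u * y)\<^sup>2 \<partial>M) = (\<integral>u. 1 / (1 - u + u * y)\<^sup>2 \<partial>M) * v"
        by (simp only: mult.commute)
    qed
    ultimately show ?thesis by (simp add: has_field_derivative_def)
  qed
  have "((\<lambda>y. f_alpha \<alpha> y - h y) has_real_derivative 0) (at y within {0<..})" if "y \<in> {0<..}" for y
    using DERIV_diff [OF f_deriv h, of y] that by (auto intro: has_field_derivative_at_within)
  from has_field_derivative_zero_constant [OF convex_real_interval(3) [of "0 :: real"] this]
  obtain c where c: "\<And>y. y \<in> {0<..} \<Longrightarrow> f_alpha \<alpha> y - h y = c" by blast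
  have "f_alpha \<alpha> x - h x = f_alpha \<alpha> 1 - h 1" using c x by simp
  moreover have "h 1 = 0" by (simp add: h_def)
  ultimately show ?thesis by (simp add: h_def)
qed

text \<open>\<open>Lop \<rho> V\<close> is the derivative of the functional calculus at \<open>\<rho>\<close> along \<open>V\<close>, that is \<open>L\<^sub>\<alpha>[\<rho>](V)\<close>, and
  \<open>Lam \<rho> V W\<close> its second derivative.\<close>

definition Lop :: "'n::finite cmat \<Rightarrow> 'n cmat \<Rightarrow> 'n cmat" where
  "Lop \<rho> V = (\<integral>u. res u \<rho> ** V ** res u \<rho> \<partial>M)"

definition Lam :: "'n::finite cmat \<Rightarrow> 'n cmat \<Rightarrow> 'n cmat \<Rightarrow> 'n cmat" where
  "Lam \<rho> V W = (\<integral>u. (- u) *\<^sub>R (res u \<rho> ** V ** res u \<rho> ** W ** res u \<rho>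
      + res u \<rho> ** W ** res u \<rho> ** V ** res u \<rho>) \<partial>M)"

lemma continuous_res: "\<rho> \<in> PD \<Longrightarrow> continuous_on {0..1} (\<lambda>u. res u \<rho>)"
  using param_diff_res by (auto simp: param_diff_def)

lemma integrable_Lop: "\<rho> \<in> PD \<Longrightarrow> integrable M (\<lambda>u. res u \<rho> ** V ** res u \<rho>)"
  by (intro integrable_continuous mm.continuous_on continuous_on_const continuous_res)

lemma Lop_has_derivative:
  assumes \<rho>: "\<rho> \<in> PD"
  shows "((\<lambda>\<sigma>. Lop \<sigma> W) has_derivative (\<lambda>V. Lam \<rho> V W)) (at \<rho> within PD)"
proof -
  note p = param_diff_mult [OF param_diff_mult [OF param_diff_res param_diff_const [of W]] param_diff_res]
  show ?thesis
    using has_derivative_integral_PD [OF p \<rho>]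
    by (simp add: Lop_def Lam_def mm.scaleR_left mm.scaleR_right mm.minus_left mm.minus_right
        matrix_mul_assoc scaleR_add_right add.commute)
qed

lemma Lam_differentiable:
  assumes \<rho>: "\<rho> \<in> PD"
  shows "(\<lambda>\<sigma>. Lam \<sigma> V W) differentiable (at \<rho> within PD)"
proof -
  have p: "\<exists>g'. param_diff (\<lambda>u \<sigma>. res u \<sigma> ** V ** res u \<sigma> ** W ** res u \<sigma>) g'" for V W :: "'n::finite cmat"
    using param_diff_mult [OF param_diff_mult [OF param_diff_mult [OF param_diff_mult
      [OF param_diff_res param_diff_const [of V]] param_diff_res] param_diff_const [of W]] param_diff_res] by blast
  obtain g1 where 1: "param_diff (\<lambda>u \<sigma>. res u \<sigma> ** V ** res u \<sigma> ** W ** res u \<sigma>) g1" using p by blast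
  obtain g2 where 2: "param_diff (\<lambda>u \<sigma>. res u \<sigma> ** W ** res u \<sigma> ** V ** res u \<sigma>) g2" using p by blast
  from has_derivative_integral_PD [OF param_diff_scale [OF param_diff_add [OF 1 2]] \<rho>]
  show ?thesis unfolding Lam_def differentiable_def by blast
qed

lemma Lam_commute: "Lam \<rho> V W = Lam \<rho> W V"
  by (simp add: Lam_def add.commute)

lemma linear_Lop: "\<rho> \<in> PD \<Longrightarrow> linear (Lop \<rho>)"
proof (rule linearI)
  assume \<rho>: "\<rho> \<in> PD"
  show "Lop \<rho> (V + W) = Lop \<rho> V + Lop \<rho> W" for V W
    unfolding Lop_def mm.add_left mm.add_right
    by (rule Bochner_Integration.integral_add) (rule integrable_Lop [OF \<rho>])+
  show "Lop \<rho> (c *\<^sub>R V) = c *\<^sub>R Lop \<rho> V" for c V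
    unfolding Lop_def mm.scaleR_left mm.scaleR_right by simp
qed

lemma linear_Lam_left: "\<rho> \<in> PD \<Longrightarrow> linear (\<lambda>V. Lam \<rho> V W)"
  using Lop_has_derivative has_derivative_bounded_linear bounded_linear.linear by blast

lemma linear_Lam_right: "\<rho> \<in> PD \<Longrightarrow> linear (Lam \<rho> V)"
  using linear_Lam_left [of \<rho> V] by (simp add: Lam_commute [of \<rho> _ V])

section \<open>The first derivative as an invertible operator\<close>

lemma conj_transpose_Lop:
  assumes \<rho>: "\<rho> \<in> PD" shows "conj_transpose (Lop \<rho> V) = Lop \<rho> (conj_transpose V)"
proof -
  have "conj_transpose (Lop \<rho> V) = (\<integral>u. conj_transpose (res u \<rho> ** V ** res u \<rho>) \<partial>M)"
    unfolding Lop_def by (rule integral_bounded_linear [OF bounded_linear_conj_transpose integrable_Lop [OF \<rho>], symmetric])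
  also have "\<dots> = Lop \<rho> (conj_transpose V)"
    unfolding Lop_def
    by (rule Bochner_Integration.integral_cong)
       (simp_all add: conj_transpose_mult res_Herm [OF \<rho>] space_M matrix_mul_assoc)
  finally show ?thesis .
qed

lemma Lop_Herm: "\<rho> \<in> PD \<Longrightarrow> V \<in> Herm \<Longrightarrow> Lop \<rho> V \<in> Herm"
  by (simp add: mem_Herm conj_transpose_Lop)

text \<open>In an eigenbasis of \<rho>, L multiplies each entry by a number; for distinct
  eigenvalues the integral is the divided difference of \<open>f_alpha\<close>, as in the
  Daleckii-Krein formula.\<close>

lemma Lop_entry:
  fixes U :: "'n::finite cmat"
  assumes U: "unitary_mat U" and \<rho>: "\<rho> = U ** real_diag d ** conj_transpose U" and d: "\<And>i. d i > 0"
    and PD: "\<rho> \<in> PD"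
  shows "(conj_transpose U ** Lop \<rho> V ** U) $ i $ j =
    of_real (\<integral>u. 1 / ((1 - u + u * d i) * (1 - u + u * d j)) \<partial>M) * (conj_transpose U ** V ** U) $ i $ j"
proof -
  let ?r = "\<lambda>u i. 1 / (1 - u + u * d i)"
  let ?W = "conj_transpose U ** V ** U"
  have UU: "conj_transpose U ** U = mat 1"
    using U by (simp_all add: unitary_mat_def)
  have UUX: "X ** conj_transpose U ** U = X" for X
    by (simp add: matrix_mul_assoc [symmetric] UU)
  have T: "bounded_linear (\<lambda>X. (conj_transpose U ** X ** U) $ i $ j)"
    by (intro bounded_linear_compose [OF bounded_linear_vec_nth] mm.bounded_linear_right
        bounded_linear_compose [OF mm.bounded_linear_left])
  have "(conj_transpose U ** Lop \<rho> V ** U) $ i $ j = (\<integral>u. (conj_transpose U ** (res u \<rho> ** V ** res u \<rho>) ** U) $ i $ j \<partial>M)"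
    unfolding Lop_def by (rule integral_bounded_linear [OF T integrable_Lop [OF PD], symmetric])
  also have "\<dots> = (\<integral>u. of_real (?r u i * ?r u j) * ?W $ i $ j \<partial>M)"
  proof (rule Bochner_Integration.integral_cong)
    fix u assume "u \<in> space M"
    then have u: "u \<in> {0..1}" by (simp add: space_M)
    have "conj_transpose U ** (res u \<rho> ** V ** res u \<rho>) ** U = real_diag (?r u) ** ?W ** real_diag (?r u)"
      unfolding res_diag [OF U \<rho> d u] by (simp add: matrix_mul_assoc UU UUX)
    also have "\<dots> $ i $ j = of_real (?r u i * ?r u j) * ?W $ i $ j"
      by (simp add: real_diag_mult_nth)
    finally show "(conj_transpose U ** (res u \<rho> ** V ** res u \<rho>) ** U) $ i $ j = of_real (?r u i * ?r u j) * ?W $ i $ j" .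
  qed simp
  also have "\<dots> = (\<integral>u. complex_of_real (?r u i * ?r u j) \<partial>M) * ?W $ i $ j"
    by (rule integral_mult_left_zero)
  also have "(\<integral>u. complex_of_real (?r u i * ?r u j) \<partial>M) = of_real (\<integral>u. ?r u i * ?r u j \<partial>M)"
    by (rule integral_complex_of_real)
  finally show ?thesis by simp
qed

lemma Lop_coefficient_pos:
  assumes "a > 0" "b > 0"
  shows "(\<integral>u. 1 / ((1 - u + u * a) * (1 - u + u * b)) \<partial>M) > 0"
proof -
  \<comment> \<open>A lower bound for the integrand that is free of u: 1 - u + u a is at most 1 +
    a.\<close>
  let ?c = "1 / ((1 + a) * (1 + b))"
  have "0 < ?c * measure M (space M)" using assms mass_pos by simp
  also have "\<dots> = (\<integral>u. ?c \<partial>M)" by simp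
  also have "\<dots> \<le> (\<integral>u. 1 / ((1 - u + u * a) * (1 - u + u * b)) \<partial>M)"
  proof (rule integral_mono)
    show "integrable M (\<lambda>u. 1 / ((1 - u + u * a) * (1 - u + u * b)))"
      using denominator_pos [OF assms(1)] denominator_pos [OF assms(2)]
      by (intro integrable_continuous) (auto intro!: continuous_intros simp: less_imp_neq [THEN not_sym])
    fix u assume "u \<in> space M"
    then have u: "u \<in> {0..1}" by (simp add: space_M)
    note pos = denominator_pos [OF assms(1) u] denominator_pos [OF assms(2) u]
    have "u * a \<le> a" "u * b \<le> b" using u assms by (simp_all add: mult_left_le_one_le)
    then have "1 - u + u * a \<le> 1 + a" "1 - u + u * b \<le> 1 + b" using u by simp_all
    then have "(1 - u + u * a) * (1 - u + u * b) \<le> (1 + a) * (1 + b)"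
      using assms pos by (intro mult_mono) auto
    then show "?c \<le> 1 / ((1 - u + u * a) * (1 - u + u * b))"
      using pos assms by (intro divide_left_mono) auto
  qed simp
  finally show ?thesis .
qed

lemma inj_Lop:
  fixes \<rho> :: "'n::finite cmat"
  assumes \<rho>: "\<rho> \<in> PD"
  shows "inj (Lop \<rho>)"
proof (rule linear_injective_0 [OF linear_Lop [OF \<rho>], THEN iffD2], intro allI impI)
  fix V assume V: "Lop \<rho> V = 0"
  obtain U d where U: "unitary_mat U" and \<rho>d: "\<rho> = U ** real_diag d ** conj_transpose U" and d: "\<And>i. d i > 0"
    using PD_diagonalizable [OF \<rho>] by blast
  have UU: "U ** conj_transpose U = mat 1"
    using U by (simp_all add: unitary_mat_def)
  have "(conj_transpose U ** V ** U) $ i $ j = 0" for i j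
    using Lop_entry [OF U \<rho>d d \<rho>, of V i j] Lop_coefficient_pos [OF d d, of i j] V
    by (auto simp: mm.zero_left mm.zero_right)
  then have "conj_transpose U ** V ** U = 0" by (simp add: vec_eq_iff)
  then have "U ** (conj_transpose U ** V ** U) ** conj_transpose U = 0" by (simp add: mm.zero_left mm.zero_right)
  moreover have "U ** (conj_transpose U ** V ** U) ** conj_transpose U = (U ** conj_transpose U) ** V ** (U ** conj_transpose U)"
    by (simp only: matrix_mul_assoc)
  ultimately show "V = 0" by (simp add: UU)
qed

lemma Lop_inv:
  assumes \<rho>: "\<rho> \<in> PD"
  shows "Lop \<rho> (inv (Lop \<rho>) V) = V" "inv (Lop \<rho>) (Lop \<rho> V) = V"
  using surj_f_inv_f [OF linear_injective_imp_surjective [OF linear_Lop inj_Lop]] inv_f_f [OF inj_Lop] \<rho> by auto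

text \<open>L commutes with the conjugate transpose, hence so does its inverse. Thus inversion on
  all matrices gives the Hermitian solution that \<open>alpha_conn\<close> asks for.\<close>

lemma inv_Lop_Herm:
  assumes \<rho>: "\<rho> \<in> PD" and V: "V \<in> Herm"
  shows "inv (Lop \<rho>) V \<in> Herm"
  using V conj_transpose_Lop [OF \<rho>, of "inv (Lop \<rho>) V"] Lop_inv [OF \<rho>] injD [OF inj_Lop [OF \<rho>]]
  unfolding mem_Herm by metis

text \<open>In a fixed eigenbasis this is the scalar formula for each eigenvalue. Its right-hand
  side no longer mentions the eigenbasis and can be differentiated in \<rho>.\<close>

lemma herm_fun_eq_integral:
  fixes \<rho> :: "'n::finite cmat"
  assumes \<rho>: "\<rho> \<in> PD"
  shows "herm_fun (f_alpha \<alpha>) \<rho> = f_alpha \<alpha> 1 *\<^sub>R mat 1 + (\<integral>u. (\<rho> - mat 1) ** res u \<rho> \<partial>M)"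
proof -
  obtain U d where U: "unitary_mat U" and \<rho>d: "\<rho> = U ** real_diag d ** conj_transpose U" and d: "\<And>i. d i > 0"
    using PD_diagonalizable [OF \<rho>] by blast
  have UU: "conj_transpose U ** U = mat 1" "U ** conj_transpose U = mat 1"
    using U by (simp_all add: unitary_mat_def)
  have UUX: "X ** conj_transpose U ** U = X" for X
    by (simp add: matrix_mul_assoc [symmetric] UU)
  \<comment> \<open>Rank-one spectral projections; every function of \<rho> is a real combination of
    them.\<close>
  define E where "E i = U ** real_diag (\<lambda>j. if j = i then 1 else 0) ** conj_transpose U" for i
  have diag: "U ** real_diag g ** conj_transpose U = (\<Sum>i\<in>UNIV. g i *\<^sub>R E i)" for g
  proof -
    have "real_diag g = (\<Sum>i\<in>UNIV. g i *\<^sub>R (real_diag (\<lambda>j. if j = i then 1 else 0) :: 'n cmat))"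
      by (auto simp: vec_eq_iff real_diag_def scaleR_conv_of_real [where 'a = complex] if_distrib [of complex_of_real] if_distrib [of "\<lambda>x. _ * x"] cong: if_cong)
    then show ?thesis
      by (simp add: E_def mm.sum_left mm.sum_right mm.scaleR_left mm.scaleR_right)
  qed
  have one: "mat 1 = U ** real_diag (\<lambda>i. 1) ** conj_transpose U"
  proof -
    have "real_diag (\<lambda>i. 1) = (mat 1 :: 'n cmat)" by (simp add: vec_eq_iff real_diag_def mat_def)
    then show ?thesis by (simp add: UU)
  qed
  have int: "integrable M (\<lambda>u. (d i - 1) / (1 - u + u * d i))" for i
    using denominator_pos [OF d]
    by (intro integrable_continuous) (auto intro!: continuous_intros simp: less_imp_neq [THEN not_sym])
  have "(\<integral>u. (\<rho> - mat 1) ** res u \<rho> \<partial>M) = (\<integral>u. (\<Sum>i\<in>UNIV. ((d i - 1) / (1 - u + u * d i)) *\<^sub>R E i) \<partial>M)"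
  proof (rule Bochner_Integration.integral_cong)
    fix u assume "u \<in> space M"
    then have u: "u \<in> {0..1}" by (simp add: space_M)
    have "\<rho> - mat 1 = U ** real_diag (\<lambda>i. d i - 1) ** conj_transpose U"
      unfolding \<rho>d one diag by (simp add: sum_subtractf scaleR_diff_left)
    then have "(\<rho> - mat 1) ** res u \<rho> = U ** (real_diag (\<lambda>i. d i - 1) ** real_diag (\<lambda>i. 1 / (1 - u + u * d i))) ** conj_transpose U"
      unfolding res_diag [OF U \<rho>d d u] by (simp add: matrix_mul_assoc UUX)
    then show "(\<rho> - mat 1) ** res u \<rho> = (\<Sum>i\<in>UNIV. ((d i - 1) / (1 - u + u * d i)) *\<^sub>R E i)"
      unfolding real_diag_mult diag by simp
  qed simp
  also have "\<dots> = (\<Sum>i\<in>UNIV. (\<integral>u. (d i - 1) / (1 - u + u * d i) \<partial>M) *\<^sub>R E i)"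
    by (subst Bochner_Integration.integral_sum) (simp_all add: int)
  finally have "f_alpha \<alpha> 1 *\<^sub>R mat 1 + (\<integral>u. (\<rho> - mat 1) ** res u \<rho> \<partial>M)
      = (\<Sum>i\<in>UNIV. f_alpha \<alpha> (d i) *\<^sub>R E i)"
    by (simp add: f_eq_integral [OF d] one diag scaleR_sum_right scaleR_add_left sum.distrib)
  then show ?thesis
    unfolding herm_fun_eq [OF U \<rho>d] diag by simp
qed

lemma herm_fun_has_derivative:
  fixes \<rho> :: "'n::finite cmat"
  assumes \<rho>: "\<rho> \<in> PD"
  shows "(herm_fun (f_alpha \<alpha>) has_derivative Lop \<rho>) (at \<rho> within PD)"
proof -
  have "((\<lambda>\<sigma>. f_alpha \<alpha> 1 *\<^sub>R mat 1 + (\<integral>u. (\<sigma> - mat 1) ** res u \<sigma> \<partial>M)) has_derivative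
      (\<lambda>V. 0 + (\<integral>u. (\<rho> - mat 1) ** ((- u) *\<^sub>R (res u \<rho> ** V ** res u \<rho>)) + V ** res u \<rho> \<partial>M))) (at \<rho> within PD)"
    by (intro has_derivative_add has_derivative_const has_derivative_integral_PD [OF param_diff_mult
          [OF param_diff_id_minus [of "mat 1"] param_diff_res] \<rho>])
  also have "(\<lambda>V. 0 + (\<integral>u. (\<rho> - mat 1) ** ((- u) *\<^sub>R (res u \<rho> ** V ** res u \<rho>)) + V ** res u \<rho> \<partial>M)) = Lop \<rho>"
  proof
    fix V
    have "(\<rho> - mat 1) ** ((- u) *\<^sub>R (res u \<rho> ** V ** res u \<rho>)) + V ** res u \<rho> = res u \<rho> ** V ** res u \<rho>"
      if "u \<in> {0..1}" for u
    proof -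
      \<comment> \<open>The defining equation of R reads R + u (\<rho> - I) R = I. It collapses the
        two terms of the product rule into R V R.\<close>
      have "mat 1 - u *\<^sub>R ((\<rho> - mat 1) ** res u \<rho>) = ((1 - u) *\<^sub>R mat 1 + u *\<^sub>R \<rho>) ** res u \<rho> - u *\<^sub>R ((\<rho> - mat 1) ** res u \<rho>)"
        by (simp only: res_right [OF \<rho> that])
      also have "\<dots> = res u \<rho>"
        by (simp add: mm.add_left mm.diff_left mm.scaleR_left algebra_simps)
      finally have r: "mat 1 - u *\<^sub>R ((\<rho> - mat 1) ** res u \<rho>) = res u \<rho>" .
      have "A ** ((- u) *\<^sub>R (res u \<rho> ** V ** res u \<rho>)) + V ** res u \<rho>
          = (mat 1 - u *\<^sub>R (A ** res u \<rho>)) ** (V ** res u \<rho>)" for A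
        by (simp add: mm.diff_left mm.scaleR_left mm.scaleR_right mm.minus_right matrix_mul_assoc)
      then show ?thesis by (simp only: r matrix_mul_assoc)
    qed
    then have "(\<integral>u. (\<rho> - mat 1) ** ((- u) *\<^sub>R (res u \<rho> ** V ** res u \<rho>)) + V ** res u \<rho> \<partial>M) = Lop \<rho> V"
      unfolding Lop_def by (intro Bochner_Integration.integral_cong refl) (simp only: space_M)
    then show "0 + (\<integral>u. (\<rho> - mat 1) ** ((- u) *\<^sub>R (res u \<rho> ** V ** res u \<rho>)) + V ** res u \<rho> \<partial>M) = Lop \<rho> V"
      by simp
  qed
  finally show ?thesis
    by (rule has_derivative_transform [OF \<rho>, rotated]) (rule herm_fun_eq_integral)
qed

lemma L_alpha_eq: "\<rho> \<in> PD \<Longrightarrow> V \<in> Herm \<Longrightarrow> L_alpha \<alpha> \<rho> V = Lop \<rho> V"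
  unfolding L_alpha_def
  by (rule vector_derivative_at, rule has_vector_derivative_PD_line) (simp_all add: herm_fun_has_derivative)

end

section \<open>Flatness of the alpha-connections\<close>

text \<open>A derivative within \<^const>\<open>PD\<close> is determined on Hermitian directions only, so arguments are
  projected to \<^const>\<open>Herm\<close> before expanding in a basis of all matrices.\<close>

definition herm_part :: "'n::finite cmat \<Rightarrow> 'n cmat" where
  "herm_part A = (1/2) *\<^sub>R (A + conj_transpose A)"

lemma herm_part_Herm [simp]: "herm_part A \<in> Herm"
  by (simp add: herm_part_def mem_Herm add.commute)

lemma herm_part_id [simp]: "A \<in> Herm \<Longrightarrow> herm_part A = A"
  by (simp add: herm_part_def mem_Herm scaleR_2 [symmetric])

lemma linear_herm_part: "linear herm_part"
  by (rule linearI) (simp_all add: herm_part_def algebra_simps)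

lemma has_derivative_derivative_along_field:
  fixes F :: "'n::finite cmat \<Rightarrow> 'n cmat"
  assumes F: "\<And>\<sigma>. \<sigma> \<in> PD \<Longrightarrow> (F has_derivative F' \<sigma>) (at \<sigma> within PD)"
    and F2: "\<And>V. V \<in> Herm \<Longrightarrow> (\<lambda>\<sigma>. F' \<sigma> V) differentiable (at \<rho> within PD)"
    and \<rho>: "\<rho> \<in> PD"
    and Y: "(Y has_derivative Y') (at \<rho> within PD)" and YH: "\<And>\<sigma>. \<sigma> \<in> PD \<Longrightarrow> Y \<sigma> \<in> Herm"
    and D: "((\<lambda>\<sigma>. F' \<sigma> (Y \<rho>)) has_derivative D) (at \<rho> within PD)"
  shows "((\<lambda>\<sigma>. F' \<sigma> (Y \<sigma>)) has_derivative (\<lambda>h. D h + F' \<rho> (herm_part (Y' h)))) (at \<rho> within PD)"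
proof -
  have lin: "linear (F' \<sigma>)" if "\<sigma> \<in> PD" for \<sigma>
    using F [OF that] has_derivative_bounded_linear bounded_linear.linear by blast
  have "((\<lambda>\<sigma>. Y \<sigma> - Y \<rho>) has_derivative (\<lambda>h. Y' h - 0)) (at \<rho> within PD)"
    by (intro has_derivative_diff Y has_derivative_const)
  moreover have "linear (\<lambda>v. F' \<sigma> (herm_part v))" if "\<sigma> \<in> PD" for \<sigma>
    using linear_compose [OF linear_herm_part lin [OF that]] by (simp add: o_def)
  moreover have "(\<lambda>\<sigma>. F' \<sigma> (herm_part b)) differentiable (at \<rho> within PD)" for b
    by (rule F2) simp
  ultimately obtain T' where T': "\<And>h. linear (T' h)"
    and d: "((\<lambda>\<sigma>. F' \<sigma> (herm_part (Y \<sigma> - Y \<rho>))) has_derivative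
      (\<lambda>h. T' h (Y \<rho> - Y \<rho>) + F' \<rho> (herm_part (Y' h - 0)))) (at \<rho> within PD)"
    using differentiable_linear_family [OF \<rho>, of "\<lambda>\<sigma> v. F' \<sigma> (herm_part v)" "\<lambda>\<sigma>. Y \<sigma> - Y \<rho>" "\<lambda>h. Y' h - 0"]
    by blast
  have eq: "F' \<sigma> (Y \<sigma>) = F' \<sigma> (Y \<rho>) + F' \<sigma> (herm_part (Y \<sigma> - Y \<rho>))" if "\<sigma> \<in> PD" for \<sigma>
    using YH [OF that] YH [OF \<rho>] by (simp add: linear_diff [OF lin [OF that]])
  have "((\<lambda>\<sigma>. F' \<sigma> (Y \<rho>) + F' \<sigma> (herm_part (Y \<sigma> - Y \<rho>))) has_derivative (\<lambda>h. D h + F' \<rho> (herm_part (Y' h)))) (at \<rho> within PD)"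
    using has_derivative_add [OF D d] by (simp add: linear_0 [OF T'])
  then show ?thesis
    by (rule has_derivative_transform [OF \<rho>, rotated]) (rule eq)
qed

text \<open>This is XYF - YXF = [X,Y]F: the second derivatives of F cancel by symmetry, and the
  derivatives of the fields leave the bracket.\<close>

lemma dir_deriv_commutator:
  fixes F :: "'n::finite cmat \<Rightarrow> 'n cmat"
  assumes F: "\<And>\<sigma>. \<sigma> \<in> PD \<Longrightarrow> (F has_derivative F' \<sigma>) (at \<sigma> within PD)"
    and F2: "\<And>V. V \<in> Herm \<Longrightarrow> (\<lambda>\<sigma>. F' \<sigma> V) differentiable (at \<rho> within PD)"
    and \<rho>: "\<rho> \<in> PD"
    and X: "(X has_derivative X') (at \<rho> within PD)" and XH: "\<And>\<sigma>. \<sigma> \<in> PD \<Longrightarrow> X \<sigma> \<in> Herm"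
    and Y: "(Y has_derivative Y') (at \<rho> within PD)" and YH: "\<And>\<sigma>. \<sigma> \<in> PD \<Longrightarrow> Y \<sigma> \<in> Herm"
  shows "dir_deriv X (\<lambda>\<sigma>. F' \<sigma> (Y \<sigma>)) \<rho> - dir_deriv Y (\<lambda>\<sigma>. F' \<sigma> (X \<sigma>)) \<rho> = F' \<rho> (lie_bracket X Y \<rho>)"
proof -
  have lin: "linear (F' \<rho>)"
    using F [OF \<rho>] has_derivative_bounded_linear bounded_linear.linear by blast
  obtain DX where DX: "((\<lambda>\<sigma>. F' \<sigma> (X \<rho>)) has_derivative DX) (at \<rho> within PD)"
    using F2 [OF XH [OF \<rho>]] unfolding differentiable_def by blast
  obtain DY where DY: "((\<lambda>\<sigma>. F' \<sigma> (Y \<rho>)) has_derivative DY) (at \<rho> within PD)"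
    using F2 [OF YH [OF \<rho>]] unfolding differentiable_def by blast
  have sym: "DX (Y \<rho>) = DY (X \<rho>)"
    by (rule second_derivative_symmetric_PD [OF F \<rho> XH [OF \<rho>] YH [OF \<rho>] DX DY])
  have "dir_deriv X (\<lambda>\<sigma>. F' \<sigma> (Y \<sigma>)) \<rho> = DY (X \<rho>) + F' \<rho> (herm_part (Y' (X \<rho>)))"
    by (rule dir_deriv_eq [where X = X, OF has_derivative_derivative_along_field [OF F F2 \<rho> Y YH DY] \<rho> XH [OF \<rho>]])
  moreover have "dir_deriv Y (\<lambda>\<sigma>. F' \<sigma> (X \<sigma>)) \<rho> = DX (Y \<rho>) + F' \<rho> (herm_part (X' (Y \<rho>)))"
    by (rule dir_deriv_eq [where X = Y, OF has_derivative_derivative_along_field [OF F F2 \<rho> X XH DX] \<rho> YH [OF \<rho>]])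
  moreover have "Y' (X \<rho>) \<in> Herm" "X' (Y \<rho>) \<in> Herm"
    using has_derivative_Herm [OF Y \<rho> XH [OF \<rho>] YH] has_derivative_Herm [OF X \<rho> YH [OF \<rho>] XH] by blast+
  moreover have "lie_bracket X Y \<rho> = Y' (X \<rho>) - X' (Y \<rho>)"
    unfolding lie_bracket_def
    by (simp add: dir_deriv_eq [where X = X, OF Y \<rho> XH [OF \<rho>]] dir_deriv_eq [where X = Y, OF X \<rho> YH [OF \<rho>]])
  ultimately show ?thesis by (simp add: sym linear_diff [OF lin])
qed

section \<open>Smooth and constant vector fields\<close>

lemma smooth_vfieldE:
  assumes "smooth_vfield (Z :: 'n::finite vfield)"
  obtains Z' where "\<And>\<sigma>. \<sigma> \<in> PD \<Longrightarrow> Z \<sigma> \<in> Herm"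
    "\<And>\<sigma>. \<sigma> \<in> PD \<Longrightarrow> (Z has_derivative Z' \<sigma>) (at \<sigma> within PD)"
    "\<And>V \<sigma>. V \<in> Herm \<Longrightarrow> \<sigma> \<in> PD \<Longrightarrow> (\<lambda>\<sigma>. Z' \<sigma> V) differentiable (at \<sigma> within PD)"
proof -
  \<comment> \<open>Curvature differentiates the third field twice.\<close>
  have "C_k_on_PD (Suc (Suc 0)) Z" using assms by (simp only: smooth_vfield_def)
  then obtain Z' where Z': "\<forall>\<rho>\<in>PD. (Z has_derivative Z' \<rho>) (at \<rho> within PD)"
    "\<forall>V\<in>Herm. C_k_on_PD (Suc 0) (\<lambda>\<rho>. Z' \<rho> V)"
    by (subst (asm) C_k_on_PD.simps(2)) blast
  have "(\<lambda>\<sigma>. Z' \<sigma> V) differentiable (at \<sigma> within PD)" if "V \<in> Herm" "\<sigma> \<in> PD" for V \<sigma>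
    using Z'(2) that unfolding C_k_on_PD.simps(2) differentiable_def by blast
  moreover have "\<And>\<sigma>. \<sigma> \<in> PD \<Longrightarrow> Z \<sigma> \<in> Herm" using assms by (simp add: smooth_vfield_def)
  ultimately show ?thesis using that Z'(1) by blast
qed

lemma smooth_vfield_const: "V \<in> Herm \<Longrightarrow> smooth_vfield (\<lambda>_. V)"
proof -
  have "C_k_on_PD k (\<lambda>_. V)" for k and V :: "'a::finite cmat"
  proof (induction k arbitrary: V)
    case (Suc k)
    show ?case unfolding C_k_on_PD.simps(2)
      by (rule exI [of _ "\<lambda>_ _. 0"]) (simp add: Suc)
  qed simp
  then show "V \<in> Herm \<Longrightarrow> ?thesis" by (simp add: smooth_vfield_def)
qed

lemma lie_bracket_const: "lie_bracket (\<lambda>_. V) (\<lambda>_. W) \<rho> = 0"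
  by (simp add: lie_bracket_def dir_deriv_def)

context alpha_kernel
begin

text \<open>The Christoffel symbols of the connection in the affine coordinates of \<^const>\<open>Herm\<close>.\<close>

definition Gam :: "'n::finite cmat \<Rightarrow> 'n cmat \<Rightarrow> 'n cmat \<Rightarrow> 'n cmat" where
  "Gam \<rho> V W = inv (Lop \<rho>) (Lam \<rho> V W)"

lemma linear_inv_Lop:
  assumes "\<rho> \<in> PD" shows "linear (inv (Lop \<rho>))"
proof (rule linearI)
  fix V W :: "'a cmat" and c :: real
  show "inv (Lop \<rho>) (V + W) = inv (Lop \<rho>) V + inv (Lop \<rho>) W"
    by (rule injD [OF inj_Lop [OF assms]]) (simp add: linear_add [OF linear_Lop [OF assms]] Lop_inv [OF assms])
  show "inv (Lop \<rho>) (c *\<^sub>R V) = c *\<^sub>R inv (Lop \<rho>) V"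
    by (rule injD [OF inj_Lop [OF assms]]) (simp add: linear_cmul [OF linear_Lop [OF assms]] Lop_inv [OF assms])
qed

section \<open>The alpha-connection in affine coordinates and its flatness\<close>

lemma Lop_field_has_derivative:
  assumes \<rho>: "\<rho> \<in> PD" and Y: "(Y has_derivative Y') (at \<rho> within PD)"
  shows "((\<lambda>\<sigma>. Lop \<sigma> (Y \<sigma>)) has_derivative (\<lambda>V. Lam \<rho> V (Y \<rho>) + Lop \<rho> (Y' V))) (at \<rho> within PD)"
  by (rule has_derivative_linear_family [OF \<rho> linear_Lop linear_Lam_right Lop_has_derivative Y])
     (use \<rho> in auto)

text \<open>Stated for any Hermitian-valued Y with a Hermitian directional derivative, so that Y may
  itself be a covariant derivative.\<close>

lemma alpha_conn_eq_inv:
  assumes \<rho>: "\<rho> \<in> PD" and X: "X \<rho> \<in> Herm" and Y: "\<And>\<sigma>. \<sigma> \<in> PD \<Longrightarrow> Y \<sigma> \<in> Herm"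
    and D: "dir_deriv X (\<lambda>\<sigma>. Lop \<sigma> (Y \<sigma>)) \<rho> \<in> Herm"
  shows "alpha_conn \<alpha> X Y \<rho> = inv (Lop \<rho>) (dir_deriv X (\<lambda>\<sigma>. Lop \<sigma> (Y \<sigma>)) \<rho>)"
proof -
  let ?D = "dir_deriv X (\<lambda>\<sigma>. Lop \<sigma> (Y \<sigma>)) \<rho>"
  have "dir_deriv X (\<lambda>\<sigma>. L_alpha \<alpha> \<sigma> (Y \<sigma>)) \<rho> = ?D"
    by (rule dir_deriv_cong [where X = X, OF _ \<rho> X]) (simp add: L_alpha_eq Y)
  then have "alpha_conn \<alpha> X Y \<rho> = (THE W. W \<in> Herm \<and> L_alpha \<alpha> \<rho> W = ?D)"
    by (simp add: alpha_conn_def)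
  also have "\<dots> = inv (Lop \<rho>) ?D"
  proof (rule the_equality)
    show "inv (Lop \<rho>) ?D \<in> Herm \<and> L_alpha \<alpha> \<rho> (inv (Lop \<rho>) ?D) = ?D"
      by (simp add: L_alpha_eq inv_Lop_Herm \<rho> D Lop_inv)
    show "W = inv (Lop \<rho>) ?D" if "W \<in> Herm \<and> L_alpha \<alpha> \<rho> W = ?D" for W
    proof -
      have "Lop \<rho> W = ?D" using that L_alpha_eq [OF \<rho>, of W] by simp
      then show ?thesis using Lop_inv(2) [OF \<rho>, of W] by simp
    qed
  qed
  finally show ?thesis .
qed

lemma Lam_Herm: "\<rho> \<in> PD \<Longrightarrow> V \<in> Herm \<Longrightarrow> W \<in> Herm \<Longrightarrow> Lam \<rho> V W \<in> Herm"
  by (rule has_derivative_Herm [OF Lop_has_derivative]) (simp_all add: Lop_Herm)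

lemma alpha_conn_formula:
  assumes \<rho>: "\<rho> \<in> PD" and X: "X \<rho> \<in> Herm" and YH: "\<And>\<sigma>. \<sigma> \<in> PD \<Longrightarrow> Y \<sigma> \<in> Herm"
    and Y: "(Y has_derivative Y') (at \<rho> within PD)"
  shows "alpha_conn \<alpha> X Y \<rho> = Y' (X \<rho>) + Gam \<rho> (X \<rho>) (Y \<rho>)"
proof -
  note d = Lop_field_has_derivative [OF \<rho> Y]
  have D: "dir_deriv X (\<lambda>\<sigma>. Lop \<sigma> (Y \<sigma>)) \<rho> = Lam \<rho> (X \<rho>) (Y \<rho>) + Lop \<rho> (Y' (X \<rho>))"
    by (rule dir_deriv_eq [where X = X, OF d \<rho> X])
  also have "\<dots> \<in> Herm" by (rule has_derivative_Herm [OF d \<rho> X]) (simp add: Lop_Herm YH)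
  finally have DH: "dir_deriv X (\<lambda>\<sigma>. Lop \<sigma> (Y \<sigma>)) \<rho> \<in> Herm" .
  show ?thesis
    using alpha_conn_eq_inv [where X = X and Y = Y, OF \<rho> X YH DH] unfolding D
    by (simp add: linear_add [OF linear_inv_Lop [OF \<rho>]] Lop_inv [OF \<rho>] Gam_def)
qed

text \<open>Torsion vanishes because the Christoffel symbols inherit the symmetry of the second
  derivative \<open>Lam\<close>. For curvature, every covariant derivative is written as the inverse
  of L applied to an ordinary derivative of L(Z).\<close>

theorem flat_alpha_conn: "flat_conn (alpha_conn \<alpha> :: 'n::finite conn)"
  unfolding flat_conn_def
proof (intro conjI allI impI ballI)
  fix X Y :: "'n vfield" and \<rho> :: "'n cmat"
  assume "smooth_vfield X \<and> smooth_vfield Y" and \<rho>: "\<rho> \<in> PD"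
  then obtain X' Y' where X: "\<And>\<sigma>. \<sigma> \<in> PD \<Longrightarrow> X \<sigma> \<in> Herm" "(X has_derivative X') (at \<rho> within PD)"
    and Y: "\<And>\<sigma>. \<sigma> \<in> PD \<Longrightarrow> Y \<sigma> \<in> Herm" "(Y has_derivative Y') (at \<rho> within PD)"
    using smooth_vfieldE by metis
  show "conn_torsion (alpha_conn \<alpha>) X Y \<rho> = 0"
    unfolding conn_torsion_def lie_bracket_def
    by (simp add: alpha_conn_formula [where X = X and Y = Y, OF \<rho> X(1) [OF \<rho>] Y] alpha_conn_formula [where X = Y and Y = X, OF \<rho> Y(1) [OF \<rho>] X]
        dir_deriv_eq [where X = Y, OF X(2) \<rho> Y(1) [OF \<rho>]] dir_deriv_eq [where X = X, OF Y(2) \<rho> X(1) [OF \<rho>]]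
        Gam_def Lam_commute [of \<rho> "Y \<rho>"])
next
  fix X Y Z :: "'n vfield" and \<rho> :: "'n cmat"
  assume smooth: "smooth_vfield X \<and> smooth_vfield Y \<and> smooth_vfield Z" and \<rho>: "\<rho> \<in> PD"
  obtain X' where X: "\<And>\<sigma>. \<sigma> \<in> PD \<Longrightarrow> X \<sigma> \<in> Herm"
    "\<And>\<sigma>. \<sigma> \<in> PD \<Longrightarrow> (X has_derivative X' \<sigma>) (at \<sigma> within PD)"
    using smooth smooth_vfieldE by metis
  obtain Y' where Y: "\<And>\<sigma>. \<sigma> \<in> PD \<Longrightarrow> Y \<sigma> \<in> Herm"
    "\<And>\<sigma>. \<sigma> \<in> PD \<Longrightarrow> (Y has_derivative Y' \<sigma>) (at \<sigma> within PD)"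
    using smooth smooth_vfieldE by metis
  obtain Z' where Z: "\<And>\<sigma>. \<sigma> \<in> PD \<Longrightarrow> Z \<sigma> \<in> Herm"
    "\<And>\<sigma>. \<sigma> \<in> PD \<Longrightarrow> (Z has_derivative Z' \<sigma>) (at \<sigma> within PD)"
    "\<And>V \<sigma>. V \<in> Herm \<Longrightarrow> \<sigma> \<in> PD \<Longrightarrow> (\<lambda>\<sigma>. Z' \<sigma> V) differentiable (at \<sigma> within PD)"
    using smooth smooth_vfieldE by metis
  \<comment> \<open>F is the image of Z under L; differentiating Z covariantly means differentiating
    F in the ordinary sense.\<close>
  define F where "F \<sigma> = Lop \<sigma> (Z \<sigma>)" for \<sigma>
  define F' where "F' \<sigma> V = Lam \<sigma> V (Z \<sigma>) + Lop \<sigma> (Z' \<sigma> V)" for \<sigma> V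
  have F: "(F has_derivative F' \<sigma>) (at \<sigma> within PD)" if "\<sigma> \<in> PD" for \<sigma>
    unfolding F_def [abs_def] F'_def [abs_def] by (rule Lop_field_has_derivative [OF that Z(2) [OF that]])
  have F2: "(\<lambda>\<sigma>. F' \<sigma> V) differentiable (at \<tau> within PD)" if V: "V \<in> Herm" and \<tau>: "\<tau> \<in> PD" for V \<tau>
  proof -
    obtain D where D: "((\<lambda>\<sigma>. Z' \<sigma> V) has_derivative D) (at \<tau> within PD)"
      using Z(3) [OF V \<tau>] unfolding differentiable_def by blast
    have 1: "(\<lambda>\<sigma>. Lam \<sigma> V (Z \<sigma>)) differentiable (at \<tau> within PD)"
      by (rule differentiable_linear_family [OF \<tau> linear_Lam_right Lam_differentiable [OF \<tau>] Z(2) [OF \<tau>]])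
        (auto simp: differentiable_def)
    have 2: "(\<lambda>\<sigma>. Lop \<sigma> (Z' \<sigma> V)) differentiable (at \<tau> within PD)"
      using Lop_field_has_derivative [OF \<tau> D] unfolding differentiable_def by blast
    show ?thesis unfolding F'_def by (rule differentiable_add [OF 1 2])
  qed
  have F'H: "F' \<sigma> V \<in> Herm" if "\<sigma> \<in> PD" "V \<in> Herm" for \<sigma> V
    by (rule has_derivative_Herm [OF F [OF that(1)] that]) (simp add: F_def Lop_Herm Z)
  have conn1: "alpha_conn \<alpha> A Z \<sigma> = inv (Lop \<sigma>) (F' \<sigma> (A \<sigma>))" if "\<sigma> \<in> PD" "A \<sigma> \<in> Herm" for A \<sigma>
  proof -
    have "dir_deriv A (\<lambda>\<sigma>. Lop \<sigma> (Z \<sigma>)) \<sigma> = F' \<sigma> (A \<sigma>)"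
      using dir_deriv_eq [where X = A, OF F [OF that(1)] that] by (simp add: F_def [abs_def])
    then show ?thesis using alpha_conn_eq_inv [of \<sigma> A Z] that F'H Z by simp
  qed
  have conn2: "alpha_conn \<alpha> A (alpha_conn \<alpha> B Z) \<rho> = inv (Lop \<rho>) (dir_deriv A (\<lambda>\<sigma>. F' \<sigma> (B \<sigma>)) \<rho>)"
    if A: "\<And>\<sigma>. \<sigma> \<in> PD \<Longrightarrow> A \<sigma> \<in> Herm" and B: "\<And>\<sigma>. \<sigma> \<in> PD \<Longrightarrow> B \<sigma> \<in> Herm"
      "(B has_derivative B') (at \<rho> within PD)" for A B B'
  proof -
    obtain D where D: "((\<lambda>\<sigma>. F' \<sigma> (B \<rho>)) has_derivative D) (at \<rho> within PD)"
      using F2 [OF B(1) [OF \<rho>] \<rho>] unfolding differentiable_def by blast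
    have d: "((\<lambda>\<sigma>. F' \<sigma> (B \<sigma>)) has_derivative (\<lambda>h. D h + F' \<rho> (herm_part (B' h)))) (at \<rho> within PD)"
      by (rule has_derivative_derivative_along_field [OF F F2 [OF _ \<rho>] \<rho> B(2,1) D])
    have DH: "dir_deriv A (\<lambda>\<sigma>. F' \<sigma> (B \<sigma>)) \<rho> \<in> Herm"
      unfolding dir_deriv_eq [where X = A, OF d \<rho> A [OF \<rho>]]
      by (rule has_derivative_Herm [OF d \<rho> A [OF \<rho>]]) (simp add: F'H B)
    \<comment> \<open>L cancels the inverse carried by the inner covariant derivative, so no inverse
      has to be differentiated.\<close>
    have "dir_deriv A (\<lambda>\<sigma>. Lop \<sigma> (alpha_conn \<alpha> B Z \<sigma>)) \<rho> = dir_deriv A (\<lambda>\<sigma>. F' \<sigma> (B \<sigma>)) \<rho>"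
      by (rule dir_deriv_cong [where X = A, OF _ \<rho> A [OF \<rho>]]) (simp add: conn1 B Lop_inv)
    then show ?thesis
      using alpha_conn_eq_inv [of \<rho> A "alpha_conn \<alpha> B Z"] \<rho> A DH by (simp add: conn1 B inv_Lop_Herm F'H)
  qed
  have lieH: "lie_bracket X Y \<rho> \<in> Herm"
    using has_derivative_Herm [OF Y(2) [OF \<rho>] \<rho> X(1) [OF \<rho>] Y(1)]
      has_derivative_Herm [OF X(2) [OF \<rho>] \<rho> Y(1) [OF \<rho>] X(1)]
    unfolding lie_bracket_def dir_deriv_eq [where X = Y, OF X(2) [OF \<rho>] \<rho> Y(1) [OF \<rho>]] dir_deriv_eq [where X = X, OF Y(2) [OF \<rho>] \<rho> X(1) [OF \<rho>]]
    by simp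
  have comm: "dir_deriv X (\<lambda>\<sigma>. F' \<sigma> (Y \<sigma>)) \<rho> - dir_deriv Y (\<lambda>\<sigma>. F' \<sigma> (X \<sigma>)) \<rho> = F' \<rho> (lie_bracket X Y \<rho>)"
    by (rule dir_deriv_commutator [OF F F2 [OF _ \<rho>] \<rho> X(2) [OF \<rho>] X(1) Y(2) [OF \<rho>] Y(1)])
  have conn_XY: "alpha_conn \<alpha> X (alpha_conn \<alpha> Y Z) \<rho> = inv (Lop \<rho>) (dir_deriv X (\<lambda>\<sigma>. F' \<sigma> (Y \<sigma>)) \<rho>)"
    by (rule conn2 [OF _ _ Y(2) [OF \<rho>]]) (fact X(1), fact Y(1))
  have conn_YX: "alpha_conn \<alpha> Y (alpha_conn \<alpha> X Z) \<rho> = inv (Lop \<rho>) (dir_deriv Y (\<lambda>\<sigma>. F' \<sigma> (X \<sigma>)) \<rho>)"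
    by (rule conn2 [OF _ _ X(2) [OF \<rho>]]) (fact Y(1), fact X(1))
  have conn_lie: "alpha_conn \<alpha> (lie_bracket X Y) Z \<rho> = inv (Lop \<rho>) (F' \<rho> (lie_bracket X Y \<rho>))"
    by (rule conn1) (fact \<rho>, fact lieH)
  show "conn_curvature (alpha_conn \<alpha>) X Y Z \<rho> = 0"
    unfolding conn_curvature_def conn_lie conn_XY conn_YX
    by (simp flip: linear_diff [OF linear_inv_Lop [OF \<rho>]] add: comm)
qed

section \<open>Properties of the Christoffel symbols\<close>

lemma Gam_Herm: "\<rho> \<in> PD \<Longrightarrow> V \<in> Herm \<Longrightarrow> W \<in> Herm \<Longrightarrow> Gam \<rho> V W \<in> Herm"
  by (simp add: Gam_def inv_Lop_Herm Lam_Herm)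

lemma linear_Gam_right: "\<rho> \<in> PD \<Longrightarrow> linear (Gam \<rho> V)"
  using linear_compose [OF linear_Lam_right linear_inv_Lop] by (simp add: Gam_def [abs_def] o_def)

lemma Gam_zero: "\<rho> \<in> PD \<Longrightarrow> Gam \<rho> 0 W = 0"
  by (simp add: Gam_def linear_0 [OF linear_Lam_left] linear_0 [OF linear_inv_Lop])

text \<open>The symbols solve a linear equation whose operator and right-hand side are
  differentiable in \<sigma>.\<close>

lemma Gam_differentiable:
  assumes \<rho>: "\<rho> \<in> PD"
  shows "(\<lambda>\<sigma>. Gam \<sigma> V W) differentiable (at \<rho> within PD)"
proof -
  obtain D where D: "((\<lambda>\<sigma>. Lam \<sigma> V W) has_derivative D) (at \<rho> within PD)"
    using Lam_differentiable [OF \<rho>] unfolding differentiable_def by blast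
  show ?thesis
    by (rule differentiable_linear_family_inverse [OF \<rho> linear_Lop linear_Lam_right [OF \<rho>]
          Lop_has_derivative [OF \<rho>] inj_Lop [OF \<rho>] D])
       (simp_all add: Gam_def Lop_inv)
qed

lemma alpha_conn_const:
  assumes "\<rho> \<in> PD" "V \<in> Herm" "W \<in> Herm"
  shows "alpha_conn \<alpha> (\<lambda>_. V) (\<lambda>_. W) \<rho> = Gam \<rho> V W"
  using alpha_conn_formula [OF assms(1), of "\<lambda>_. V" "\<lambda>_. W" "\<lambda>_. 0"] assms by simp

text \<open>Vanishing curvature on constant fields: their bracket is 0, so only the derivative of
  the symbols and their commutator remain. D1 and D2 are arbitrary, since on Hermitian directions
  the value does not depend on the choice.\<close>

lemma Gam_structure_equation:
  assumes \<rho>: "\<rho> \<in> PD" and H: "V \<in> Herm" "W \<in> Herm" "Z \<in> Herm"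
    and D1: "((\<lambda>\<sigma>. Gam \<sigma> W Z) has_derivative D1) (at \<rho> within PD)"
    and D2: "((\<lambda>\<sigma>. Gam \<sigma> V Z) has_derivative D2) (at \<rho> within PD)"
  shows "(D1 V - D2 W) + (Gam \<rho> V (Gam \<rho> W Z) - Gam \<rho> W (Gam \<rho> V Z)) = 0"
proof -
  have conn2: "alpha_conn \<alpha> (\<lambda>_. A) (alpha_conn \<alpha> (\<lambda>_. B) (\<lambda>_. Z)) \<rho> = D A + Gam \<rho> A (Gam \<rho> B Z)"
    if "A \<in> Herm" "B \<in> Herm" and D: "((\<lambda>\<sigma>. Gam \<sigma> B Z) has_derivative D) (at \<rho> within PD)" for A B D
  proof -
    have "(alpha_conn \<alpha> (\<lambda>_. B) (\<lambda>_. Z) has_derivative D) (at \<rho> within PD)"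
      by (rule has_derivative_transform [OF \<rho> _ D]) (simp add: alpha_conn_const that H)
    from alpha_conn_formula [OF \<rho> _ _ this, of "\<lambda>_. A"] show ?thesis
      by (simp add: alpha_conn_const that H \<rho> Gam_Herm)
  qed
  have "alpha_conn \<alpha> (lie_bracket (\<lambda>_. V) (\<lambda>_. W)) (\<lambda>_. Z) \<rho> = 0"
    using alpha_conn_formula [OF \<rho>, of "lie_bracket (\<lambda>_. V) (\<lambda>_. W)" "\<lambda>_. Z" "\<lambda>_. 0"] H
    by (simp add: lie_bracket_const Gam_zero \<rho>)
  moreover have "conn_curvature (alpha_conn \<alpha>) (\<lambda>_. V) (\<lambda>_. W) (\<lambda>_. Z) \<rho> = 0"
    using flat_alpha_conn smooth_vfield_const H \<rho> unfolding flat_conn_def by blast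
  ultimately show ?thesis
    unfolding conn_curvature_def conn2 [OF H(1,2) D1] conn2 [OF H(2,1) D2] by (simp add: algebra_simps)
qed

lemma Gam_mat_1:
  "Gam (mat 1) V W = - ((\<integral>u. u \<partial>M) / measure M (space M)) *\<^sub>R (V ** W + W ** V)"
proof -
  have Lop1: "Lop (mat 1) V = measure M (space M) *\<^sub>R V" for V :: "'n::finite cmat"
    by (simp add: Lop_def res_mat_1)
  have "integrable M (\<lambda>u. u)" by (intro integrable_continuous continuous_intros)
  then have "Lam (mat 1) V W = - (\<integral>u. u \<partial>M) *\<^sub>R (V ** W + W ** V)"
    by (simp add: Lam_def res_mat_1)
  also have "\<dots> = Lop (mat 1) (- ((\<integral>u. u \<partial>M) / measure M (space M)) *\<^sub>R (V ** W + W ** V))"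
    using mass_pos by (simp add: Lop1)
  finally show ?thesis by (simp add: Gam_def Lop_inv [OF mat_1_PD])
qed

end

section \<open>Multiples of the Christoffel symbols\<close>

definition matrix_unit :: "'n::finite \<Rightarrow> 'n \<Rightarrow> 'n cmat" where
  "matrix_unit a b = (\<chi> i j. if i = a \<and> j = b then 1 else 0)"

lemma matrix_unit_mult: "matrix_unit a b ** matrix_unit c d = (if b = c then matrix_unit a d else 0)"
  by (auto simp: vec_eq_iff matrix_matrix_mult_def matrix_unit_def if_distrib [of "\<lambda>x. _ * x"]
      if_distrib [of "\<lambda>x. x * _"] cong: if_cong intro!: sum.neutral)

lemma conj_transpose_matrix_unit [simp]: "conj_transpose (matrix_unit a b) = matrix_unit b a"
  by (auto simp: vec_eq_iff matrix_unit_def)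

lemma iterated_commutator_nonzero:
  assumes "CARD('n::finite) \<ge> 2"
  obtains V W :: "'n::finite cmat" where "V \<in> Herm" "W \<in> Herm"
    "(V ** W - W ** V) ** V - V ** (V ** W - W ** V) \<noteq> 0"
proof -
  obtain a b :: 'n where ab: "a \<noteq> b"
    using assms card_le_Suc0_iff_eq [of "UNIV :: 'n set"] by auto
  \<comment> \<open>In the plane of two indices, V swaps and W projects: [V,W] is E_ba - E_ab, and a
    further bracket with V gives twice E_bb - E_aa.\<close>
  let ?V = "matrix_unit a b + matrix_unit b a" and ?W = "matrix_unit a a"
  have "(?V ** ?W - ?W ** ?V) ** ?V - ?V ** (?V ** ?W - ?W ** ?V)
      = 2 *\<^sub>R matrix_unit b b - 2 *\<^sub>R matrix_unit a a"
    using ab by (simp add: mm.add_left mm.add_right mm.diff_left mm.diff_right matrix_unit_mult scaleR_2)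
  also have "\<dots> \<noteq> 0"
  proof
    assume "2 *\<^sub>R matrix_unit b b - 2 *\<^sub>R matrix_unit a a = (0 :: 'n cmat)"
    then have "(2 *\<^sub>R matrix_unit b b - 2 *\<^sub>R matrix_unit a a :: 'n cmat) $ b $ b = 0 $ b $ b" by simp
    then show False using ab by (simp add: matrix_unit_def)
  qed
  finally show ?thesis by (intro that [of ?V ?W]) (simp_all add: mem_Herm add.commute)
qed

context alpha_kernel
begin

text \<open>A vanishing first moment concentrates M at 0, which forces \<open>f_alpha\<close> to
  have a constant derivative. The logarithm therefore has a nonzero moment.\<close>

lemma integral_u_eq_0:
  assumes "(\<integral>u. u \<partial>M) = 0"
  shows "(\<integral>u. 1 / (1 - u + u * x)\<^sup>2 \<partial>M) = measure M (space M)"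
proof -
  have "integrable M (\<lambda>u. u)" by (intro integrable_continuous continuous_intros)
  then have "AE u in M. u = 0"
    using assms integral_nonneg_eq_0_iff_AE [of M "\<lambda>u. u"] AE_I2 [of M "\<lambda>u. 0 \<le> u"] by (simp add: space_M)
  then have "(\<integral>u. 1 / (1 - u + u * x)\<^sup>2 \<partial>M) = (\<integral>u. 1 \<partial>M)"
    by (intro integral_cong_AE) (auto simp: measurable_cong_sets [OF sets_M refl] intro!: measurable_restrict_space1)
  then show ?thesis by simp
qed

text \<open>Concentration of M at 0 kills the factor u in the second derivative; this is the case of
  the mixture connection.\<close>

lemma Gam_eq_0:
  assumes "(\<integral>u. u \<partial>M) = 0" "\<rho> \<in> PD"
  shows "Gam \<rho> V W = 0"
proof -
  have "integrable M (\<lambda>u. u)" by (intro integrable_continuous continuous_intros)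
  then have "AE u in M. u = 0"
    using assms integral_nonneg_eq_0_iff_AE [of M "\<lambda>u. u"] AE_I2 [of M "\<lambda>u. 0 \<le> u"] by (simp add: space_M)
  then have "Lam \<rho> V W = 0"
    unfolding Lam_def by (intro integral_eq_zero_AE) auto
  then show ?thesis by (simp add: Gam_def linear_0 [OF linear_inv_Lop] assms)
qed

text \<open>For anticommutators, {V,{W,Z}} - {W,{V,Z}} = [[V,W],Z]; the choice Z = V reduces this to
  the iterated commutator.\<close>

lemma Gam_commutator_nonzero:
  assumes n: "CARD('n::finite) \<ge> 2" and k: "(\<integral>u. u \<partial>M) \<noteq> 0"
  obtains V W Z :: "'n::finite cmat" where "V \<in> Herm" "W \<in> Herm" "Z \<in> Herm"
    "Gam (mat 1) V (Gam (mat 1) W Z) - Gam (mat 1) W (Gam (mat 1) V Z) \<noteq> 0"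
proof -
  obtain V W :: "'n cmat" where VW: "V \<in> Herm" "W \<in> Herm"
    and nz: "(V ** W - W ** V) ** V - V ** (V ** W - W ** V) \<noteq> 0"
    using iterated_commutator_nonzero [OF n] by blast
  define c where "c = - ((\<integral>u. u \<partial>M) / measure M (space M))"
  have c: "c \<noteq> 0" using k mass_pos by (simp add: c_def)
  have "Gam (mat 1) V (Gam (mat 1) W Z) - Gam (mat 1) W (Gam (mat 1) V Z)
      = (c * c) *\<^sub>R ((V ** W - W ** V) ** Z - Z ** (V ** W - W ** V))" for Z
    unfolding Gam_mat_1 c_def [symmetric]
    by (simp add: mm.add_left mm.add_right mm.diff_left mm.diff_right mm.scaleR_left mm.scaleR_right
        matrix_mul_assoc scaleR_diff_right scaleR_add_right)
  then show ?thesis using c nz VW by (intro that [of V W V]) auto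
qed

text \<open>With \<open>P\<close> the antisymmetrized derivative of \<^const>\<open>Gam\<close> and \<open>Q\<close> its commutator, flatness reads
  \<open>P + Q = 0\<close>, whereas a connection with coefficients \<open>q\<close> times \<^const>\<open>Gam\<close> has curvature \<open>q P + q\<^sup>2 Q\<close>.\<close>

lemma scaled_structure_equation_fails:
  assumes n: "CARD('n::finite) \<ge> 2" and k: "(\<integral>u. u \<partial>M) \<noteq> 0" and q: "0 < q" "q < 1"
  obtains V W Z :: "'n::finite cmat" and D1 D2 where "V \<in> Herm" "W \<in> Herm" "Z \<in> Herm"
    "((\<lambda>\<sigma>. Gam \<sigma> W Z) has_derivative D1) (at (mat 1) within PD)"
    "((\<lambda>\<sigma>. Gam \<sigma> V Z) has_derivative D2) (at (mat 1) within PD)"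
    "q *\<^sub>R (D1 V - D2 W) + (q * q) *\<^sub>R (Gam (mat 1) V (Gam (mat 1) W Z) - Gam (mat 1) W (Gam (mat 1) V Z)) \<noteq> 0"
proof -
  obtain V W Z :: "'n cmat" where H: "V \<in> Herm" "W \<in> Herm" "Z \<in> Herm"
    and Q: "Gam (mat 1) V (Gam (mat 1) W Z) - Gam (mat 1) W (Gam (mat 1) V Z) \<noteq> 0" (is "?Q \<noteq> 0")
    using Gam_commutator_nonzero [OF n k] by blast
  obtain D1 where D1: "((\<lambda>\<sigma>. Gam \<sigma> W Z) has_derivative D1) (at (mat 1) within PD)"
    using Gam_differentiable [OF mat_1_PD] unfolding differentiable_def by blast
  obtain D2 where D2: "((\<lambda>\<sigma>. Gam \<sigma> V Z) has_derivative D2) (at (mat 1) within PD)"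
    using Gam_differentiable [OF mat_1_PD] unfolding differentiable_def by blast
  have "D1 V - D2 W = - ?Q"
    using Gam_structure_equation [OF mat_1_PD H D1 D2] by (rule eq_neg_iff_add_eq_0 [THEN iffD2])
  then have "q *\<^sub>R (D1 V - D2 W) + (q * q) *\<^sub>R ?Q = (q * q - q) *\<^sub>R ?Q"
    by (simp only: scaleR_minus_right scaleR_diff_left) simp
  moreover have "q * q - q \<noteq> 0" using q by simp
  ultimately have "q *\<^sub>R (D1 V - D2 W) + (q * q) *\<^sub>R ?Q \<noteq> 0" using Q by simp
  with H D1 D2 show ?thesis by (rule that)
qed

text \<open>The formula for D is assumed for Y merely differentiable at \<rho> and for X known at
  \<rho>, because it is applied to Y a covariant derivative and to X a Lie bracket.\<close>

lemma scaled_not_flat: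
  fixes D :: "'n::finite conn"
  assumes n: "CARD('n) \<ge> 2" and k: "(\<integral>u. u \<partial>M) \<noteq> 0" and q: "0 < q" "q < 1"
    and D: "\<And>\<rho> X Y Y'. \<rho> \<in> PD \<Longrightarrow> X \<rho> \<in> Herm \<Longrightarrow> (\<And>\<sigma>. \<sigma> \<in> PD \<Longrightarrow> Y \<sigma> \<in> Herm) \<Longrightarrow>
      (Y has_derivative Y') (at \<rho> within PD) \<Longrightarrow> D X Y \<rho> = Y' (X \<rho>) + q *\<^sub>R Gam \<rho> (X \<rho>) (Y \<rho>)"
  shows "\<not> flat_conn D"
proof
  assume flat: "flat_conn D"
  obtain V W Z :: "'n cmat" and D1 D2 where H: "V \<in> Herm" "W \<in> Herm" "Z \<in> Herm"
    and D1: "((\<lambda>\<sigma>. Gam \<sigma> W Z) has_derivative D1) (at (mat 1) within PD)"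
    and D2: "((\<lambda>\<sigma>. Gam \<sigma> V Z) has_derivative D2) (at (mat 1) within PD)"
    and ne: "q *\<^sub>R (D1 V - D2 W) + (q * q) *\<^sub>R (Gam (mat 1) V (Gam (mat 1) W Z) - Gam (mat 1) W (Gam (mat 1) V Z)) \<noteq> 0"
    using scaled_structure_equation_fails [OF n k q] by metis
  have const: "D (\<lambda>_. A) (\<lambda>_. B) \<sigma> = q *\<^sub>R Gam \<sigma> A B" if "A \<in> Herm" "B \<in> Herm" "\<sigma> \<in> PD" for A B \<sigma>
    using D [of \<sigma> "\<lambda>_. A" "\<lambda>_. B" "\<lambda>_. 0"] that by simp
  have second: "D (\<lambda>_. A) (D (\<lambda>_. B) (\<lambda>_. Z)) (mat 1) = q *\<^sub>R E A + (q * q) *\<^sub>R Gam (mat 1) A (Gam (mat 1) B Z)"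
    if "A \<in> Herm" "B \<in> Herm" and E: "((\<lambda>\<sigma>. Gam \<sigma> B Z) has_derivative E) (at (mat 1) within PD)" for A B E
  proof -
    have "(D (\<lambda>_. B) (\<lambda>_. Z) has_derivative (\<lambda>h. q *\<^sub>R E h)) (at (mat 1) within PD)"
      by (rule has_derivative_transform [OF mat_1_PD _ has_derivative_scaleR_right [OF E]])
        (simp add: const that H)
    from D [OF mat_1_PD _ _ this, of "\<lambda>_. A"] show ?thesis
      by (simp add: const that H mat_1_PD Gam_Herm linear_cmul [OF linear_Gam_right])
  qed
  have "D (lie_bracket (\<lambda>_. V) (\<lambda>_. W)) (\<lambda>_. Z) (mat 1) = 0"
    using D [OF mat_1_PD, of "lie_bracket (\<lambda>_. V) (\<lambda>_. W)" "\<lambda>_. Z" "\<lambda>_. 0"] H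
    by (simp add: lie_bracket_const Gam_zero mat_1_PD)
  moreover have "conn_curvature D (\<lambda>_. V) (\<lambda>_. W) (\<lambda>_. Z) (mat 1) = 0"
    using flat smooth_vfield_const H mat_1_PD unfolding flat_conn_def by blast
  ultimately have "q *\<^sub>R D1 V + (q * q) *\<^sub>R Gam (mat 1) V (Gam (mat 1) W Z) -
      (q *\<^sub>R D2 W + (q * q) *\<^sub>R Gam (mat 1) W (Gam (mat 1) V Z)) = 0"
    unfolding conn_curvature_def second [OF H(1,2) D1] second [OF H(2,1) D2] by simp
  with ne show False by (simp add: algebra_simps)
qed

text \<open>Agreement on constant fields at every \<rho> identifies the symbols as functions, hence
  also their derivatives along Hermitian directions; the structure equation for \<beta> then
  contradicts the one that fails after scaling by q.\<close>

lemma scaled_Gam_not_alpha_conn: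
  assumes n: "CARD('n::finite) \<ge> 2" and k: "(\<integral>u. u \<partial>M) \<noteq> 0" and q: "0 < q" "q < 1"
    and N: "alpha_kernel N \<beta>"
  obtains V W \<rho> :: "'n::finite cmat" where "\<rho> \<in> PD" "V \<in> Herm" "W \<in> Herm" "alpha_conn \<beta> (\<lambda>_. V) (\<lambda>_. W) \<rho> \<noteq> q *\<^sub>R Gam \<rho> V W"
proof (rule ccontr)
  interpret N: alpha_kernel N \<beta> by (rule N)
  note result = that
  assume "\<not> thesis"
  then have eq: "N.Gam \<rho> V W = q *\<^sub>R Gam \<rho> V W" if "\<rho> \<in> PD" "V \<in> Herm" "W \<in> Herm" for \<rho> V W :: "'n cmat"
    using that N.alpha_conn_const [OF that] result by metis
  obtain V W Z :: "'n cmat" and D1 D2 where H: "V \<in> Herm" "W \<in> Herm" "Z \<in> Herm"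
    and D1: "((\<lambda>\<sigma>. Gam \<sigma> W Z) has_derivative D1) (at (mat 1) within PD)"
    and D2: "((\<lambda>\<sigma>. Gam \<sigma> V Z) has_derivative D2) (at (mat 1) within PD)"
    and ne: "q *\<^sub>R (D1 V - D2 W) + (q * q) *\<^sub>R (Gam (mat 1) V (Gam (mat 1) W Z) - Gam (mat 1) W (Gam (mat 1) V Z)) \<noteq> 0"
    using scaled_structure_equation_fails [OF n k q] by metis
  have "((\<lambda>\<sigma>. N.Gam \<sigma> W Z) has_derivative (\<lambda>h. q *\<^sub>R D1 h)) (at (mat 1) within PD)"
    by (rule has_derivative_transform [OF mat_1_PD _ has_derivative_scaleR_right [OF D1]]) (simp add: eq H)
  moreover have "((\<lambda>\<sigma>. N.Gam \<sigma> V Z) has_derivative (\<lambda>h. q *\<^sub>R D2 h)) (at (mat 1) within PD)"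
    by (rule has_derivative_transform [OF mat_1_PD _ has_derivative_scaleR_right [OF D2]]) (simp add: eq H)
  ultimately have "(q *\<^sub>R D1 V - q *\<^sub>R D2 W) + (N.Gam (mat 1) V (N.Gam (mat 1) W Z) - N.Gam (mat 1) W (N.Gam (mat 1) V Z)) = 0"
    by (rule N.Gam_structure_equation [OF mat_1_PD H])
  with ne show False
    by (simp add: eq H mat_1_PD Gam_Herm linear_cmul [OF linear_Gam_right] algebra_simps)
qed

end

section \<open>Kernels of the alpha-connections\<close>

lemma measure_distr_space:
  assumes f: "f \<in> measurable M N"
  shows "measure (distr M N f) (space (distr M N f)) = measure M (space M)"
proof -
  have "f -` space N \<inter> space M = space M" using measurable_space [OF f] by auto
  then show ?thesis by (simp add: measure_distr [OF f])
qed

text \<open>For \<alpha> = -1 the derivative of \<open>f_alpha\<close> is 1 and M is a point mass at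
  0. This case stands apart because the density s^t / (s + 1)^2 of the general construction is not
  integrable for t = 1.\<close>

lemma alpha_kernel_mixture: "\<exists>M. alpha_kernel M (-1) \<and> (\<integral>u. u \<partial>M) = 0"
proof -
  \<comment> \<open>Any probability measure would do; its image under the constant map 0 is the
    point mass.\<close>
  define N where "N = restrict_space lborel {0..1::real}"
  have N: "emeasure N (space N) = 1" by (simp add: N_def space_restrict_space emeasure_restrict_space)
  then have finN: "finite_measure N" by (intro finite_measureI) simp
  let ?M = "distr N (restrict_space borel {0..1}) (\<lambda>_. 0 :: real)"
  have meas: "(\<lambda>_. 0 :: real) \<in> measurable N (restrict_space borel {0..1})"
    by (rule measurable_const) (simp add: space_restrict_space)
  have mN: "measure N (space N) = 1" using N by (simp add: measure_def)
  have "alpha_kernel ?M (-1)"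
  proof (unfold alpha_kernel_def alpha_kernel_axioms_def, intro conjI allI impI)
    show "finite_measure ?M" by (rule finite_measure.finite_measure_distr [OF finN meas])
    show "sets ?M = sets (restrict_space borel {0..1})" by simp
    show "measure ?M (space ?M) > 0"
      unfolding measure_distr_space [OF meas] mN by simp
    fix x :: real assume x: "x > 0"
    have "(\<integral>u. 1 / (1 - u + u * x)\<^sup>2 \<partial>?M) = (\<integral>u. 1 \<partial>N)"
      using denominator_pos [OF x]
      by (subst integral_distr [OF meas]) (auto intro!: borel_measurable_continuous_on_restrict continuous_intros simp: less_imp_neq [THEN not_sym])
    then have "(\<integral>u. 1 / (1 - u + u * x)\<^sup>2 \<partial>?M) = 1" using mN by simp
    moreover have "(f_alpha (-1) has_real_derivative 1) (at x)"
      by (rule has_field_derivative_transform_within_open [OF DERIV_ident, of "{0<..}"])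
         (use x in \<open>simp_all add: f_alpha_def\<close>)
    ultimately show "(f_alpha (-1) has_real_derivative (\<integral>u. 1 / (1 - u + u * x)\<^sup>2 \<partial>?M)) (at x)"
      by simp
  qed
  moreover have "(\<integral>u. u \<partial>?M) = 0"
    by (subst integral_distr [OF meas]) (auto intro!: borel_measurable_continuous_on_restrict continuous_intros)
  ultimately show ?thesis by blast
qed

text \<open>For \<open>t = (1 - \<alpha>) / 2\<close> the substitution \<open>s \<mapsto> x s\<close> shows that the integral of
  \<open>s\<^sup>t / (s + x)\<^sup>2\<close> over \<open>s > 0\<close> is a constant multiple of \<open>x\<^sup>t\<^sup>-\<^sup>1\<close>, the derivative of \<open>f\<^sub>\<alpha>\<close>; the kernel is the
  image of the normalized density \<open>s\<^sup>t / (s + 1)\<^sup>2\<close> under \<open>s \<mapsto> 1 / (1 + s)\<close>.\<close>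

lemma alpha_kernel_exists:
  assumes \<alpha>: "-1 < \<alpha>" "\<alpha> \<le> 1"
  shows "\<exists>M. alpha_kernel M \<alpha>"
proof -
  define t where "t = (1 - \<alpha>) / 2"
  have t: "0 \<le> t" "t < 1" using \<alpha> by (auto simp: t_def)
  define v where "v x s = indicator {0<..} s * (s powr t / (s + x)\<^sup>2)" for x s :: real
  have v_nonneg: "v x s \<ge> 0" for x s by (simp add: v_def)
  have v_meas [measurable]: "v x \<in> borel_measurable borel" for x unfolding v_def by measurable
  have v_int: "integrable lborel (v 1)"
  proof -
    \<comment> \<open>The majorant (1 + s)^(t - 2) has a finite integral because t < 1.\<close>
    have "(\<integral>\<^sup>+s. ennreal ((1 + s) powr (t - 2)) * indicator {0..} s \<partial>lborel) = 0 - (- ((1 + 0) powr (t - 1) / (1 - t)))"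
    proof (rule nn_integral_FTC_atLeast)
      show "((\<lambda>s. - ((1 + s) powr (t - 1) / (1 - t))) \<longlongrightarrow> 0) at_top"
      proof -
        have "((\<lambda>s. (1 + s) powr (t - 1)) \<longlongrightarrow> 0) at_top"
          using t by (intro tendsto_neg_powr filterlim_tendsto_add_at_top [OF tendsto_const] filterlim_ident) auto
        from tendsto_minus [OF tendsto_divide [OF this tendsto_const [of "1 - t"]]] t show ?thesis by simp
      qed
      fix s :: real assume "0 \<le> s"
      then have "((\<lambda>s. (1 + s) powr (t - 1)) has_real_derivative (t - 1) * (1 + s) powr (t - 2)) (at s)"
        by (auto intro!: derivative_eq_intros)
      from DERIV_minus [OF DERIV_cdivide [OF this, of "1 - t"]]
      show "((\<lambda>s. - ((1 + s) powr (t - 1) / (1 - t))) has_real_derivative (1 + s) powr (t - 2)) (at s)"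
      proof (rule DERIV_cong)
        have "- ((t - 1) * a / (1 - t)) = a" for a using t by (simp add: field_simps)
        then show "- ((t - 1) * (1 + s) powr (t - 2) / (1 - t)) = (1 + s) powr (t - 2)" .
      qed
    qed simp_all
    also have "\<dots> < \<infinity>" by simp
    finally have fin: "(\<integral>\<^sup>+s. ennreal ((1 + s) powr (t - 2)) * indicator {0..} s \<partial>lborel) < \<infinity>" .
    have "v 1 s \<le> (1 + s) powr (t - 2) * indicator {0..} s" for s
    proof (cases "s > 0")
      case True
      have "s powr t / (s + 1)\<^sup>2 \<le> (1 + s) powr t / (s + 1)\<^sup>2"
        using True t by (intro divide_right_mono powr_mono2) auto
      also have "\<dots> = (1 + s) powr (t - 2)"
        using True by (simp add: powr_diff add.commute)
      finally show ?thesis using True by (simp add: v_def)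
    qed (simp add: v_def)
    then have "(\<integral>\<^sup>+s. ennreal (v 1 s) \<partial>lborel) \<le> (\<integral>\<^sup>+s. ennreal ((1 + s) powr (t - 2)) * indicator {0..} s \<partial>lborel)"
      by (intro nn_integral_mono) (metis ennreal_leI ennreal_mult' indicator_pos_le ennreal_indicator powr_ge_zero)
    then show ?thesis using fin v_nonneg by (intro integrableI_nonneg) auto
  qed
  have v_scale: "(\<integral>s. v x s \<partial>lborel) = x powr (t - 1) * (\<integral>s. v 1 s \<partial>lborel)" if x: "x > 0" for x
  proof -
    have "(\<integral>s. v x s \<partial>lborel) = \<bar>x\<bar> *\<^sub>R (\<integral>s. v x (0 + x * s) \<partial>lborel)"
      by (rule lborel_integral_real_affine) (use x in simp)
    also have "(\<lambda>s. v x (0 + x * s)) = (\<lambda>s. x powr (t - 2) * v 1 s)"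
    proof
      fix s
      have "(x * s + x)\<^sup>2 = x\<^sup>2 * (s + 1)\<^sup>2" by (simp add: power2_eq_square algebra_simps)
      then show "v x (0 + x * s) = x powr (t - 2) * v 1 s"
        using x by (auto simp: v_def indicator_def zero_less_mult_iff powr_mult powr_diff)
    qed
    also have "\<bar>x\<bar> *\<^sub>R (\<integral>s. x powr (t - 2) * v 1 s \<partial>lborel) = (x * x powr (t - 2)) * (\<integral>s. v 1 s \<partial>lborel)"
      using x by simp
    also have "x * x powr (t - 2) = x powr (t - 1)"
      using x by (simp add: powr_diff power2_eq_square)
    finally show ?thesis .
  qed
  define c where "c = (\<integral>s. v 1 s \<partial>lborel)"
  have c: "c > 0"
  proof -
    \<comment> \<open>On [1,2] the numerator s^t is at least 1 and the denominator at most
      9.\<close>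
    have "(1 / 9 :: real) = (\<integral>s. indicator {1..2} s * (1 / 9) \<partial>(lborel :: real measure))"
      by simp
    also have "\<dots> \<le> c"
      unfolding c_def
    proof (rule integral_mono)
      show "integrable lborel (\<lambda>s :: real. indicator {1..2} s * (1 / 9 :: real))" by simp
      fix s :: real
      show "indicator {1..2} s * (1 / 9) \<le> v 1 s"
      proof (cases "s \<in> {1..2}")
        case True
        then have "(s + 1)\<^sup>2 \<le> 3\<^sup>2" by (intro power_mono) auto
        moreover have "1 \<le> s powr t" using True t by (simp add: ge_one_powr_ge_zero)
        ultimately have "1 / 9 \<le> s powr t / (s + 1)\<^sup>2"
          using True by (intro frac_le) auto
        then show ?thesis using True by (simp add: v_def)
      qed (simp add: v_nonneg)
    qed (rule v_int)
    finally show ?thesis by simp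
  qed
  define N where "N = density lborel (\<lambda>s. ennreal (v 1 s / c))"
  have N_int: "(\<integral>s. g s \<partial>N) = (\<integral>s. v 1 s / c * g s \<partial>lborel)" if "g \<in> borel_measurable borel" for g :: "real \<Rightarrow> real"
    unfolding N_def using that c v_nonneg by (subst integral_density) auto
  have N_mass: "emeasure N (space N) = 1"
  proof -
    have "emeasure N (space N) = (\<integral>\<^sup>+s. ennreal (v 1 s / c) \<partial>lborel)"
      by (simp add: N_def emeasure_density)
    also have "\<dots> = ennreal (\<integral>s. v 1 s / c \<partial>lborel)"
      using v_int v_nonneg c by (intro nn_integral_eq_integral) auto
    also have "(\<integral>s. v 1 s / c \<partial>lborel) = 1" using c by (simp add: c_def)
    finally show ?thesis by simp
  qed
  have finN: "finite_measure N" using N_mass by (intro finite_measureI) simp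
  \<comment> \<open>The absolute value sends the whole line into [0,1]; the density vanishes for s
    \<le> 0, so only 1 / (1 + s) counts.\<close>
  define \<phi> where "\<phi> s = 1 / (1 + \<bar>s\<bar>)" for s :: real
  have [measurable]: "\<phi> \<in> borel_measurable borel" unfolding \<phi>_def by measurable
  let ?B = "restrict_space borel {0..1::real}"
  have \<phi>: "\<phi> \<in> measurable N ?B"
  proof -
    have "\<phi> \<in> measurable borel ?B"
      by (rule measurable_restrict_space2) (auto simp: \<phi>_def)
    then show ?thesis by (simp add: N_def cong: measurable_cong_sets)
  qed
  let ?M = "distr N ?B \<phi>"
  have "alpha_kernel ?M \<alpha>"
  proof (unfold alpha_kernel_def alpha_kernel_axioms_def, intro conjI allI impI)
    show "finite_measure ?M" by (rule finite_measure.finite_measure_distr [OF finN \<phi>])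
    show "sets ?M = sets ?B" by simp
    show "measure ?M (space ?M) > 0"
      unfolding measure_distr_space [OF \<phi>] using N_mass by (simp add: measure_def)
    fix x :: real assume x: "x > 0"
    have "(\<integral>u. 1 / (1 - u + u * x)\<^sup>2 \<partial>?M) = (\<integral>s. 1 / (1 - \<phi> s + \<phi> s * x)\<^sup>2 \<partial>N)"
      using denominator_pos [OF x]
      by (intro integral_distr [OF \<phi>])
         (auto intro!: borel_measurable_continuous_on_restrict continuous_intros simp: less_imp_neq [THEN not_sym])
    also have "\<dots> = (\<integral>s. v 1 s / c * (1 / (1 - \<phi> s + \<phi> s * x)\<^sup>2) \<partial>lborel)"
      by (rule N_int) (simp add: \<phi>_def)
    also have "\<dots> = (\<integral>s. v x s / c \<partial>lborel)"
    proof (rule Bochner_Integration.integral_cong)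
      fix s
      \<comment> \<open>With u = 1 / (1 + s) one has 1 - u + u x = (s + x) / (s + 1), which
        exchanges the denominators (s + 1)^2 and (s + x)^2.\<close>
      show "v 1 s / c * (1 / (1 - \<phi> s + \<phi> s * x)\<^sup>2) = v x s / c"
      proof (cases "s > 0")
        case True
        then have \<phi>1: "\<phi> s * (s + 1) = 1" by (simp add: \<phi>_def)
        have "(1 - \<phi> s + \<phi> s * x) * (s + 1) = (s + 1) - \<phi> s * (s + 1) + \<phi> s * (s + 1) * x"
          by (simp add: algebra_simps)
        then have "1 - \<phi> s + \<phi> s * x = (s + x) / (s + 1)"
          using True by (intro eq_divide_imp) (simp_all add: \<phi>1)
        then show ?thesis using True x by (simp add: v_def power_divide)
      qed (simp add: v_def)
    qed simp
    also have "\<dots> = x powr (t - 1)"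
      using c by (simp add: v_scale [OF x] c_def [symmetric])
    finally have I: "(\<integral>u. 1 / (1 - u + u * x)\<^sup>2 \<partial>?M) = x powr (t - 1)" .
    have "(f_alpha \<alpha> has_real_derivative x powr (t - 1)) (at x)"
    proof (cases "\<alpha> = 1")
      case True
      then have "f_alpha \<alpha> = ln" by (simp add: f_alpha_def fun_eq_iff)
      moreover have "x powr (t - 1) = 1 / x" using x True by (simp add: t_def powr_minus_divide)
      ultimately show ?thesis using DERIV_ln_divide [OF x] by simp
    next
      case False
      then have t0: "t > 0" using \<alpha> by (simp add: t_def)
      have "f_alpha \<alpha> = (\<lambda>x. 1 / t * x powr t)"
        using False by (simp add: f_alpha_def fun_eq_iff t_def)
      moreover have "((\<lambda>x. 1 / t * x powr t) has_real_derivative 1 / t * (t * x powr (t - 1))) (at x)"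
        by (intro DERIV_cmult has_real_derivative_powr x)
      ultimately show ?thesis using t0 by simp
    qed
    then show "(f_alpha \<alpha> has_real_derivative (\<integral>u. 1 / (1 - u + u * x)\<^sup>2 \<partial>?M)) (at x)"
      by (simp add: I)
  qed
  then show ?thesis by blast
qed

theorem mainTheorem2:
  assumes "CARD('n::finite) \<ge> 2"
  shows "(\<forall>p\<in>{0..1}. flat_conn (conn_comb p mixture_conn (1 - p) exponential_conn :: 'n conn)
                        \<longleftrightarrow> p = 0 \<or> p = 1) \<and>
         (\<forall>\<alpha>\<in>{-1<..<1}.
            \<not> flat_conn (conn_comb ((1 + \<alpha>) / 2) exponential_conn
                                   ((1 - \<alpha>) / 2) mixture_conn :: 'n conn) \<and>
            \<not> conn_eq (conn_comb ((1 + \<alpha>) / 2) exponential_conn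
                                 ((1 - \<alpha>) / 2) mixture_conn :: 'n conn)
                      (alpha_conn \<alpha>))"
proof -
  obtain Mm where m: "alpha_kernel Mm (-1)" and Mm: "(\<integral>u. u \<partial>Mm) = 0"
    using alpha_kernel_mixture by blast
  interpret m: alpha_kernel Mm "-1" by (rule m)
  obtain Me where "alpha_kernel Me 1" using alpha_kernel_exists [of 1] by auto
  then interpret e: alpha_kernel Me 1 .
  \<comment> \<open>The derivative of the logarithm differs at 1 and 2, which excludes a vanishing
    first moment.\<close>
  have "(f_alpha 1 has_real_derivative 1) (at 1)" "(f_alpha 1 has_real_derivative 1 / 2) (at 2)"
    using DERIV_ln_divide [of 1] DERIV_ln_divide [of 2] by (simp_all add: f_alpha_def [abs_def])
  then have "(\<integral>u. 1 / (1 - u + u * 1)\<^sup>2 \<partial>Me) = 1" "(\<integral>u. 1 / (1 - u + u * 2)\<^sup>2 \<partial>Me) = 1 / 2"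
    using e.f_deriv [of 1] e.f_deriv [of 2] DERIV_unique by fastforce+
  then have k: "(\<integral>u. u \<partial>Me) \<noteq> 0"
    using e.integral_u_eq_0 [of 1] e.integral_u_eq_0 [of 2] by auto
  have mixture: "mixture_conn X Y \<rho> = Y' (X \<rho>)"
    if "\<rho> \<in> PD" "X \<rho> \<in> Herm" "\<And>\<sigma>. \<sigma> \<in> PD \<Longrightarrow> Y \<sigma> \<in> Herm" "(Y has_derivative Y') (at \<rho> within PD)"
    for X Y :: "'n vfield" and \<rho> Y'
    using m.alpha_conn_formula [of \<rho> X Y Y', OF that] m.Gam_eq_0 [OF Mm that(1)]
    by (simp add: mixture_conn_def)
  have exponential: "exponential_conn X Y \<rho> = Y' (X \<rho>) + e.Gam \<rho> (X \<rho>) (Y \<rho>)"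
    if "\<rho> \<in> PD" "X \<rho> \<in> Herm" "\<And>\<sigma>. \<sigma> \<in> PD \<Longrightarrow> Y \<sigma> \<in> Herm" "(Y has_derivative Y') (at \<rho> within PD)"
    for X Y :: "'n vfield" and \<rho> Y'
    using e.alpha_conn_formula [of \<rho> X Y Y', OF that] by (simp add: exponential_conn_def)
  \<comment> \<open>The weights add up to 1, so the derivative terms combine to Y', and only the
    exponential part contributes Christoffel symbols, with weight q.\<close>
  have not_flat_1: "\<not> flat_conn (conn_comb p mixture_conn q exponential_conn :: 'n conn)"
    if pq: "p = 1 - q" "0 < q" "q < 1" for p q
    by (rule e.scaled_not_flat [OF assms k pq(2,3)])
       (simp add: conn_comb_def mixture exponential pq(1) scaleR_add_right flip: scaleR_add_left add.assoc)
  have comm: "conn_comb a D b E = conn_comb b E a D" for a b and D E :: "'n conn"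
    by (simp add: conn_comb_def fun_eq_iff add.commute)
  have "flat_conn (conn_comb p mixture_conn (1 - p) exponential_conn :: 'n conn) \<longleftrightarrow> p = 0 \<or> p = 1"
    if p: "p \<in> {0..1}" for p
  proof -
    have "conn_comb 0 mixture_conn (1 - 0) exponential_conn = (alpha_conn 1 :: 'n conn)"
      "conn_comb 1 mixture_conn (1 - 1) exponential_conn = (alpha_conn (-1) :: 'n conn)"
      by (simp_all add: conn_comb_def fun_eq_iff mixture_conn_def exponential_conn_def)
    then have "p = 0 \<or> p = 1 \<Longrightarrow> flat_conn (conn_comb p mixture_conn (1 - p) exponential_conn :: 'n conn)"
      using e.flat_alpha_conn m.flat_alpha_conn by metis
    moreover have "p \<noteq> 0 \<Longrightarrow> p \<noteq> 1 \<Longrightarrow> \<not> flat_conn (conn_comb p mixture_conn (1 - p) exponential_conn :: 'n conn)"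
      using p by (intro not_flat_1) auto
    ultimately show ?thesis by blast
  qed
  moreover have "\<not> flat_conn (conn_comb ((1 + \<alpha>) / 2) exponential_conn ((1 - \<alpha>) / 2) mixture_conn :: 'n conn)"
    if "\<alpha> \<in> {-1<..<1}" for \<alpha>
    unfolding comm [of _ exponential_conn] using that by (intro not_flat_1) (auto simp: field_simps)
  moreover have "\<not> conn_eq (conn_comb ((1 + \<alpha>) / 2) exponential_conn ((1 - \<alpha>) / 2) mixture_conn :: 'n conn) (alpha_conn \<alpha>)"
    if \<alpha>: "\<alpha> \<in> {-1<..<1}" for \<alpha>
  proof
    assume eq: "conn_eq (conn_comb ((1 + \<alpha>) / 2) exponential_conn ((1 - \<alpha>) / 2) mixture_conn :: 'n conn) (alpha_conn \<alpha>)"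
    \<comment> \<open>Any kernel for \<alpha> serves: it brings the structure equation of the
      alpha-connection, whatever its symbols are.\<close>
    obtain Ma where Ma: "alpha_kernel Ma \<alpha>" using alpha_kernel_exists [of \<alpha>] \<alpha> by auto
    have q: "0 < (1 + \<alpha>) / 2" "(1 + \<alpha>) / 2 < 1" using \<alpha> by auto
    obtain V W \<rho> :: "'n cmat" where H: "\<rho> \<in> PD" "V \<in> Herm" "W \<in> Herm"
      and ne: "alpha_conn \<alpha> (\<lambda>_. V) (\<lambda>_. W) \<rho> \<noteq> ((1 + \<alpha>) / 2) *\<^sub>R e.Gam \<rho> V W"
      using e.scaled_Gam_not_alpha_conn [OF assms k q Ma] by blast
    have "conn_comb ((1 + \<alpha>) / 2) exponential_conn ((1 - \<alpha>) / 2) mixture_conn (\<lambda>_. V) (\<lambda>_. W) \<rho> = alpha_conn \<alpha> (\<lambda>_. V) (\<lambda>_. W) \<rho>"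
      using eq smooth_vfield_const H unfolding conn_eq_def by blast
    moreover have "conn_comb ((1 + \<alpha>) / 2) exponential_conn ((1 - \<alpha>) / 2) mixture_conn (\<lambda>_. V) (\<lambda>_. W) \<rho> = ((1 + \<alpha>) / 2) *\<^sub>R e.Gam \<rho> V W"
      using mixture [of \<rho> "\<lambda>_. V" "\<lambda>_. W" "\<lambda>_. 0"] exponential [of \<rho> "\<lambda>_. V" "\<lambda>_. W" "\<lambda>_. 0"] H
      by (simp add: conn_comb_def)
    ultimately show False using ne by simp
  qed
  ultimately show ?thesis by blast
qed

end
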